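(* There exist a real-time 1-counter Büchi automaton $\mathcal A$ and a 2-tape Büchi automaton $\mathcal B$ such that the $\omega$-language $L(\mathcal A)$ and the infinitary rational relation $L(\mathcal B)$ are arithmetical $\Delta^0_3$ sets, and such that Player 2 has a winning strategy in each of the Gale–Stewart games $G(L(\mathcal A))$ and $G(L(\mathcal B))$ but has no hyperarithmetical winning strategy in either of these games.
   Context: Gale–Stewart game $G(A)$, $A\subseteq X^\omega$ ($X$ finite): players alternately write letters of $X$ (Player 1 first); Player 1 wins iff the resulting $\omega$-word is in $A$; a strategy for Player 2 is a map $(X^2)^\star X\to X$, coded recursively as a subset of $\mathbb N$; hyperarithmetical means $\Delta^1_1$ (as a subset of $\mathbb N$). Arithmetical $\Delta^0_3$ subsets of $X^\omega$: sets that are both $\Sigma^0_3$ and $\Pi^0_3$ in the arithmetical hierarchy of $\omega$-languages ($L\in\Sigma^0_n$ iff defined by $n$ number quantifiers over a recursive relation on $(a_1,\dots,a_{n-1},\sigma[a_n+1])$). A real-time 1-counter Büchi automaton has finitely many states, one counter in $\mathbb N$, reads one letter per transition, can test the counter for zero and change it by $0,\pm1$, with Büchi acceptance. A 2-tape Büchi automaton $(K,\Sigma,\Gamma,\Delta,q_0,F)$ has finite $\Delta\subseteq K\times\Sigma^\star\times\Gamma^\star\times K$ and accepts $(u,v)\in\Sigma^\omega\times\Gamma^\omega$ if some infinite sequence of transitions from $q_0$ visiting $F$ infinitely often has concatenated input $u$ and output $v$; its language (an infinitary rational relation) is regarded as a subset of $(\Sigma\times\Gamma)^\omega$. *)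

theory Defs
  imports Complex_Main "HOL-Library.Omega_Words_Fun" "HOL-Library.Nat_Bijection"
begin

section \<open>Recursive relations on the natural numbers\<close>

text \<open>
  Programs for the partial recursive functions, with argument lists read from the left.
  \<open>Prec f g\<close> recurses on the first argument and \<open>Mu f\<close> searches for the least first argument
  at which \<open>f\<close> is zero.
\<close>

datatype recf = Zero | Succ | Proj nat | Comp recf "recf list" | Prec recf recf | Mu recf

inductive computes :: "recf \<Rightarrow> nat list \<Rightarrow> nat \<Rightarrow> bool" where
  zero: "computes Zero xs 0"
| succ: "computes Succ (x # xs) (Suc x)"
| proj: "i < length xs \<Longrightarrow> computes (Proj i) xs (xs ! i)"
| comp: "list_all2 (\<lambda>g y. computes g xs y) gs ys \<Longrightarrow> computes f ys z \<Longrightarrow>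
           computes (Comp f gs) xs z"
| prec_0: "computes f xs z \<Longrightarrow> computes (Prec f g) (0 # xs) z"
| prec_Suc: "computes (Prec f g) (n # xs) y \<Longrightarrow> computes g (n # y # xs) z \<Longrightarrow>
           computes (Prec f g) (Suc n # xs) z"
| mu: "computes f (n # xs) 0 \<Longrightarrow> (\<And>m. m < n \<Longrightarrow> \<exists>y. computes f (m # xs) (Suc y)) \<Longrightarrow>
           computes (Mu f) xs n"
monos list.rel_mono

lemma computes_deterministic:
  "computes p xs y \<Longrightarrow> computes p xs z \<Longrightarrow> y = z"
proof (induction arbitrary: z rule: computes.induct)
  case (zero xs)
  then show ?case by (cases rule: computes.cases) simp_all
next
  case (succ x xs)
  then show ?case by (cases rule: computes.cases) simp_all
next
  case (proj i xs)
  from proj.prems show ?case by (cases rule: computes.cases) simp_all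
next
  case (comp xs gs ys f w)
  from comp.prems obtain ys' where
    ys': "list_all2 (\<lambda>g y. computes g xs y) gs ys'" "computes f ys' z"
    by (cases rule: computes.cases) blast
  have "ys = ys'"
    using comp.IH(1) ys'(1) by (intro nth_equalityI) (simp_all add: list_all2_conv_all_nth)
  then show ?case using comp.IH(2) ys'(2) by simp
next
  case (prec_0 f xs w g)
  from prec_0.prems have "computes f xs z" by (cases rule: computes.cases) simp_all
  then show ?case by (rule prec_0.IH)
next
  case (prec_Suc f g n xs y w)
  from prec_Suc.prems obtain y' where
    y': "computes (Prec f g) (n # xs) y'" "computes g (n # y' # xs) z"
    by (cases rule: computes.cases) blast
  from prec_Suc.IH(1)[OF y'(1)] y'(2) have "computes g (n # y # xs) z" by simp
  then show ?case by (rule prec_Suc.IH(2))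
next
  case (mu f n xs)
  from mu.prems have z: "computes f (z # xs) 0"
    by (cases rule: computes.cases) simp_all
  from mu.prems have z': "\<exists>y. computes f (m # xs) (Suc y)" if "m < z" for m
    by (cases rule: computes.cases) (use that in simp)
  have "\<not> z < n"
  proof
    assume "z < n"
    with mu.IH(2) obtain y where "\<forall>v. computes f (z # xs) v \<longrightarrow> Suc y = v" by blast
    with z show False by blast
  qed
  moreover have "\<not> n < z"
  proof
    assume "n < z"
    with z' obtain y where "computes f (n # xs) (Suc y)" by blast
    with mu.IH(1) show False by blast
  qed
  ultimately show ?case by simp
qed

definition recursive_rel :: "nat \<Rightarrow> (nat list \<Rightarrow> bool) \<Rightarrow> bool" where
  "recursive_rel k R \<longleftrightarrow>
     (\<exists>p. \<forall>xs. length xs = k \<longrightarrow> computes p xs (if R xs then 1 else 0))"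


section \<open>Arithmetical and analytical hierarchies\<close>

text \<open>\<open>alt_quant b n P\<close> prefixes \<open>P\<close> with \<open>n\<close> alternating number quantifiers, the outermost
  one being existential iff \<open>b\<close> holds.\<close>

fun alt_quant :: "bool \<Rightarrow> nat \<Rightarrow> (nat list \<Rightarrow> bool) \<Rightarrow> bool" where
  "alt_quant b 0 P \<longleftrightarrow> P []"
| "alt_quant True (Suc n) P \<longleftrightarrow> (\<exists>a. alt_quant False n (\<lambda>as. P (a # as)))"
| "alt_quant False (Suc n) P \<longleftrightarrow> (\<forall>a. alt_quant True n (\<lambda>as. P (a # as)))"

text \<open>
  For numbers \<open>as = [a\<^sub>1, \<dots>, a\<^sub>n]\<close>, \<open>n \<ge> 1\<close>, the following says that
  \<open>(xs, a\<^sub>1, \<dots>, a\<^bsub>n-1\<^esub>, \<sigma>[a\<^sub>n + 1])\<close> is in \<open>R\<close>, where \<open>\<sigma>[m]\<close> is the initial segment of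
  length \<open>m\<close> of \<open>\<sigma>\<close>, coded by a number.
\<close>

definition matrix :: "(nat list \<Rightarrow> bool) \<Rightarrow> nat list \<Rightarrow> nat word \<Rightarrow> nat list \<Rightarrow> bool" where
  "matrix R xs \<sigma> as \<longleftrightarrow> R (xs @ butlast as @ [list_encode (prefix (Suc (last as)) \<sigma>)])"

definition omega_words :: "'a set \<Rightarrow> 'a word set" where
  "omega_words X = {\<sigma>. range \<sigma> \<subseteq> X}"

text \<open>
  Throughout, \<open>c\<close> is an injective coding of the letters by numbers; for a finite alphabet all
  such codings are recursively equivalent.
\<close>

definition Sigma0 :: "('a \<Rightarrow> nat) \<Rightarrow> 'a set \<Rightarrow> nat \<Rightarrow> 'a word set \<Rightarrow> bool" where
  "Sigma0 c X n L \<longleftrightarrow> 1 \<le> n \<and> L \<subseteq> omega_words X \<and>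
     (\<exists>R. recursive_rel n R \<and>
        L = {\<sigma> \<in> omega_words X. alt_quant True n (matrix R [] (c \<circ> \<sigma>))})"

definition Pi0 :: "('a \<Rightarrow> nat) \<Rightarrow> 'a set \<Rightarrow> nat \<Rightarrow> 'a word set \<Rightarrow> bool" where
  "Pi0 c X n L \<longleftrightarrow> L \<subseteq> omega_words X \<and> Sigma0 c X n (omega_words X - L)"

definition Delta0 :: "('a \<Rightarrow> nat) \<Rightarrow> 'a set \<Rightarrow> nat \<Rightarrow> 'a word set \<Rightarrow> bool" where
  "Delta0 c X n L \<longleftrightarrow> Sigma0 c X n L \<and> Pi0 c X n L"

text \<open>
  A set of natural numbers is \<open>\<Sigma>\<^sup>1\<^sub>1\<close> if it is the projection along \<open>\<nat> \<Rightarrow> \<nat>\<close> of an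
  arithmetical relation.
\<close>

definition Sigma11 :: "nat set \<Rightarrow> bool" where
  "Sigma11 S \<longleftrightarrow> (\<exists>b n R. 1 \<le> n \<and> recursive_rel (Suc n) R \<and>
     S = {x. \<exists>\<phi> :: nat \<Rightarrow> nat. alt_quant b n (matrix R [x] \<phi>)})"

definition hyperarithmetical :: "nat set \<Rightarrow> bool" where
  "hyperarithmetical S \<longleftrightarrow> Sigma11 S \<and> Sigma11 (- S)"


section \<open>Gale--Stewart games\<close>

text \<open>Player 2 moves after the words of odd length, i.e. those in \<open>(X\<^sup>2)\<^sup>\<star>X\<close>; the values of
  a strategy at other words are irrelevant.\<close>

definition positions2 :: "'a set \<Rightarrow> 'a list set" where
  "positions2 X = {w \<in> lists X. odd (length w)}"

definition strategy2 :: "'a set \<Rightarrow> ('a list \<Rightarrow> 'a) \<Rightarrow> bool" where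
  "strategy2 X f \<longleftrightarrow> (\<forall>w \<in> positions2 X. f w \<in> X)"

definition follows2 :: "('a list \<Rightarrow> 'a) \<Rightarrow> 'a word \<Rightarrow> bool" where
  "follows2 f \<sigma> \<longleftrightarrow> (\<forall>i. odd i \<longrightarrow> \<sigma> i = f (prefix i \<sigma>))"

definition winning2 :: "'a set \<Rightarrow> 'a word set \<Rightarrow> ('a list \<Rightarrow> 'a) \<Rightarrow> bool" where
  "winning2 X A f \<longleftrightarrow> strategy2 X f \<and> (\<forall>\<sigma> \<in> omega_words X. follows2 f \<sigma> \<longrightarrow> \<sigma> \<notin> A)"

definition strategy_code :: "('a \<Rightarrow> nat) \<Rightarrow> 'a set \<Rightarrow> ('a list \<Rightarrow> 'a) \<Rightarrow> nat set" where
  "strategy_code c X f = (\<lambda>w. prod_encode (list_encode (map c w), c (f w))) ` positions2 X"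


section \<open>Real-time 1-counter Buechi automata\<close>

text \<open>
  A transition \<open>(p, a, z, q, d)\<close> leads from \<open>p\<close> to \<open>q\<close> reading \<open>a\<close> and adding \<open>d\<close> to the
  counter; it is enabled only if the counter is zero (\<open>z = True\<close>), respectively positive
  (\<open>z = False\<close>).
\<close>

record ('q, 'a) counter_aut =
  ca_states :: "'q set"
  ca_alphabet :: "'a set"
  ca_trans :: "('q \<times> 'a \<times> bool \<times> 'q \<times> int) set"
  ca_init :: 'q
  ca_final :: "'q set"

definition rt_counter_buchi :: "('q, 'a) counter_aut \<Rightarrow> bool" where
  "rt_counter_buchi M \<longleftrightarrow>
     finite (ca_states M) \<and> finite (ca_alphabet M) \<and>
     ca_init M \<in> ca_states M \<and> ca_final M \<subseteq> ca_states M \<and>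
     ca_trans M \<subseteq> ca_states M \<times> ca_alphabet M \<times> UNIV \<times> ca_states M \<times> {-1, 0, 1} \<and>
     (\<forall>p a q d. (p, a, True, q, d) \<in> ca_trans M \<longrightarrow> d \<noteq> -1)"

definition ca_run :: "('q, 'a) counter_aut \<Rightarrow> 'a word \<Rightarrow> 'q word \<Rightarrow> nat word \<Rightarrow> bool" where
  "ca_run M \<sigma> r n \<longleftrightarrow> r 0 = ca_init M \<and> n 0 = 0 \<and>
     (\<forall>i. (r i, \<sigma> i, n i = 0, r (Suc i), int (n (Suc i)) - int (n i)) \<in> ca_trans M)"

definition ca_lang :: "('q, 'a) counter_aut \<Rightarrow> 'a word set" where
  "ca_lang M = {\<sigma> \<in> omega_words (ca_alphabet M).
     \<exists>r n. ca_run M \<sigma> r n \<and> (\<exists>\<^sub>\<infinity>i. r i \<in> ca_final M)}"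


section \<open>2-tape Buechi automata\<close>

record ('q, 'a, 'b) tape2_aut =
  ta_states :: "'q set"
  ta_in :: "'a set"
  ta_out :: "'b set"
  ta_trans :: "('q \<times> 'a list \<times> 'b list \<times> 'q) set"
  ta_init :: 'q
  ta_final :: "'q set"

definition tape2_buchi :: "('q, 'a, 'b) tape2_aut \<Rightarrow> bool" where
  "tape2_buchi T \<longleftrightarrow>
     finite (ta_states T) \<and> finite (ta_in T) \<and> finite (ta_out T) \<and>
     finite (ta_trans T) \<and>
     ta_trans T \<subseteq> ta_states T \<times> lists (ta_in T) \<times> lists (ta_out T) \<times> ta_states T \<and>
     ta_init T \<in> ta_states T \<and> ta_final T \<subseteq> ta_states T"

text \<open>The infinite concatenation \<open>ws 0 @ ws 1 @ \<dots>\<close> is the \<open>\<omega>\<close>-word \<open>\<sigma>\<close>; in particular it is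
  infinite, although individual factors may be empty.\<close>

definition concat_is :: "'a list word \<Rightarrow> 'a word \<Rightarrow> bool" where
  "concat_is ws \<sigma> \<longleftrightarrow>
     (\<forall>n. concat (prefix n ws) = prefix (length (concat (prefix n ws))) \<sigma>) \<and>
     (\<forall>m. \<exists>n. m \<le> length (concat (prefix n ws)))"

definition ta_accepts :: "('q, 'a, 'b) tape2_aut \<Rightarrow> 'a word \<Rightarrow> 'b word \<Rightarrow> bool" where
  "ta_accepts T u v \<longleftrightarrow>
     (\<exists>r x y. r 0 = ta_init T \<and> (\<forall>i. (r i, x i, y i, r (Suc i)) \<in> ta_trans T) \<and>
        (\<exists>\<^sub>\<infinity>i. r i \<in> ta_final T) \<and> concat_is x u \<and> concat_is y v)"

text \<open>The accepted relation, as a set of \<open>\<omega>\<close>-words over the product alphabet.\<close>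

definition ta_lang :: "('q, 'a, 'b) tape2_aut \<Rightarrow> ('a \<times> 'b) word set" where
  "ta_lang T = {\<sigma> \<in> omega_words (ta_in T \<times> ta_out T). ta_accepts T (fst \<circ> \<sigma>) (snd \<circ> \<sigma>)}"

end

theory Submission
  imports Defs "HOL-Library.Countable"
begin

text \<open>
  A \<open>\<Sigma>\<^sup>1\<^sub>1\<close> set is the set of all \<open>x\<close> for which a recursive tree \<open>T\<^sub>p(x)\<close> has an infinite
  branch. In the game, Player 1 plays a number \<open>x\<close>, read as a pair \<open>(p, q)\<close>, and Player 2 answers
  with a bit. If the bit is \<open>1\<close>, then Player 1 has to descend in \<open>T\<^sub>p(x)\<close> and Player 2 in
  \<open>T\<^sub>q(x)\<close>, alternately, and the first one to be stuck loses; if it is \<open>0\<close>, the trees are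
  exchanged. If Player 1 won the position after bit \<open>0\<close> and the one after bit \<open>1\<close>, the two
  winning strategies could be played against each other, which is absurd; so Player 2 wins. If
  \<open>F\<close> is the set of all \<open>x\<close> that a hyperarithmetical winning strategy answers with \<open>1\<close>, choose
  \<open>p\<close> and \<open>q\<close> such that \<open>T\<^sub>p(x)\<close> has a branch iff \<open>x \<in> F\<close>, and \<open>T\<^sub>q(x)\<close> iff \<open>x \<notin> F\<close>. At
  \<open>x = (p, q)\<close> the answer of the strategy gives the tree with a branch to Player 1 and the one
  without to Player 2, and it loses.

  All claims about the trees are made by Player 1, as derivations in a fixed Horn program over
  counters that includes an evaluator for the recursive functions; Player 2 chooses the premise
  to go on with. Moves only increment or decrement a counter, and when Player 1 uses a test for
  zero, Player 2 may object, which ends the play. Hence the winner depends on one test of one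
  counter at most: a 1-counter automaton guesses this counter and follows it from the beginning,
  and a 2-tape automaton compares the increments read on one tape with the decrements read on
  the other one.
\<close>

section \<open>Computable functions\<close>

text \<open>The bit with which a winning strategy answers \<open>x\<close> separates two disjoint
  sets: where \<open>start0\<close> is derivable the answer has to be 1, where \<open>start1\<close>
  is derivable it has to be 0. Derivability in such a Horn program is a
  \<open>\<Pi>\<^sup>1\<^sub>1\<close> notion, and the diagonal argument says that this pair of
  disjoint \<open>\<Pi>\<^sup>1\<^sub>1\<close> sets has no hyperarithmetical separating set. No
  general determinacy theorem is needed: Player 2 can keep a position underivable, and conversely no
  winning strategy of Player 2 ever runs into a derivable position. Besides plays that end in
  \<open>Tru\<close> or in a passed test, Player 1 wins only those in which Player 2 delays in a
  \<open>Forall\<close> forever. So the winning condition is that the position is good from some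
  time on, which is \<open>\<Sigma>\<^sup>0\<^sub>2\<close> and therefore
  \<open>\<Delta>\<^sup>0\<^sub>3\<close>. The price for having at most one test per play is that
  illegal decrements are possible as long as Player 2 does not object; hence registers range over
  the integers in actual plays, but over the natural numbers in derivations.\<close>

definition computable :: "nat \<Rightarrow> (nat list \<Rightarrow> nat) \<Rightarrow> bool" where
  "computable k f \<longleftrightarrow> (\<exists>p. \<forall>xs. length xs = k \<longrightarrow> computes p xs (f xs))"

lemma recursive_rel_iff_computable:
  "recursive_rel k P \<longleftrightarrow> computable k (\<lambda>xs. if P xs then 1 else 0)"
  by (simp add: recursive_rel_def computable_def)

lemma computable_cong:
  "computable k f \<Longrightarrow> (\<And>xs. length xs = k \<Longrightarrow> f xs = g xs) \<Longrightarrow> computable k g"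
  unfolding computable_def by metis

lemma recursive_rel_cong:
  "recursive_rel k P \<Longrightarrow> (\<And>xs. length xs = k \<Longrightarrow> P xs \<longleftrightarrow> Q xs) \<Longrightarrow> recursive_rel k Q"
  unfolding recursive_rel_def by metis

lemma computable_proj: "i < k \<Longrightarrow> computable k (\<lambda>xs. xs ! i)"
  unfolding computable_def using computes.proj by blast

lemma computable_comp:
  assumes "computable (length gs) f" "\<And>g. g \<in> set gs \<Longrightarrow> computable k g"
  shows "computable k (\<lambda>xs. f (map (\<lambda>g. g xs) gs))"
proof -
  obtain p where p: "\<And>xs. length xs = length gs \<Longrightarrow> computes p xs (f xs)"
    using assms(1) unfolding computable_def by blast
  obtain c where c: "\<And>g xs. g \<in> set gs \<Longrightarrow> length xs = k \<Longrightarrow> computes (c g) xs (g xs)"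
    using assms(2) unfolding computable_def by metis
  have "computes (Comp p (map c gs)) xs (f (map (\<lambda>g. g xs) gs))" if "length xs = k" for xs
  proof (rule computes.comp)
    show "list_all2 (\<lambda>g y. computes g xs y) (map c gs) (map (\<lambda>g. g xs) gs)"
      using c that by (simp add: list_all2_conv_all_nth)
  qed (simp add: p)
  then show ?thesis unfolding computable_def by blast
qed

lemma computable_zero: "computable k (\<lambda>xs. 0)"
  unfolding computable_def using computes.zero by blast

lemma computable_Suc:
  assumes "computable k f"
  shows "computable k (\<lambda>xs. Suc (f xs))"
proof -
  have "computable (length [f]) (\<lambda>xs. Suc (xs ! 0))"
    unfolding computable_def
    by (rule exI[of _ Succ]) (auto simp: length_Suc_conv intro: computes.succ)
  from computable_comp[OF this, of k] assms show ?thesis by simp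
qed

lemma computable_const: "computable k (\<lambda>xs. c)"
  by (induction c) (auto intro: computable_zero computable_Suc)

lemma computable_comp1:
  assumes "computable (Suc 0) (\<lambda>xs. h (xs ! 0))" "computable k f"
  shows "computable k (\<lambda>xs. h (f xs))"
  using computable_comp[of "[f]" "\<lambda>xs. h (xs ! 0)" k] assms by simp

lemma computable_drop:
  assumes "computable k f"
  shows "computable (m + k) (\<lambda>xs. f (drop m xs))"
proof -
  have "computable (m + k) (\<lambda>xs. f (map (\<lambda>g. g xs) (map (\<lambda>i xs. xs ! (m + i)) [0..<k])))"
    by (rule computable_comp) (use assms in \<open>auto intro: computable_proj\<close>)
  then show ?thesis
    by (rule computable_cong) (auto intro!: arg_cong[of _ _ f] nth_equalityI)
qed

lemma computable_drop2: "computable k f \<Longrightarrow> computable (Suc (Suc k)) (\<lambda>xs. f (drop 2 xs))"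
  using computable_drop[of k f 2] by simp

lemma computable_Cons:
  assumes "computable (Suc k) f" "computable k g"
  shows "computable k (\<lambda>xs. f (g xs # xs))"
proof -
  have "computable k (\<lambda>xs. f (map (\<lambda>h. h xs) (g # map (\<lambda>i xs. xs ! i) [0..<k])))"
    by (rule computable_comp) (use assms in \<open>auto intro: computable_proj\<close>)
  then show ?thesis
    by (rule computable_cong) (auto intro!: arg_cong[of _ _ f] nth_equalityI)
qed

text \<open>\<open>Prec\<close> puts the recursion index and the previous value in front of the
  parameters, hence \<open>drop 2 ys\<close>. Later functions are written with
  \<open>rec_nat\<close> and matched with a closed form by a separate induction.\<close>

lemma computable_rec_nat:
  assumes n: "computable k n" and b: "computable k b"
    and s: "computable (Suc (Suc k)) (\<lambda>ys. s (ys ! 0) (ys ! 1) (drop 2 ys))"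
  shows "computable k (\<lambda>xs. rec_nat (b xs) (\<lambda>i y. s i y xs) (n xs))"
proof -
  obtain p where p: "\<And>xs. length xs = k \<Longrightarrow> computes p xs (b xs)"
    using b unfolding computable_def by blast
  obtain q where q: "\<And>ys. length ys = Suc (Suc k) \<Longrightarrow>
      computes q ys (s (ys ! 0) (ys ! 1) (drop 2 ys))"
    using s unfolding computable_def by blast
  have *: "computes (Prec p q) (m # xs) (rec_nat (b xs) (\<lambda>i y. s i y xs) m)"
    if "length xs = k" for m xs
  proof (induction m)
    case 0
    then show ?case using p[OF that] by (auto intro: computes.prec_0)
  next
    case (Suc m)
    show ?case
      by (rule computes.prec_Suc[OF Suc.IH])
        (use q[of "m # rec_nat (b xs) (\<lambda>i y. s i y xs) m # xs"] that in simp)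
  qed
  have "computable (Suc k) (\<lambda>ys. rec_nat (b (tl ys)) (\<lambda>i y. s i y (tl ys)) (hd ys))"
    unfolding computable_def by (rule exI[of _ "Prec p q"]) (auto simp: length_Suc_conv *)
  from computable_Cons[OF this n] show ?thesis by simp
qed

lemma computable_if_zero:
  assumes "computable k c" "computable k f" "computable k g"
  shows "computable k (\<lambda>xs. if c xs = 0 then f xs else g xs)"
proof -
  have "computable k (\<lambda>xs. rec_nat (f xs) (\<lambda>i y. g xs) (c xs))"
    by (rule computable_rec_nat[where s = "\<lambda>i y xs. g xs"])
      (use assms computable_drop[of k g 2] in simp_all)
  then show ?thesis
    by (rule computable_cong) (auto simp: gr0_conv_Suc)
qed

lemma computable_if:
  assumes "recursive_rel k P" "computable k f" "computable k g"
  shows "computable k (\<lambda>xs. if P xs then f xs else g xs)"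
  by (rule computable_cong[OF computable_if_zero[OF
        assms(1)[unfolded recursive_rel_iff_computable] assms(3) assms(2)]]) simp

lemma recursive_rel_not: "recursive_rel k P \<Longrightarrow> recursive_rel k (\<lambda>xs. \<not> P xs)"
  unfolding recursive_rel_iff_computable
  by (drule computable_if_zero[OF _ computable_const[of k 1] computable_const[of k 0]])
    (erule computable_cong, simp)

lemma recursive_rel_conj:
  "recursive_rel k P \<Longrightarrow> recursive_rel k Q \<Longrightarrow> recursive_rel k (\<lambda>xs. P xs \<and> Q xs)"
  unfolding recursive_rel_iff_computable[of _ Q] recursive_rel_iff_computable[of _ "\<lambda>xs. P xs \<and> Q xs"]
  by (drule computable_if[OF _ _ computable_const[of k 0]], assumption) (erule computable_cong, simp)

lemma recursive_rel_disj:
  "recursive_rel k P \<Longrightarrow> recursive_rel k Q \<Longrightarrow> recursive_rel k (\<lambda>xs. P xs \<or> Q xs)"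
  by (rule recursive_rel_cong[OF recursive_rel_not[OF recursive_rel_conj[OF
          recursive_rel_not recursive_rel_not]]]) auto

lemma recursive_rel_imp:
  "recursive_rel k P \<Longrightarrow> recursive_rel k Q \<Longrightarrow> recursive_rel k (\<lambda>xs. P xs \<longrightarrow> Q xs)"
  by (rule recursive_rel_cong[OF recursive_rel_disj[OF recursive_rel_not]]) auto

lemma recursive_rel_const: "recursive_rel k (\<lambda>xs. b)"
  unfolding recursive_rel_iff_computable by (rule computable_const)

lemma recursive_rel_Ball:
  "finite A \<Longrightarrow> (\<And>a. a \<in> A \<Longrightarrow> recursive_rel k (P a)) \<Longrightarrow> recursive_rel k (\<lambda>xs. \<forall>a\<in>A. P a xs)"
  by (induction rule: finite_induct) (simp_all add: recursive_rel_const recursive_rel_conj)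

lemma recursive_rel_Bex:
  "finite A \<Longrightarrow> (\<And>a. a \<in> A \<Longrightarrow> recursive_rel k (P a)) \<Longrightarrow> recursive_rel k (\<lambda>xs. \<exists>a\<in>A. P a xs)"
  by (induction rule: finite_induct) (simp_all add: recursive_rel_const recursive_rel_disj)

lemma recursive_rel_comp:
  assumes "recursive_rel (length gs) P" "\<And>g. g \<in> set gs \<Longrightarrow> computable k g"
  shows "recursive_rel k (\<lambda>xs. P (map (\<lambda>g. g xs) gs))"
  using computable_comp[OF assms(1)[unfolded recursive_rel_iff_computable] assms(2)]
  unfolding recursive_rel_iff_computable by simp

lemma computable_pred: "computable k f \<Longrightarrow> computable k (\<lambda>xs. f xs - 1)"
proof (erule computable_comp1[rotated])
  have "computable (Suc 0) (\<lambda>xs. rec_nat 0 (\<lambda>i y. i) (xs ! 0))"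
    by (rule computable_rec_nat[where s = "\<lambda>i y xs. i"])
      (auto intro: computable_proj computable_zero)
  then show "computable (Suc 0) (\<lambda>xs. xs ! 0 - 1)"
    by (rule computable_cong) (auto split: nat_diff_split simp: gr0_conv_Suc)
qed

lemma computable_add:
  assumes "computable k f" "computable k g"
  shows "computable k (\<lambda>xs. f xs + g xs)"
proof -
  have "computable k (\<lambda>xs. rec_nat (g xs) (\<lambda>i y. Suc y) (f xs))"
    by (rule computable_rec_nat[where s = "\<lambda>i y xs. Suc y"])
      (auto intro: assms computable_proj computable_Suc)
  moreover have "rec_nat a (\<lambda>i y. Suc y) b = b + a" for a b by (induction b) auto
  ultimately show ?thesis by simp
qed

lemma computable_diff:
  assumes "computable k f" "computable k g"
  shows "computable k (\<lambda>xs. f xs - g xs)"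
proof -
  have "computable k (\<lambda>xs. rec_nat (f xs) (\<lambda>i y. y - 1) (g xs))"
    by (rule computable_rec_nat[where s = "\<lambda>i y xs. y - 1"])
      (use assms computable_pred[OF computable_proj[of 1 "Suc (Suc k)"]] in simp_all)
  moreover have "rec_nat a (\<lambda>i y. y - 1) b = a - b" for a b :: nat by (induction b) auto
  ultimately show ?thesis by simp
qed

lemma recursive_rel_le:
  "computable k f \<Longrightarrow> computable k g \<Longrightarrow> recursive_rel k (\<lambda>xs. f xs \<le> g xs)"
  unfolding recursive_rel_iff_computable
  by (rule computable_cong[OF computable_if_zero[OF computable_diff[of k f g]
          computable_const[of k 1] computable_const[of k 0]]]) auto

lemma recursive_rel_eq:
  "computable k f \<Longrightarrow> computable k g \<Longrightarrow> recursive_rel k (\<lambda>xs. f xs = g xs)"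
  by (rule recursive_rel_cong[OF recursive_rel_conj[OF recursive_rel_le[of k f g]
          recursive_rel_le[of k g f]]]) auto

lemma computable_Least:
  assumes P: "recursive_rel (Suc k) (\<lambda>ys. P (hd ys) (tl ys))"
    and ex: "\<And>xs. length xs = k \<Longrightarrow> \<exists>n. P n xs"
  shows "computable k (\<lambda>xs. LEAST n. P n xs)"
proof -
  obtain p where p: "\<And>ys. length ys = Suc k \<Longrightarrow> computes p ys (if P (hd ys) (tl ys) then 0 else 1)"
    using computable_if[OF P computable_const[of _ 0] computable_const[of _ 1]]
    unfolding computable_def by blast
  have "computes (Mu p) xs (LEAST n. P n xs)" if len: "length xs = k" for xs
  proof (rule computes.mu)
    show "computes p ((LEAST n. P n xs) # xs) 0"
      using p[of "(LEAST n. P n xs) # xs"] len LeastI_ex[OF ex[OF len]] by simp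
  next
    fix m assume "m < (LEAST n. P n xs)"
    then have "\<not> P m xs" by (rule not_less_Least)
    then show "\<exists>y. computes p (m # xs) (Suc y)" using p[of "m # xs"] len by auto
  qed
  then show ?thesis unfolding computable_def by blast
qed

text \<open>A finite table is a nested case distinction, whatever \<open>t\<close> is. In this way
  the step functions of the finite control become computable without writing programs for
  them.\<close>

lemma computable_table:
  assumes "finite D" "computable k f"
  shows "computable k (\<lambda>xs. if f xs \<in> D then t (f xs) else d)"
  using assms(1)
proof (induction rule: finite_induct)
  case empty
  then show ?case by (simp add: computable_const)
next
  case (insert a D)
  have "computable k (\<lambda>xs. if f xs = a then t a else if f xs \<in> D then t (f xs) else d)"
    by (intro computable_if recursive_rel_eq computable_const insert.IH assms(2))
  then show ?case by (rule computable_cong) auto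
qed

section \<open>Cantor pairing and codes of lists\<close>

lemma computable_triangle: "computable k f \<Longrightarrow> computable k (\<lambda>xs. triangle (f xs))"
proof (erule computable_comp1[rotated])
  have "computable (Suc 0) (\<lambda>xs. rec_nat 0 (\<lambda>i y. y + Suc i) (xs ! 0))"
    by (rule computable_rec_nat[where s = "\<lambda>i y xs. y + Suc i"])
      (auto intro!: computable_proj computable_zero computable_add computable_Suc)
  moreover have "rec_nat 0 (\<lambda>i y. y + Suc i) n = triangle n" for n by (induction n) auto
  ultimately show "computable (Suc 0) (\<lambda>xs. triangle (xs ! 0))" by simp
qed

lemma computable_prod_encode:
  "computable k f \<Longrightarrow> computable k g \<Longrightarrow> computable k (\<lambda>xs. prod_encode (f xs, g xs))"
  unfolding prod_encode_def by (auto intro!: computable_add computable_triangle)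

lemma triangle_mono: "m \<le> n \<Longrightarrow> triangle m \<le> triangle n"
  unfolding triangle_def by (intro div_le_mono mult_le_mono) auto

lemma le_triangle: "n \<le> triangle n"
  by (induction n) auto

text \<open>The diagonal on which \<open>n\<close> lies is the \<open>w\<close> with
  \<open>triangle w \<le> n < triangle (Suc w)\<close>; so a least-number search inverts the
  pairing.\<close>

lemma fst_add_snd_prod_decode:
  "fst (prod_decode n) + snd (prod_decode n) = (LEAST w. n < triangle (Suc w))" (is "?a + ?b = _")
proof (rule Least_equality[symmetric])
  have n: "n = triangle (?a + ?b) + ?a"
    using prod_decode_inverse[of n] unfolding prod_encode_def
    by (metis (mono_tags, lifting) case_prod_beta)
  show "n < triangle (Suc (?a + ?b))"
    by (subst n) simp
  fix w assume "n < triangle (Suc w)"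
  then have "triangle (?a + ?b) < triangle (Suc w)" using n by linarith
  then show "?a + ?b \<le> w" using triangle_mono[of "Suc w" "?a + ?b"] by (metis leD not_less_eq_eq)
qed

lemma computable_decode_sum:
  "computable k f \<Longrightarrow> computable k (\<lambda>xs. fst (prod_decode (f xs)) + snd (prod_decode (f xs)))"
proof (erule computable_comp1[rotated])
  have "computable (Suc 0) (\<lambda>xs. LEAST w. xs ! 0 < triangle (Suc w))"
  proof (rule computable_Least)
    have "recursive_rel (Suc (Suc 0)) (\<lambda>ys. Suc (ys ! 1) \<le> triangle (Suc (ys ! 0)))"
      by (intro recursive_rel_le computable_triangle computable_Suc computable_proj) auto
    then show "recursive_rel (Suc (Suc 0)) (\<lambda>ys. tl ys ! 0 < triangle (Suc (hd ys)))"
      by (rule recursive_rel_cong) (auto simp: length_Suc_conv)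
  next
    fix xs :: "nat list"
    show "\<exists>w. xs ! 0 < triangle (Suc w)" by (metis le_triangle Suc_le_eq)
  qed
  then show "computable (Suc 0) (\<lambda>xs. fst (prod_decode (xs ! 0)) + snd (prod_decode (xs ! 0)))"
    by (simp only: fst_add_snd_prod_decode)
qed

lemma computable_fst_prod_decode:
  "computable k f \<Longrightarrow> computable k (\<lambda>xs. fst (prod_decode (f xs)))"
proof -
  assume f: "computable k f"
  have eq: "n - triangle (fst (prod_decode n) + snd (prod_decode n)) = fst (prod_decode n)" for n
    using prod_decode_inverse[of n] unfolding prod_encode_def
    by (metis (mono_tags, lifting) add_diff_cancel_left' case_prod_beta)
  have "computable k (\<lambda>xs. f xs - triangle (fst (prod_decode (f xs)) + snd (prod_decode (f xs))))"
    by (intro computable_diff computable_triangle computable_decode_sum f)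
  then show ?thesis by (simp only: eq)
qed

lemma computable_snd_prod_decode:
  assumes f: "computable k f"
  shows "computable k (\<lambda>xs. snd (prod_decode (f xs)))"
  using computable_diff[OF computable_decode_sum[OF f] computable_fst_prod_decode[OF f]] by simp

lemma fst_prod_decode_le: "fst (prod_decode n) \<le> n"
  by (metis le_prod_encode_1 prod.collapse prod_decode_inverse)

lemma snd_prod_decode_le: "snd (prod_decode n) \<le> n"
  by (metis le_prod_encode_2 prod.collapse prod_decode_inverse)

text \<open>Both are \<open>0\<close> on the code \<open>0\<close> of the empty list.\<close>

definition code_hd :: "nat \<Rightarrow> nat" where
  "code_hd s = fst (prod_decode (s - 1))"

definition code_tl :: "nat \<Rightarrow> nat" where
  "code_tl s = snd (prod_decode (s - 1))"

lemma prod_decode_0: "prod_decode 0 = (0, 0)"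
  by (simp add: prod_decode_def prod_decode_aux.simps)

lemma code_hd_encode: "code_hd (list_encode (x # xs)) = x"
  by (simp add: code_hd_def)

lemma code_tl_encode: "code_tl (list_encode xs) = list_encode (tl xs)"
  by (cases xs) (simp_all add: code_tl_def prod_decode_0)

lemma code_tl_pow_encode: "(code_tl ^^ i) (list_encode xs) = list_encode (drop i xs)"
  by (induction i arbitrary: xs) (simp_all add: code_tl_encode drop_Suc tl_drop)

lemma code_nth_encode: "i < length xs \<Longrightarrow> code_hd ((code_tl ^^ i) (list_encode xs)) = xs ! i"
  by (simp add: code_tl_pow_encode Cons_nth_drop_Suc[symmetric] code_hd_encode
      del: list_encode.simps)

lemma computable_code_hd: "computable k f \<Longrightarrow> computable k (\<lambda>xs. code_hd (f xs))"
  unfolding code_hd_def by (intro computable_fst_prod_decode computable_pred)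

lemma computable_code_tl: "computable k f \<Longrightarrow> computable k (\<lambda>xs. code_tl (f xs))"
  unfolding code_tl_def by (intro computable_snd_prod_decode computable_pred)

lemma computable_code_tl_pow:
  assumes "computable k n" "computable k f"
  shows "computable k (\<lambda>xs. (code_tl ^^ n xs) (f xs))"
proof -
  have "computable k (\<lambda>xs. rec_nat (f xs) (\<lambda>i y. code_tl y) (n xs))"
    by (rule computable_rec_nat[where s = "\<lambda>i y xs. code_tl y"])
      (auto intro!: assms computable_proj computable_code_tl)
  moreover have "rec_nat a (\<lambda>i y. code_tl y) n = (code_tl ^^ n) a" for a n by (induction n) auto
  ultimately show ?thesis by simp
qed

definition code_length :: "nat \<Rightarrow> nat" where
  "code_length s = length (list_decode s)"

lemma code_length_encode: "code_length (list_encode xs) = length xs"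
  by (simp add: code_length_def)

text \<open>\<open>code_tl\<close> keeps the code 0 of the empty list fixed, so the first time at
  which 0 appears among the iterated tails is the length.\<close>

lemma code_length_Least: "code_length s = (LEAST i. (code_tl ^^ i) s = 0)"
proof -
  have "(code_tl ^^ i) s = 0 \<longleftrightarrow> length (list_decode s) \<le> i" for i
    using code_tl_pow_encode[of i "list_decode s"] list_encode_eq[of "drop i (list_decode s)" "[]"]
    by simp
  then show ?thesis unfolding code_length_def by simp (rule Least_equality[symmetric], auto)
qed

lemma computable_code_length: "computable k f \<Longrightarrow> computable k (\<lambda>xs. code_length (f xs))"
proof (erule computable_comp1[rotated])
  have "computable (Suc 0) (\<lambda>xs. LEAST i. (code_tl ^^ i) (xs ! 0) = 0)"
  proof (rule computable_Least)
    have "recursive_rel (Suc (Suc 0)) (\<lambda>ys. (code_tl ^^ (ys ! 0)) (ys ! 1) = 0)"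
      by (intro recursive_rel_eq computable_code_tl_pow computable_proj computable_const) auto
    then show "recursive_rel (Suc (Suc 0)) (\<lambda>ys. (code_tl ^^ hd ys) (tl ys ! 0) = 0)"
      by (rule recursive_rel_cong) (auto simp: length_Suc_conv)
  next
    fix xs :: "nat list"
    have "(code_tl ^^ length (list_decode (xs ! 0))) (xs ! 0) = 0"
      using code_tl_pow_encode[of "length (list_decode (xs ! 0))" "list_decode (xs ! 0)"] by simp
    then show "\<exists>n. (code_tl ^^ n) (xs ! 0) = 0" ..
  qed
  then show "computable (Suc 0) (\<lambda>xs. code_length (xs ! 0))"
    by (simp only: code_length_Least)
qed

section \<open>Alternating counter programs\<close>

text \<open>In the game proper, \<open>RX\<close> is the number played, \<open>RP\<close> and
  \<open>RQ\<close> are the two programs, \<open>RS\<close> and \<open>RT\<close> the two sequences,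
  \<open>RV\<close> and \<open>RW\<close> their new entries, and \<open>RC\<close> is scratch space.
  In the evaluator, \<open>EP\<close> is the program with tag \<open>EU\<close> and body
  \<open>EB\<close>, \<open>EA\<close> the argument list and \<open>EZ\<close> the value; the others
  hold intermediate results.\<close>

datatype reg = RX | RP | RQ | RS | RT | RV | RW | RC
  | EP | EA | EZ | EU | EB | EF | EG | EH | EN | EY

text \<open>Calls do not return: Player 2 selects one premise and the other one is dropped. So a
  call may destroy all registers that it works with.\<close>

datatype lab = LEq reg reg | LPair reg reg reg | LEval | LNth | LEvals | LBelow | LRound

text \<open>The control states of the game. Player 1 chooses in \<open>Either\<close> and \<open>Guess\<close>, Player 2 in
  \<open>Both\<close> and \<open>Forall\<close>; Player 2 may also object to \<open>Dec\<close>. \<open>Guess\<close> can set the register to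
  any value, \<open>Forall\<close> can only increase it, and Player 2 loses if he increases it forever. In
  \<open>Ask\<close>, Player 1 increases the register as long as he likes, and then Player 2 chooses. \<open>sem\<close>
  says that Player 1 wins, given the positions \<open>Call l\<close> from which he does.\<close>

datatype fm =
    Tru
  | Test reg bool
  | Either fm fm
  | Both fm fm
  | Inc reg fm
  | Dec reg fm
  | Guess reg fm
  | Forall reg fm
  | Call lab
  | Ask reg fm fm

primrec sem :: "(lab \<Rightarrow> (reg \<Rightarrow> nat) \<Rightarrow> bool) \<Rightarrow> fm \<Rightarrow> (reg \<Rightarrow> nat) \<Rightarrow> bool" where
  "sem I Tru \<rho> = True"
| "sem I (Test r z) \<rho> = ((\<rho> r = 0) = z)"
| "sem I (Either A B) \<rho> = (sem I A \<rho> \<or> sem I B \<rho>)"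
| "sem I (Both A B) \<rho> = (sem I A \<rho> \<and> sem I B \<rho>)"
| "sem I (Inc r A) \<rho> = sem I A (\<rho>(r := Suc (\<rho> r)))"
| "sem I (Dec r A) \<rho> = (\<rho> r \<noteq> 0 \<and> sem I A (\<rho>(r := \<rho> r - 1)))"
| "sem I (Guess r A) \<rho> = (\<exists>v. sem I A (\<rho>(r := v)))"
| "sem I (Forall r A) \<rho> = (\<forall>v \<ge> \<rho> r. sem I A (\<rho>(r := v)))"
| "sem I (Call l) \<rho> = I l \<rho>"
| "sem I (Ask r A B) \<rho> = (\<exists>v \<ge> \<rho> r. sem I A (\<rho>(r := v)) \<and> sem I B (\<rho>(r := v)))"

lemma sem_mono:
  "(\<And>l \<rho>. I l \<rho> \<longrightarrow> J l \<rho>) \<Longrightarrow> sem I A \<rho> \<longrightarrow> sem J A \<rho>"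
  by (induction A arbitrary: \<rho>) auto

definition if_zero :: "reg \<Rightarrow> fm \<Rightarrow> fm" where
  "if_zero r A = Both (Test r True) A"

text \<open>Assignment is not a move of the game. Player 1 adjusts the target by single steps, and
  Player 2 may ask for the comparison, which counts both registers down.\<close>

definition set_reg :: "reg \<Rightarrow> reg \<Rightarrow> fm \<Rightarrow> fm" where
  "set_reg s r A = Guess s (Both (Call (LEq s r)) A)"

definition set_zero :: "reg \<Rightarrow> fm \<Rightarrow> fm" where
  "set_zero r A = Guess r (if_zero r A)"

definition make_cons :: "reg \<Rightarrow> reg \<Rightarrow> reg \<Rightarrow> fm \<Rightarrow> fm" where
  "make_cons c a b A = Guess c (Both (Call (LPair a b c)) (Inc c A))"

definition unpair :: "reg \<Rightarrow> reg \<Rightarrow> reg \<Rightarrow> fm \<Rightarrow> fm" where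
  "unpair a b c A = Guess a (Guess b (Both (Call (LPair a b c)) A))"

definition uncons :: "reg \<Rightarrow> reg \<Rightarrow> reg \<Rightarrow> fm \<Rightarrow> fm" where
  "uncons a b c A = Dec c (unpair a b c A)"

text \<open>\<open>LEval\<close> claims that the program coded by \<open>EP\<close> maps the argument list coded by \<open>EA\<close> to
  \<open>EZ\<close>. In the game \<open>LRound\<close>, Player 1 extends the sequence \<open>RS\<close> (newest entry first) by
  \<open>RV\<close>, claiming that program \<open>RP\<close> accepts \<open>(RX, RS)\<close>; then Player 2 extends \<open>RT\<close> by
  \<open>RW\<close>, and Player 1 may claim that program \<open>RQ\<close> rejects \<open>(RX, RT)\<close>.\<close>

definition eval_call :: "reg \<Rightarrow> reg \<Rightarrow> fm \<Rightarrow> fm" where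
  "eval_call p s A =
     set_reg EP p (set_zero EH (make_cons EY s EH (make_cons EA RX EY (set_zero EZ A))))"

definition prog_prec :: fm where
  "prog_prec = unpair EF EG EB (uncons EN EH EA (Either
     (if_zero EN (set_reg EP EF (set_reg EA EH (Call LEval))))
     (Dec EN (Guess EY (Both
        (set_reg EZ EY (make_cons EA EN EH (Call LEval)))
        (make_cons EU EY EH (make_cons EA EN EU (set_reg EP EG (Call LEval)))))))))"

definition prog_mu :: fm where
  "prog_mu = Both
     (make_cons EH EZ EA (set_reg EA EH (set_zero EZ (set_reg EP EB (Call LEval)))))
     (set_reg EN EZ (Call LBelow))"

primrec prog :: "lab \<Rightarrow> fm" where
  "prog (LEq r s) = Either (if_zero r (if_zero s Tru)) (Dec r (Dec s (Call (LEq r s))))"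
| "prog (LPair a b c) = Either
     (if_zero a (if_zero b (if_zero c Tru)))
     (Either (Dec a (Inc b (Dec c (Call (LPair a b c)))))
             (if_zero a (Dec b (Dec c (Call (LPair b a c))))))"
| "prog LEval = unpair EU EB EP (Either
     (if_zero EU (if_zero EZ Tru))
     (Dec EU (Either (if_zero EU (uncons EH EY EA (Inc EH (Call (LEq EH EZ)))))
     (Dec EU (Either (if_zero EU (Call LNth))
     (Dec EU (Either (if_zero EU
        (unpair EF EG EB (Guess EY (Both (Call LEvals)
           (set_reg EP EF (set_reg EA EY (Call LEval)))))))
     (Dec EU (Either (if_zero EU prog_prec)
     (Dec EU prog_mu))))))))))"
| "prog LNth = uncons EH EY EA (Either
     (if_zero EB (Call (LEq EH EZ)))
     (Dec EB (set_reg EA EY (Call LNth))))"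
| "prog LEvals = Either
     (if_zero EG (if_zero EY Tru))
     (uncons EF EH EG (set_reg EG EH (uncons EN EH EY (set_reg EY EH
        (Both (Call LEvals) (set_reg EP EF (set_reg EZ EN (Call LEval))))))))"
| "prog LBelow = Either (if_zero EN Tru)
     (Dec EN (Both (Call LBelow)
        (make_cons EH EN EA (set_reg EA EH (Guess EZ (Inc EZ (set_reg EP EB (Call LEval))))))))"
| "prog LRound = Guess RV (make_cons RC RV RS (set_reg RS RC (Both
     (eval_call RP RS (Inc EZ (Call LEval)))
     (set_zero RW (Forall RW (make_cons RC RW RT (set_reg RT RC (Either
        (eval_call RQ RT (Call LEval))
        (Call LRound)))))))))"

text \<open>The least fixed point admits only well-founded derivations, in accordance with the
  winning condition: a play that passes through calls forever is lost by Player 1.\<close>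

inductive holds :: "lab \<Rightarrow> (reg \<Rightarrow> nat) \<Rightarrow> bool" where
  "sem holds (prog l) \<rho> \<Longrightarrow> holds l \<rho>"
monos sem_mono

lemma holds_iff: "holds l \<rho> \<longleftrightarrow> sem holds (prog l) \<rho>"
  by (rule holds.simps[of l \<rho>, simplified])

section \<open>Correctness of comparison and pairing\<close>

lemma prod_encode_0: "prod_encode (0, 0) = 0"
  by (simp add: prod_encode_def)

lemma prod_encode_eq_0: "prod_encode (a, b) = 0 \<longleftrightarrow> a = 0 \<and> b = 0"
  using prod_encode_eq[of "(a, b)" "(0, 0)"] by (simp add: prod_encode_0)

text \<open>A step back in the Cantor enumeration within a diagonal; the next lemma steps from the
  start of a diagonal to the end of the previous one. \<open>LPair\<close> follows these steps down
  to the pair of zeros.\<close>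

lemma prod_encode_Suc_left: "prod_encode (Suc a, b) = Suc (prod_encode (a, Suc b))"
  by (simp add: prod_encode_def)

lemma prod_encode_0_Suc: "prod_encode (0, Suc b) = Suc (prod_encode (b, 0))"
  by (simp add: prod_encode_def)

lemma holds_LEq: "r \<noteq> s \<Longrightarrow> holds (LEq r s) \<rho> \<longleftrightarrow> \<rho> r = \<rho> s"
proof
  assume "holds (LEq r s) \<rho>" "r \<noteq> s"
  then show "\<rho> r = \<rho> s"
  proof (induction "LEq r s" \<rho> rule: holds.induct)
    case (1 \<rho>)
    then show ?case by (auto simp: if_zero_def)
  qed
next
  assume "\<rho> r = \<rho> s" "r \<noteq> s"
  then show "holds (LEq r s) \<rho>"
  proof (induction "\<rho> r" arbitrary: \<rho>)
    case 0
    then show ?case by (subst holds_iff) (simp add: if_zero_def)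
  next
    case (Suc n)
    have "holds (LEq r s) (\<rho>(r := n, s := n))"
      by (rule Suc.hyps(1)) (use Suc.prems in auto)
    then show ?case using Suc by (subst holds_iff) (simp add: Suc.hyps(2)[symmetric])
  qed
qed

lemma holds_LPair:
  assumes "a \<noteq> b" "a \<noteq> c" "b \<noteq> c"
  shows "holds (LPair a b c) \<rho> \<longleftrightarrow> prod_encode (\<rho> a, \<rho> b) = \<rho> c"
proof
  assume "holds (LPair a b c) \<rho>"
  then show "prod_encode (\<rho> a, \<rho> b) = \<rho> c" using assms
  \<comment> \<open>Passing to the previous diagonal exchanges the roles of \<open>a\<close> and
    \<open>b\<close>, so the induction has to be uniform in both.\<close>
  proof (induction "LPair a b c" \<rho> arbitrary: a b rule: holds.induct)
    case (1 \<rho>)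
    from 1(1) 1(2-) consider "\<rho> a = 0" "\<rho> b = 0" "\<rho> c = 0"
      | "\<rho> a \<noteq> 0" "\<rho> c \<noteq> 0" "prod_encode (\<rho> a - 1, Suc (\<rho> b)) = \<rho> c - 1"
      | "\<rho> a = 0" "\<rho> b \<noteq> 0" "\<rho> c \<noteq> 0" "prod_encode (\<rho> b - 1, 0) = \<rho> c - 1"
      by (auto simp: if_zero_def)
    then show ?case
      by cases (auto simp: prod_encode_0 prod_encode_Suc_left prod_encode_0_Suc gr0_conv_Suc)
  qed
next
  assume "prod_encode (\<rho> a, \<rho> b) = \<rho> c"
  then show "holds (LPair a b c) \<rho>" using assms
  proof (induction "\<rho> c" arbitrary: \<rho> a b)
    case 0
    then show ?case by (subst holds_iff) (simp add: if_zero_def prod_encode_eq_0)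
  next
    case (Suc n)
    have c: "\<rho> c = Suc n" using Suc.hyps(2) by simp
    note ne = Suc.prems(2-4) Suc.prems(2-4)[symmetric]
    show ?case
    proof (cases "\<rho> a")
      case a: (Suc a')
      have "holds (LPair a b c) (\<rho>(a := a', b := Suc (\<rho> b), c := n))"
        by (rule Suc.hyps(1)) (use a c ne Suc.prems(1) in \<open>auto simp: prod_encode_Suc_left\<close>)
      then show ?thesis using a c ne by (subst holds_iff) simp
    next
      case a: 0
      then obtain b' where b': "\<rho> b = Suc b'"
        using Suc.prems(1) c by (cases "\<rho> b") (auto simp: prod_encode_0)
      have "holds (LPair b a c) (\<rho>(b := b', c := n))"
        by (rule Suc.hyps(1)) (use a c b' ne Suc.prems(1) in \<open>auto simp: prod_encode_0_Suc\<close>)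
      then show ?thesis using a c b' ne by (subst holds_iff) (simp add: if_zero_def)
    qed
  qed
qed

text \<open>The hypothesis in an induction on \<open>holds\<close> is about the conjunction of \<open>holds\<close> with the
  claim, so the rules for the macros are needed for this interpretation, too.\<close>

definition exact :: "(lab \<Rightarrow> (reg \<Rightarrow> nat) \<Rightarrow> bool) \<Rightarrow> bool" where
  "exact I \<longleftrightarrow> (\<forall>r s \<rho>. r \<noteq> s \<longrightarrow> (I (LEq r s) \<rho> \<longleftrightarrow> \<rho> r = \<rho> s)) \<and>
     (\<forall>a b c \<rho>. a \<noteq> b \<longrightarrow> a \<noteq> c \<longrightarrow> b \<noteq> c \<longrightarrow>
        (I (LPair a b c) \<rho> \<longleftrightarrow> prod_encode (\<rho> a, \<rho> b) = \<rho> c))"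

lemma exact_holds: "exact holds"
  by (simp add: exact_def holds_LEq holds_LPair)

lemma sem_if_zero: "sem I (if_zero r A) \<rho> \<longleftrightarrow> \<rho> r = 0 \<and> sem I A \<rho>"
  by (simp add: if_zero_def)

lemma exact_LEq: "exact I \<Longrightarrow> r \<noteq> s \<Longrightarrow> I (LEq r s) \<rho> \<longleftrightarrow> \<rho> r = \<rho> s"
  by (simp add: exact_def)

lemma sem_set_reg:
  "exact I \<Longrightarrow> s \<noteq> r \<Longrightarrow> sem I (set_reg s r A) \<rho> \<longleftrightarrow> sem I A (\<rho>(s := \<rho> r))"
  by (simp add: set_reg_def exact_def)

lemma sem_set_zero: "sem I (set_zero r A) \<rho> \<longleftrightarrow> sem I A (\<rho>(r := 0))"
  by (simp add: set_zero_def sem_if_zero)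

lemma sem_make_cons:
  "exact I \<Longrightarrow> a \<noteq> b \<Longrightarrow> a \<noteq> c \<Longrightarrow> b \<noteq> c \<Longrightarrow>
   sem I (make_cons c a b A) \<rho> \<longleftrightarrow> sem I A (\<rho>(c := Suc (prod_encode (\<rho> a, \<rho> b))))"
  by (simp add: make_cons_def exact_def)

lemma sem_unpair:
  assumes "exact I" "a \<noteq> b" "a \<noteq> c" "b \<noteq> c"
  shows "sem I (unpair a b c A) \<rho> \<longleftrightarrow>
     sem I A (\<rho>(a := fst (prod_decode (\<rho> c)), b := snd (prod_decode (\<rho> c))))"
proof -
  have "prod_encode (v, w) = n \<longleftrightarrow> v = fst (prod_decode n) \<and> w = snd (prod_decode n)" for v w n
    by auto
  then show ?thesis using assms by (simp add: unpair_def exact_def)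
qed

lemma sem_uncons:
  assumes "exact I" "a \<noteq> b" "a \<noteq> c" "b \<noteq> c"
  shows "sem I (uncons a b c A) \<rho> \<longleftrightarrow> \<rho> c \<noteq> 0 \<and>
     sem I A (\<rho>(c := \<rho> c - 1, a := fst (prod_decode (\<rho> c - 1)), b := snd (prod_decode (\<rho> c - 1))))"
  using assms by (simp add: uncons_def sem_unpair)

lemmas sem_macros = sem_if_zero sem_set_zero

lemmas exact_macros = sem_set_reg sem_make_cons sem_unpair sem_uncons exact_LEq

text \<open>With components \<open>a\<close> and \<open>b\<close>, the number is
  \<open>triangle (a + b) + a\<close>, and the first summand is already at least \<open>b\<close>.
  So the body of a program code is smaller than the code once the tag is positive, which gives
  termination of the decoding.\<close>

lemma snd_prod_decode_less: "fst (prod_decode n) \<noteq> 0 \<Longrightarrow> snd (prod_decode n) < n"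
proof -
  assume a: "fst (prod_decode n) \<noteq> 0"
  have "n = triangle (fst (prod_decode n) + snd (prod_decode n)) + fst (prod_decode n)"
    using prod_decode_inverse[of n] unfolding prod_encode_def
    by (metis (mono_tags, lifting) case_prod_beta)
  moreover have "m \<le> triangle m" for m by (induction m) auto
  ultimately show ?thesis using a by (metis add_leD2 le_neq_implies_less less_add_same_cancel1 neq0_conv not_less order_trans)
qed

lemma mem_list_decode_le: "x \<in> set (list_decode n) \<Longrightarrow> x \<le> n"
proof (induction n rule: less_induct)
  case (less n)
  show ?case
  proof (cases n)
    case (Suc m)
    then have "x = fst (prod_decode m) \<or> x \<in> set (list_decode (snd (prod_decode m)))"
      using less.prems by (cases "prod_decode m") auto
    then show ?thesis
      using less.IH[of "snd (prod_decode m)"] Suc fst_prod_decode_le[of m] snd_prod_decode_le[of m]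
      by auto
  qed (use less.prems in simp)
qed

text \<open>Every number is made a program, so that every \<open>x\<close> is a pair of programs.
  All tags above 4 mean \<open>Mu\<close>, as in \<open>LEval\<close>, which arrives at
  \<open>prog_mu\<close> after five decrements without a further test.\<close>

function recf_decode :: "nat \<Rightarrow> recf" where
  "recf_decode n = (let t = fst (prod_decode n); b = snd (prod_decode n) in
     if t = 0 then Zero
     else if t = 1 then Succ
     else if t = 2 then Proj b
     else if t = 3 then Comp (recf_decode (fst (prod_decode b)))
       (map recf_decode (list_decode (snd (prod_decode b))))
     else if t = 4 then Prec (recf_decode (fst (prod_decode b))) (recf_decode (snd (prod_decode b)))
     else Mu (recf_decode b))"
  by auto
termination
proof -
  have *: "fst (prod_decode (snd (prod_decode n))) < n" "snd (prod_decode (snd (prod_decode n))) < n"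
    "x \<in> set (list_decode (snd (prod_decode (snd (prod_decode n))))) \<Longrightarrow> x < n"
    if "fst (prod_decode n) \<noteq> 0" for n x
    using le_less_trans[OF fst_prod_decode_le snd_prod_decode_less[OF that]]
      le_less_trans[OF snd_prod_decode_le snd_prod_decode_less[OF that]]
      mem_list_decode_le[of x "snd (prod_decode (snd (prod_decode n)))"]
    by auto
  show ?thesis
    by (relation "measure id") (simp_all add: * snd_prod_decode_less)
qed

declare recf_decode.simps [simp del]

lemma recf_decode_encode:
  "recf_decode (prod_encode (t, b)) = (
     if t = 0 then Zero
     else if t = 1 then Succ
     else if t = 2 then Proj b
     else if t = 3 then Comp (recf_decode (fst (prod_decode b)))
       (map recf_decode (list_decode (snd (prod_decode b))))
     else if t = 4 then Prec (recf_decode (fst (prod_decode b))) (recf_decode (snd (prod_decode b)))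
     else Mu (recf_decode b))"
  by (subst recf_decode.simps) (simp add: Let_def)

lemma surj_recf_decode: "\<exists>n. recf_decode n = p"
proof (induction p)
  case Zero
  show ?case by (rule exI[of _ "prod_encode (0, 0)"]) (simp add: recf_decode_encode)
next
  case Succ
  show ?case by (rule exI[of _ "prod_encode (1, 0)"]) (simp add: recf_decode_encode)
next
  case (Proj i)
  show ?case by (rule exI[of _ "prod_encode (2, i)"]) (simp add: recf_decode_encode)
next
  case (Comp f gs)
  obtain n where n: "recf_decode n = f" using Comp.IH(1) by blast
  have "\<forall>g. \<exists>m. g \<in> set gs \<longrightarrow> recf_decode m = g" using Comp.IH(2) by blast
  then obtain c where c: "\<And>g. g \<in> set gs \<Longrightarrow> recf_decode (c g) = g" by metis
  show ?case
    by (rule exI[of _ "prod_encode (3, prod_encode (n, list_encode (map c gs)))"])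
      (simp add: recf_decode_encode n c map_idI)
next
  case (Prec f g)
  then obtain m n where "recf_decode m = f" "recf_decode n = g" by blast
  then show ?case
    by (intro exI[of _ "prod_encode (4, prod_encode (m, n))"]) (simp add: recf_decode_encode)
next
  case (Mu f)
  then obtain m where "recf_decode m = f" by blast
  then show ?case
    by (intro exI[of _ "prod_encode (5, m)"]) (simp add: recf_decode_encode)
qed

section \<open>Correctness of the evaluator\<close>

lemma list_decode_pos:
  "0 < n \<Longrightarrow> list_decode n = fst (prod_decode (n - 1)) # list_decode (snd (prod_decode (n - 1)))"
  by (cases n; cases "prod_decode (n - 1)") simp_all

lemma list_decode_eq_Nil: "list_decode n = [] \<longleftrightarrow> n = 0"
  by (cases n; cases "prod_decode (n - 1)") simp_all

text \<open>The invariant of derivations. \<open>LEq\<close> and \<open>LPair\<close> are taken care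
  of by \<open>exact\<close>, and the evaluator never calls \<open>LRound\<close>; hence the value
  \<open>True\<close> for them.\<close>

primrec meaning :: "lab \<Rightarrow> (reg \<Rightarrow> nat) \<Rightarrow> bool" where
  "meaning (LEq r s) \<rho> = True"
| "meaning (LPair a b c) \<rho> = True"
| "meaning LEval \<rho> = computes (recf_decode (\<rho> EP)) (list_decode (\<rho> EA)) (\<rho> EZ)"
| "meaning LNth \<rho> =
     (\<rho> EB < length (list_decode (\<rho> EA)) \<and> list_decode (\<rho> EA) ! \<rho> EB = \<rho> EZ)"
| "meaning LEvals \<rho> = list_all2 (\<lambda>g y. computes g (list_decode (\<rho> EA)) y)
     (map recf_decode (list_decode (\<rho> EG))) (list_decode (\<rho> EY))"
| "meaning LBelow \<rho> =
     (\<forall>m<\<rho> EN. \<exists>y. computes (recf_decode (\<rho> EB)) (m # list_decode (\<rho> EA)) (Suc y))"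
| "meaning LRound \<rho> = True"

lemma holds_sound: "holds l \<rho> \<Longrightarrow> meaning l \<rho>"
proof (induction rule: holds.induct)
  case (1 l \<rho>)
  let ?I = "\<lambda>l \<rho>. holds l \<rho> \<and> meaning l \<rho>"
  have ex: "exact ?I"
    using exact_holds by (auto simp: exact_def)
  show ?case
  proof (cases l)
    case LEval
    define t b where "t = fst (prod_decode (\<rho> EP))" and "b = snd (prod_decode (\<rho> EP))"
    have EP: "\<rho> EP = prod_encode (t, b)" by (simp add: t_def b_def)
    let ?xs = "list_decode (\<rho> EA)" and ?z = "\<rho> EZ"
    note sem = 1[unfolded LEval]
    consider "t = 0" | "t = Suc 0" | "t = 2" | "t = 3" | "t = 4" | "4 < t" by linarith
    then have "computes (recf_decode (prod_encode (t, b))) ?xs ?z"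
    proof cases
      case 1
      with sem show ?thesis
        by (simp add: exact_macros[OF ex] sem_macros EP recf_decode_encode computes.zero)
    next
      case 2
      with sem have "?z = Suc (fst (prod_decode (\<rho> EA - 1)))" "0 < \<rho> EA"
        by (auto simp: exact_macros[OF ex] sem_macros EP holds_LEq)
      then show ?thesis using 2 by (simp add: recf_decode_encode list_decode_pos computes.succ)
    next
      case 3
      with sem show ?thesis
        by (auto simp: exact_macros[OF ex] sem_macros EP recf_decode_encode)
          (metis computes.proj)
    next
      case 4
      with sem show ?thesis
        by (auto simp: exact_macros[OF ex] sem_macros EP recf_decode_encode intro: computes.comp)
    next
      case 5
      define f g where "f = recf_decode (fst (prod_decode b))"
        and "g = recf_decode (snd (prod_decode b))"
      from sem 5 have pos: "0 < \<rho> EA"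
        by (simp add: exact_macros[OF ex] sem_macros EP prog_prec_def)
      define n xs where "n = fst (prod_decode (\<rho> EA - 1))"
        and "xs = list_decode (snd (prod_decode (\<rho> EA - 1)))"
      from sem 5 have "n = 0 \<and> computes f xs ?z \<or> 0 < n \<and>
          (\<exists>y. computes (Prec f g) ((n - 1) # xs) y \<and> computes g ((n - 1) # y # xs) ?z)"
        by (auto simp: exact_macros[OF ex] sem_macros EP prog_prec_def recf_decode_encode
            f_def g_def n_def xs_def)
      then have "computes (Prec f g) (n # xs) ?z"
        by (cases n) (auto intro: computes.prec_0 computes.prec_Suc)
      then show ?thesis
        using 5 pos by (simp add: recf_decode_encode list_decode_pos f_def g_def n_def xs_def)
    next
      case 6
      with sem show ?thesis
        by (auto simp: exact_macros[OF ex] sem_macros EP recf_decode_encode prog_mu_def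
            intro: computes.mu)
    qed
    then show ?thesis by (simp add: LEval EP)
  next
    case LNth
    show ?thesis using 1[unfolded LNth]
      by (auto simp: LNth holds_LEq exact_macros[OF ex] sem_macros list_decode_pos)
  next
    case LEvals
    show ?thesis using 1[unfolded LEvals]
      by (auto simp: LEvals exact_macros[OF ex] sem_macros list_decode_pos)
  next
    case LBelow
    show ?thesis using 1[unfolded LBelow]
      by (cases "\<rho> EN") (auto simp: LBelow exact_macros[OF ex] sem_macros less_Suc_eq)
  qed simp_all
qed

lemma holds_LNth:
  "\<rho> EB < length (list_decode (\<rho> EA)) \<Longrightarrow> list_decode (\<rho> EA) ! \<rho> EB = \<rho> EZ \<Longrightarrow> holds LNth \<rho>"
proof (induction "\<rho> EB" arbitrary: \<rho>)
  case 0
  then have "0 < \<rho> EA" by (metis gr0I list_decode.simps(1) list.size(3) not_less_zero)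
  with 0 show ?case
    by (subst holds_iff) (simp add: exact_macros[OF exact_holds] sem_macros list_decode_pos)
next
  case (Suc n)
  have EB: "\<rho> EB = Suc n" using Suc.hyps(2) by simp
  have pos: "0 < \<rho> EA" using Suc.prems by (metis gr0I list_decode.simps(1) list.size(3) not_less_zero)
  let ?\<rho> = "\<rho>(EA := snd (prod_decode (\<rho> EA - 1)), EB := n,
    EH := fst (prod_decode (\<rho> EA - 1)), EY := snd (prod_decode (\<rho> EA - 1)))"
  have "holds LNth ?\<rho>"
    by (rule Suc.hyps(1)) (use Suc.prems EB pos in \<open>auto simp: list_decode_pos\<close>)
  then show ?case using EB pos
    by (subst holds_iff)
      (simp add: exact_macros[OF exact_holds] sem_macros fun_upd_twist)
qed

text \<open>The premise speaks of all assignments with the right \<open>EP\<close>,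
  \<open>EA\<close> and \<open>EZ\<close>, because the calls are made with varying leftovers in the
  other registers.\<close>

lemma holds_LEvals:
  assumes "list_all2 (\<lambda>g y. \<forall>\<rho>. recf_decode (\<rho> EP) = g \<longrightarrow> list_decode (\<rho> EA) = xs \<longrightarrow>
      \<rho> EZ = y \<longrightarrow> holds LEval \<rho>) gs ys"
    and "map recf_decode (list_decode (\<rho> EG)) = gs" "list_decode (\<rho> EY) = ys"
    and "list_decode (\<rho> EA) = xs"
  shows "holds LEvals \<rho>"
  using assms
proof (induction arbitrary: \<rho> rule: list_all2_induct)
  case Nil
  then have "\<rho> EG = 0" "\<rho> EY = 0" by (simp_all add: list_decode_eq_Nil)
  then show ?case by (subst holds_iff) (simp add: sem_macros)
next
  case (Cons g gs y ys)
  have pos: "0 < \<rho> EG" "0 < \<rho> EY"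
    using Cons.prems(1,2) by (metis gr0I list_decode.simps(1) list.simps(8) list.distinct(1))+
  show ?case
    by (subst holds_iff)
      (use Cons pos in \<open>simp add: exact_macros[OF exact_holds] sem_macros list_decode_pos\<close>)
qed

lemma holds_LBelow:
  assumes "\<And>m. m < n \<Longrightarrow> \<exists>y. \<forall>\<rho>. recf_decode (\<rho> EP) = f \<longrightarrow> list_decode (\<rho> EA) = m # xs \<longrightarrow>
      \<rho> EZ = Suc y \<longrightarrow> holds LEval \<rho>"
    and "\<rho> EN \<le> n" "recf_decode (\<rho> EB) = f" "list_decode (\<rho> EA) = xs"
  shows "holds LBelow \<rho>"
  using assms(2-)
proof (induction "\<rho> EN" arbitrary: \<rho>)
  case 0
  then show ?case by (subst holds_iff) (simp add: sem_macros)
next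
  case (Suc k)
  have EN: "\<rho> EN = Suc k" using Suc.hyps(2) by simp
  obtain y where y: "\<And>\<rho>. recf_decode (\<rho> EP) = f \<Longrightarrow> list_decode (\<rho> EA) = k # xs \<Longrightarrow>
      \<rho> EZ = Suc y \<Longrightarrow> holds LEval \<rho>"
    using assms(1)[of k] EN Suc.prems(1) by auto
  have "holds LBelow (\<rho>(EN := k))"
    by (rule Suc.hyps(1)) (use Suc.prems EN in auto)
  then show ?case
    by (subst holds_iff)
      (use EN Suc.prems y in \<open>auto simp: exact_macros[OF exact_holds] sem_macros intro!: exI[of _ y]\<close>)
qed

lemma holds_complete:
  "computes p xs z \<Longrightarrow> recf_decode (\<rho> EP) = p \<Longrightarrow> list_decode (\<rho> EA) = xs \<Longrightarrow> \<rho> EZ = z \<Longrightarrow>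
   holds LEval \<rho>"
proof (induction arbitrary: \<rho> rule: computes.induct)
  case (zero xs)
  obtain t b where EP: "\<rho> EP = prod_encode (t, b)" by (metis prod_decode_inverse surj_pair)
  have "t = 0" using zero by (simp add: EP recf_decode_encode split: if_splits)
  then show ?case using zero
    by (subst holds_iff) (simp add: exact_macros[OF exact_holds] sem_macros EP)
next
  case (succ x xs)
  obtain t b where EP: "\<rho> EP = prod_encode (t, b)" by (metis prod_decode_inverse surj_pair)
  have t: "t = 1" using succ by (simp add: EP recf_decode_encode split: if_splits)
  have "0 < \<rho> EA" using succ by (metis gr0I list_decode.simps(1) list.distinct(1))
  then show ?case using succ t
    by (subst holds_iff) (simp add: exact_macros[OF exact_holds] sem_macros EP list_decode_pos)
next
  case (proj i xs)
  obtain t b where EP: "\<rho> EP = prod_encode (t, b)" by (metis prod_decode_inverse surj_pair)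
  have t: "t = 2 \<and> b = i" using proj by (simp add: EP recf_decode_encode split: if_splits)
  then show ?case using proj
    by (subst holds_iff) (simp add: exact_macros[OF exact_holds] sem_macros EP holds_LNth)
next
  case (comp xs gs ys f z)
  obtain t b where EP: "\<rho> EP = prod_encode (t, b)" by (metis prod_decode_inverse surj_pair)
  have t: "t = 3 \<and> recf_decode (fst (prod_decode b)) = f \<and>
      map recf_decode (list_decode (snd (prod_decode b))) = gs"
    using comp.prems by (simp add: EP recf_decode_encode split: if_splits)
  have *: "list_all2 (\<lambda>g y. \<forall>\<rho>. recf_decode (\<rho> EP) = g \<longrightarrow> list_decode (\<rho> EA) = xs \<longrightarrow>
      \<rho> EZ = y \<longrightarrow> holds LEval \<rho>) gs ys"
    using comp.IH(1) by (rule list_all2_mono) blast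
  show ?case
    by (subst holds_iff)
      (use t comp.prems in \<open>auto simp: exact_macros[OF exact_holds] sem_macros EP
          intro!: exI[of _ "list_encode ys"] holds_LEvals[OF *] comp.IH(2)\<close>)
next
  case (prec_0 f xs z g)
  obtain t b where EP: "\<rho> EP = prod_encode (t, b)" by (metis prod_decode_inverse surj_pair)
  have t: "t = 4 \<and> recf_decode (fst (prod_decode b)) = f"
    using prec_0.prems by (simp add: EP recf_decode_encode split: if_splits)
  have "0 < \<rho> EA" using prec_0.prems by (metis gr0I list_decode.simps(1) list.distinct(1))
  then show ?case
    by (subst holds_iff)
      (use t prec_0 in \<open>simp add: exact_macros[OF exact_holds] sem_macros EP prog_prec_def
         list_decode_pos\<close>)
next
  case (prec_Suc f g n xs y z)
  obtain t b where EP: "\<rho> EP = prod_encode (t, b)" by (metis prod_decode_inverse surj_pair)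
  have t: "t = 4 \<and> recf_decode (fst (prod_decode b)) = f \<and> recf_decode (snd (prod_decode b)) = g"
    using prec_Suc.prems by (simp add: EP recf_decode_encode split: if_splits)
  have EA: "0 < \<rho> EA" using prec_Suc.prems by (metis gr0I list_decode.simps(1) list.distinct(1))
  then have xs: "fst (prod_decode (\<rho> EA - 1)) = Suc n"
      "list_decode (snd (prod_decode (\<rho> EA - 1))) = xs"
    using prec_Suc.prems(2) by (simp_all add: list_decode_pos)
  \<comment> \<open>The registers when \<open>prog_prec\<close> has just guessed the previous value
    \<open>y\<close>; \<open>EA\<close> is one less than before because \<open>uncons\<close>
    decrements it.\<close>
  let ?\<rho> = "\<rho>(EU := 0, EB := b, EF := fst (prod_decode b), EG := snd (prod_decode b),
      EA := \<rho> EA - 1, EN := n, EH := snd (prod_decode (\<rho> EA - 1)), EY := y)"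
  let ?c = "\<lambda>a b. Suc (prod_encode (a, b))"
  have 1: "holds LEval (?\<rho>(EZ := y, EA := ?c n (?\<rho> EH)))"
    by (rule prec_Suc.IH(1)) (use prec_Suc.prems xs in simp_all)
  have 2: "holds LEval (?\<rho>(EU := ?c y (?\<rho> EH), EA := ?c n (?c y (?\<rho> EH)), EP := ?\<rho> EG))"
    by (rule prec_Suc.IH(2)) (use prec_Suc.prems t xs in simp_all)
  show ?case
    by (subst holds_iff)
      (use t EA xs 1 2 in \<open>auto simp: exact_macros[OF exact_holds] sem_macros EP prog_prec_def
         fun_upd_twist intro!: exI[of _ y]\<close>)
next
  case (mu f n xs)
  obtain t b where EP: "\<rho> EP = prod_encode (t, b)" by (metis prod_decode_inverse surj_pair)
  have t: "4 < t \<and> recf_decode b = f"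
    using mu.prems by (simp add: EP recf_decode_encode split: if_splits)
  have *: "\<exists>y. \<forall>\<rho>. recf_decode (\<rho> EP) = f \<longrightarrow> list_decode (\<rho> EA) = m # xs \<longrightarrow>
      \<rho> EZ = Suc y \<longrightarrow> holds LEval \<rho>" if "m < n" for m
    using mu.IH(2)[OF that] by blast
  show ?case
    by (subst holds_iff)
      (use t mu.prems in \<open>auto simp: exact_macros[OF exact_holds] sem_macros EP prog_mu_def
         intro!: mu.IH(1) holds_LBelow[OF *]\<close>)
qed

lemma holds_LEval:
  "holds LEval \<rho> \<longleftrightarrow> computes (recf_decode (\<rho> EP)) (list_decode (\<rho> EA)) (\<rho> EZ)"
  using holds_sound[of LEval] holds_complete by auto

lemma sem_eval_call:
  assumes "r \<notin> {EP, EH, EY, EA}" "s \<notin> {EP, EH, EY, EA}"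
  shows "sem holds (eval_call r s (Call LEval)) \<rho> \<longleftrightarrow>
      computes (recf_decode (\<rho> r)) [\<rho> RX, \<rho> s] 0"
    and "sem holds (eval_call r s (Inc EZ (Call LEval))) \<rho> \<longleftrightarrow>
      computes (recf_decode (\<rho> r)) [\<rho> RX, \<rho> s] 1"
  using assms by (auto simp: eval_call_def exact_macros[OF exact_holds] sem_macros holds_LEval)

lemma holds_LRound:
  "holds LRound \<rho> \<longleftrightarrow> (\<exists>v.
     computes (recf_decode (\<rho> RP)) [\<rho> RX, Suc (prod_encode (v, \<rho> RS))] 1 \<and>
     (\<forall>w. computes (recf_decode (\<rho> RQ)) [\<rho> RX, Suc (prod_encode (w, \<rho> RT))] 0 \<or>
        holds LRound (\<rho>(RV := v, RC := Suc (prod_encode (w, \<rho> RT)),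
          RS := Suc (prod_encode (v, \<rho> RS)), RW := w, RT := Suc (prod_encode (w, \<rho> RT))))))"
  by (subst holds_iff)
    (simp add: exact_macros[OF exact_holds] sem_macros sem_eval_call fun_upd_twist)

section \<open>A normal form for \<open>\<Sigma>\<^sup>1\<^sub>1\<close> sets\<close>

text \<open>To be used with the map that sends \<open>x\<close> to the element by which a strategy
  code records the answer at \<open>x\<close>.\<close>

lemma Sigma11_vimage:
  assumes "Sigma11 S" "computable (Suc 0) (\<lambda>xs. g (xs ! 0))"
  shows "Sigma11 {x. g x \<in> S}"
proof -
  obtain b n R where n: "1 \<le> n" and R: "recursive_rel (Suc n) R"
    and S: "S = {x. \<exists>\<phi> :: nat \<Rightarrow> nat. alt_quant b n (matrix R [x] \<phi>)}"
    using assms(1) unfolding Sigma11_def by blast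
  define R' where "R' xs = R (g (hd xs) # tl xs)" for xs
  define gs where "gs = (\<lambda>xs. g (xs ! 0)) # map (\<lambda>i xs. xs ! Suc i) [0..<n]"
  have "recursive_rel (Suc n) (\<lambda>xs. R (map (\<lambda>g. g xs) gs))"
    by (rule recursive_rel_comp)
      (use R in \<open>auto simp: gs_def intro!: computable_proj computable_comp1[OF assms(2)]\<close>)
  then have "recursive_rel (Suc n) R'"
    by (rule recursive_rel_cong)
      (auto simp: gs_def R'_def length_Suc_conv hd_conv_nth intro!: arg_cong[of _ _ R] nth_equalityI)
  moreover have "matrix R' [x] \<phi> = matrix R [g x] \<phi>" for x \<phi>
    by (rule ext) (simp add: matrix_def R'_def)
  ultimately show ?thesis using n unfolding Sigma11_def S
    by (intro exI[of _ b] exI[of _ n] exI[of _ R']) simp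
qed

text \<open>One Skolem function serves all existential quantifiers, since the length of the list of
  earlier values tells which quantifier is meant. Counted from 0, quantifier \<open>i\<close> is
  existential iff \<open>b = even i\<close>; removing the outermost one flips
  \<open>b\<close>.\<close>

lemma alt_quant_skolem:
  "alt_quant b n P \<longleftrightarrow> (\<exists>g. \<forall>as. length as = n \<longrightarrow>
     (\<forall>i<n. (b = even i) \<longrightarrow> as ! i = g (take i as)) \<longrightarrow> P as)"
proof (induction n arbitrary: b P)
  case 0
  then show ?case by simp
next
  case (Suc n)
  note IH = Suc.IH[of "\<not> b"]
  have flip: "(\<forall>i<Suc n. (b = even i) \<longrightarrow> (a # as) ! i = g (take i (a # as))) \<longleftrightarrow>
      (b \<longrightarrow> a = g []) \<and> (\<forall>i<n. ((\<not> b) = even i) \<longrightarrow> as ! i = g (a # take i as))"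
    for g a and as :: "nat list"
    by (auto simp: less_Suc_eq_0_disj)
  have list: "(\<forall>as. length as = Suc n \<longrightarrow> X as) \<longleftrightarrow>
      (\<forall>a as. length as = n \<longrightarrow> X (a # as))" for X :: "nat list \<Rightarrow> bool"
    by (auto simp: length_Suc_conv)
  have split: "(\<exists>g. \<forall>as. length as = Suc n \<longrightarrow>
        (\<forall>i<Suc n. (b = even i) \<longrightarrow> as ! i = g (take i as)) \<longrightarrow> P as) \<longleftrightarrow>
      (\<exists>g. \<forall>a as. length as = n \<longrightarrow> (b \<longrightarrow> a = g []) \<longrightarrow>
        (\<forall>i<n. ((\<not> b) = even i) \<longrightarrow> as ! i = g (a # take i as)) \<longrightarrow> P (a # as))"
    (is "_ \<longleftrightarrow> ?R")
    by (simp only: list flip imp_conjL)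
  show ?case
  proof (cases b)
    case True
    have "alt_quant b (Suc n) P \<longleftrightarrow> (\<exists>a g. \<forall>as. length as = n \<longrightarrow>
        (\<forall>i<n. ((\<not> b) = even i) \<longrightarrow> as ! i = g (take i as)) \<longrightarrow> P (a # as))"
      using True IH by simp
    also have "\<dots> \<longleftrightarrow> ?R"
    proof safe
      fix a g assume *: "\<forall>as. length as = n \<longrightarrow>
        (\<forall>i<n. ((\<not> b) = even i) \<longrightarrow> as ! i = g (take i as)) \<longrightarrow> P (a # as)"
      show ?R
        by (rule exI[of _ "\<lambda>l. case l of [] \<Rightarrow> a | _ # l' \<Rightarrow> g l'"]) (use * True in auto)
    next
      fix g assume "\<forall>a as. length as = n \<longrightarrow> (b \<longrightarrow> a = g []) \<longrightarrow>
        (\<forall>i<n. ((\<not> b) = even i) \<longrightarrow> as ! i = g (a # take i as)) \<longrightarrow> P (a # as)"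
      then show "\<exists>a g. \<forall>as. length as = n \<longrightarrow>
        (\<forall>i<n. ((\<not> b) = even i) \<longrightarrow> as ! i = g (take i as)) \<longrightarrow> P (a # as)"
        by (intro exI[of _ "g []"] exI[of _ "\<lambda>l. g (g [] # l)"]) auto
    qed
    finally show ?thesis unfolding split .
  next
    case False
    have "alt_quant b (Suc n) P \<longleftrightarrow> (\<forall>a. \<exists>g. \<forall>as. length as = n \<longrightarrow>
        (\<forall>i<n. ((\<not> b) = even i) \<longrightarrow> as ! i = g (take i as)) \<longrightarrow> P (a # as))"
      using False IH by simp
    also have "\<dots> \<longleftrightarrow> ?R"
    proof
      assume "\<forall>a. \<exists>g. \<forall>as. length as = n \<longrightarrow>
        (\<forall>i<n. ((\<not> b) = even i) \<longrightarrow> as ! i = g (take i as)) \<longrightarrow> P (a # as)"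
      then obtain G where *: "\<And>a. \<forall>as. length as = n \<longrightarrow>
        (\<forall>i<n. ((\<not> b) = even i) \<longrightarrow> as ! i = G a (take i as)) \<longrightarrow> P (a # as)"
        by metis
      show ?R
        by (rule exI[of _ "\<lambda>l. case l of [] \<Rightarrow> 0 | a # l' \<Rightarrow> G a l'"]) (use * False in auto)
    next
      assume ?R
      then obtain g where *: "\<forall>a as. length as = n \<longrightarrow> (b \<longrightarrow> a = g []) \<longrightarrow>
        (\<forall>i<n. ((\<not> b) = even i) \<longrightarrow> as ! i = g (a # take i as)) \<longrightarrow> P (a # as)"
        by blast
      show "\<forall>a. \<exists>g. \<forall>as. length as = n \<longrightarrow>
        (\<forall>i<n. ((\<not> b) = even i) \<longrightarrow> as ! i = g (take i as)) \<longrightarrow> P (a # as)"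
      proof
        fix a
        show "\<exists>g. \<forall>as. length as = n \<longrightarrow>
          (\<forall>i<n. ((\<not> b) = even i) \<longrightarrow> as ! i = g (take i as)) \<longrightarrow> P (a # as)"
          by (rule exI[of _ "\<lambda>l. g (a # l)"]) (use * False in auto)
      qed
    qed
    finally show ?thesis unfolding split .
  qed
qed

section \<open>Reading entries of coded initial segments\<close>

lemma code_tl_pow_le: "(code_tl ^^ i) s \<le> s"
proof (induction i)
  case (Suc i)
  have "code_tl m \<le> m" for m
    using snd_prod_decode_le[of "m - 1"] unfolding code_tl_def by linarith
  from this[of "(code_tl ^^ i) s"] Suc show ?case by simp
qed simp

lemma code_hd_le: "code_hd s \<le> s"
  using fst_prod_decode_le[of "s - 1"] unfolding code_hd_def by linarith

text \<open>The recursion builds the list from its end, so step \<open>j\<close> has to prepend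
  \<open>f (m - j)\<close>.\<close>

definition code_map :: "(nat \<Rightarrow> nat) \<Rightarrow> nat \<Rightarrow> nat" where
  "code_map f m = rec_nat 0 (\<lambda>j y. Suc (prod_encode (f (m - j), y))) (Suc m)"

lemma code_map: "code_map f m = list_encode (map f [0..<Suc m])"
proof -
  have "rec_nat 0 (\<lambda>j y. Suc (prod_encode (f (m - j), y))) j =
      list_encode (map f [Suc m - j..<Suc m])" if "j \<le> Suc m" for j
    using that
  proof (induction j)
    case (Suc j)
    then have "[Suc m - Suc j..<Suc m] = (m - j) # [Suc m - j..<Suc m]"
      by (simp add: upt_rec Suc_diff_le)
    with Suc show ?case by simp
  qed simp
  from this[of "Suc m"] show ?thesis unfolding code_map_def by simp
qed

text \<open>Branches are stored with the newest entry first, so entry \<open>i\<close> has to be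
  counted from the end.\<close>

definition lookup :: "nat \<Rightarrow> nat \<Rightarrow> nat" where
  "lookup r i = code_hd ((code_tl ^^ (code_length r - 1 - i)) r)"

lemma lookup_rev_prefix:
  assumes "i \<le> k"
  shows "lookup (list_encode (rev (prefix (Suc k) \<psi>))) i = \<psi> i"
proof -
  define l where "l = rev (prefix (Suc k) \<psi>)"
  have len: "length l = Suc k" by (simp add: l_def)
  have "lookup (list_encode l) i = l ! (k - i)"
    unfolding lookup_def by (subst code_nth_encode) (simp_all add: code_length_encode len)
  also have "\<dots> = \<psi> i" using assms unfolding l_def
    by (cases "i = k") (auto simp: rev_nth nth_append)
  finally show ?thesis unfolding l_def .
qed

lemma computable_lookup:
  "computable k r \<Longrightarrow> computable k i \<Longrightarrow> computable k (\<lambda>xs. lookup (r xs) (i xs))"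
  unfolding lookup_def
  by (intro computable_code_hd computable_code_tl_pow computable_diff computable_code_length
      computable_const)

text \<open>A branch \<open>\<psi>\<close> consists of pairs: the first components are the witness
  \<open>\<phi>\<close>, the second ones a Skolem function on codes of lists. The node of length
  \<open>Suc k\<close> checks the one tuple \<open>as\<close> with
  \<open>list_encode (rev as) = k\<close>. By the reversal, initial segments of \<open>as\<close>
  are tails of the coded list; so their codes, and also the last entry of \<open>as\<close>, are at
  most \<open>k\<close>, and the node contains all values that the check needs.\<close>

lemma Sigma11_normal_form:
  assumes "Sigma11 S"
  obtains R where "recursive_rel 2 R"
    "S = {x. \<exists>\<psi>. \<forall>k. R [x, list_encode (rev (prefix (Suc k) \<psi>))]}"
proof -
  obtain b n R where n: "1 \<le> n" and R: "recursive_rel (Suc n) R"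
    and S: "S = {x. \<exists>\<phi> :: nat \<Rightarrow> nat. alt_quant b n (matrix R [x] \<phi>)}"
    using assms(1) unfolding Sigma11_def by blast
  define entry where "entry c i = code_hd ((code_tl ^^ (n - 1 - i)) c)" for c i
  \<comment> \<open>The first two conjuncts say that the list coded by \<open>c\<close> has length
    exactly \<open>n\<close>.\<close>
  define Q where "Q x r c \<longleftrightarrow>
      (code_tl ^^ n) c = 0 \<and> (code_tl ^^ (n - 1)) c \<noteq> 0 \<and>
      (\<forall>i\<in>{..<n}. (b = even i) \<longrightarrow> entry c i = snd (prod_decode (lookup r ((code_tl ^^ (n - i)) c))))
      \<longrightarrow> R (x # map (entry c) [0..<n - 1] @
           [code_map (\<lambda>i. fst (prod_decode (lookup r i))) (code_hd c)])" for x r c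
  define R' where "R' xs = Q (xs ! 0) (xs ! 1) (code_length (xs ! 1) - 1)" for xs
  have c: "computable 2 (\<lambda>xs. code_length (xs ! 1) - 1)"
    by (intro computable_diff computable_code_length computable_proj computable_const) simp
  have entry: "computable 2 (\<lambda>xs. entry (code_length (xs ! 1) - 1) i)" for i
    unfolding entry_def by (intro computable_code_hd computable_code_tl_pow computable_const c)
  have step: "computable (Suc (Suc 2)) (\<lambda>ys. Suc (prod_encode (fst (prod_decode (lookup (ys ! 3)
      (code_hd (code_length (ys ! 3) - 1) - ys ! 0))), ys ! 1)))"
    by (intro computable_Suc computable_prod_encode computable_fst_prod_decode computable_lookup
        computable_diff computable_code_hd computable_code_length computable_proj computable_const)
      simp_all
  have map: "computable 2 (\<lambda>xs. code_map (\<lambda>i. fst (prod_decode (lookup (xs ! 1) i)))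
      (code_hd (code_length (xs ! 1) - 1)))"
    unfolding code_map_def
  proof (rule computable_rec_nat[where s = "\<lambda>j y xs. Suc (prod_encode (fst (prod_decode (lookup (xs ! 1)
      (code_hd (code_length (xs ! 1) - 1) - j))), y))"])
    show "computable 2 (\<lambda>xs. Suc (code_hd (code_length (xs ! 1) - 1)))"
      by (intro computable_Suc computable_code_hd c)
    show "computable (Suc (Suc 2)) (\<lambda>ys. Suc (prod_encode (fst (prod_decode (lookup (drop 2 ys ! 1)
      (code_hd (code_length (drop 2 ys ! 1) - 1) - ys ! 0))), ys ! 1)))"
      by (rule computable_cong[OF step]) simp
  qed (rule computable_const)
  define gs where "gs = (\<lambda>xs. xs ! 0) #
      map (\<lambda>i xs. entry (code_length (xs ! 1) - 1) i) [0..<n - 1] @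
      [\<lambda>xs. code_map (\<lambda>i. fst (prod_decode (lookup (xs ! 1) i))) (code_hd (code_length (xs ! 1) - 1))]"
  have "recursive_rel 2 (\<lambda>xs. R (map (\<lambda>g. g xs) gs))"
    by (rule recursive_rel_comp)
      (use R n map entry in \<open>auto simp: gs_def intro!: computable_proj\<close>)
  then have "recursive_rel 2 (\<lambda>xs. R (xs ! 0 # map (entry (code_length (xs ! 1) - 1)) [0..<n - 1] @
      [code_map (\<lambda>i. fst (prod_decode (lookup (xs ! 1) i))) (code_hd (code_length (xs ! 1) - 1))]))"
    by (simp add: gs_def comp_def)
  then have "recursive_rel 2 R'"
    unfolding R'_def Q_def
    by (intro recursive_rel_imp recursive_rel_conj recursive_rel_not recursive_rel_Ball
        recursive_rel_const recursive_rel_eq entry c computable_const computable_code_tl_pow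
        computable_snd_prod_decode computable_lookup computable_proj) simp_all
  moreover have key: "R' [x, list_encode (rev (prefix (Suc (list_encode (rev as))) \<psi>))] \<longleftrightarrow>
      (length as = n \<longrightarrow>
        (\<forall>i<n. (b = even i) \<longrightarrow> as ! i = snd (prod_decode (\<psi> (list_encode (rev (take i as)))))) \<longrightarrow>
        matrix R [x] (\<lambda>i. fst (prod_decode (\<psi> i))) as)" for x \<psi> as
  proof -
    define k where "k = list_encode (rev as)"
    define r where "r = list_encode (rev (prefix (Suc k) \<psi>))"
    have len: "code_length r - 1 = k"
      unfolding r_def code_length_encode by simp
    have R'_eq: "R' [x, r] \<longleftrightarrow> Q x r k" using len unfolding R'_def by simp
    have lk: "lookup r i = \<psi> i" if "i \<le> k" for i
      unfolding r_def using that by (rule lookup_rev_prefix)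
    have "(code_tl ^^ n) k = 0 \<longleftrightarrow> length as \<le> n"
      using list_encode_eq[of "drop n (rev as)" "[]"] by (simp add: k_def code_tl_pow_encode)
    moreover have "(code_tl ^^ (n - 1)) k = 0 \<longleftrightarrow> length as \<le> n - 1"
      using list_encode_eq[of "drop (n - 1) (rev as)" "[]"] by (simp add: k_def code_tl_pow_encode)
    ultimately have form: "(code_tl ^^ n) k = 0 \<and> (code_tl ^^ (n - 1)) k \<noteq> 0 \<longleftrightarrow> length as = n"
      using n by auto
    show ?thesis
    proof (cases "length as = n")
      case False
      then show ?thesis using form
        unfolding k_def[symmetric] r_def[symmetric] R'_eq Q_def by blast
    next
      case True
      have entry: "entry k i = as ! i" if "i < n" for i
        unfolding entry_def k_def using that True
        by (subst code_nth_encode) (auto simp: rev_nth)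
      have idx: "(code_tl ^^ (n - i)) k = list_encode (rev (take i as))" if "i < n" for i
        unfolding k_def code_tl_pow_encode using that True by (simp add: drop_rev)
      have idx_le: "list_encode (rev (take i as)) \<le> k" if "i < n" for i
        using code_tl_pow_le[of "n - i" k] idx[OF that] by simp
      have ne: "as \<noteq> []" using True n by auto
      have hd: "code_hd k = last as"
        using entry[of "n - 1"] n True ne by (simp add: entry_def last_conv_nth)
      have last_le: "last as \<le> k" using code_hd_le[of k] hd by simp
      have "code_map (\<lambda>i. fst (prod_decode (lookup r i))) (code_hd k) =
          list_encode (prefix (Suc (last as)) (\<lambda>i. fst (prod_decode (\<psi> i))))"
        unfolding code_map hd subsequence_def
        using last_le by (intro arg_cong[of _ _ list_encode] map_cong) (auto simp: lk)
      moreover have "map (entry k) [0..<n - 1] = butlast as"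
        using True by (intro nth_equalityI) (auto simp: entry nth_butlast)
      ultimately show ?thesis
        using True form
        unfolding k_def[symmetric] r_def[symmetric] R'_eq Q_def matrix_def
        by (simp add: entry idx lk idx_le Ball_def)
    qed
  qed
  have "x \<in> S \<longleftrightarrow> (\<exists>\<psi>. \<forall>k. R' [x, list_encode (rev (prefix (Suc k) \<psi>))])" for x
  proof
    assume "x \<in> S"
    then obtain \<phi> g where g: "\<And>as. length as = n \<Longrightarrow>
        (\<forall>i<n. (b = even i) \<longrightarrow> as ! i = g (take i as)) \<Longrightarrow> matrix R [x] \<phi> as"
      unfolding S alt_quant_skolem by blast
    define \<psi> where "\<psi> m = prod_encode (\<phi> m, g (rev (list_decode m)))" for m
    have "R' [x, list_encode (rev (prefix (Suc (list_encode (rev as))) \<psi>))]" for as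
      unfolding key using g[of as] by (simp add: \<psi>_def)
    \<comment> \<open>Every number is the code of some reversed list, so all nodes of the branch are
      covered.\<close>
    from this[of "rev (list_decode _)"]
    have "R' [x, list_encode (rev (prefix (Suc k) \<psi>))]" for k by simp
    then show "\<exists>\<psi>. \<forall>k. R' [x, list_encode (rev (prefix (Suc k) \<psi>))]" by blast
  next
    assume "\<exists>\<psi>. \<forall>k. R' [x, list_encode (rev (prefix (Suc k) \<psi>))]"
    then obtain \<psi> where \<psi>: "\<And>as. R' [x, list_encode (rev (prefix (Suc (list_encode (rev as))) \<psi>))]"
      by blast
    show "x \<in> S"
      unfolding S alt_quant_skolem mem_Collect_eq
      by (rule exI[of _ "\<lambda>i. fst (prod_decode (\<psi> i))"],
          rule exI[of _ "\<lambda>l. snd (prod_decode (\<psi> (list_encode (rev l))))"])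
        (use \<psi>[unfolded key] in blast)
  qed
  then have "S = {x. \<exists>\<psi>. \<forall>k. R' [x, list_encode (rev (prefix (Suc k) \<psi>))]}" by blast
  ultimately show thesis by (rule that)
qed

section \<open>The tree comparison game\<close>

definition start0 :: fm where
  "start0 = unpair RQ RP RX (Call LRound)"

definition start1 :: fm where
  "start1 = unpair RP RQ RX (Call LRound)"

text \<open>By induction on the first derivation: its move \<open>v\<close> and the move
  \<open>w\<close> of the second derivation serve as the answers of Player 2 on the opposite side.
  Both extended sequences are accepted, so neither side can claim a rejection, computations being
  deterministic, and after the round the two positions mirror each other again.\<close>

lemma LRound_asym:
  assumes "holds LRound \<rho>" "\<rho>' RP = \<rho> RQ" "\<rho>' RQ = \<rho> RP" "\<rho>' RX = \<rho> RX" "\<rho>' RS = \<rho> RT" "\<rho>' RT = \<rho> RS"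
  shows "\<not> holds LRound \<rho>'"
  using assms
proof (induction LRound \<rho> arbitrary: \<rho>' rule: holds.induct)
  case (1 \<rho>)
  let ?I = "\<lambda>l \<rho>. holds l \<rho> \<and> (l = LRound \<longrightarrow> (\<forall>\<rho>'. \<rho>' RP = \<rho> RQ \<longrightarrow> \<rho>' RQ = \<rho> RP \<longrightarrow>
    \<rho>' RX = \<rho> RX \<longrightarrow> \<rho>' RS = \<rho> RT \<longrightarrow> \<rho>' RT = \<rho> RS \<longrightarrow> \<not> holds LRound \<rho>'))"
  have ex: "exact ?I"
    using exact_holds by (auto simp: exact_def)
  let ?c = "\<lambda>a b. Suc (prod_encode (a, b))"
  have "sem ?I (prog LRound) \<rho>" using 1(1) by simp
  then obtain v where v: "computes (recf_decode (\<rho> RP)) [\<rho> RX, ?c v (\<rho> RS)] 1"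
    and step: "\<And>w. computes (recf_decode (\<rho> RQ)) [\<rho> RX, ?c w (\<rho> RT)] 0 \<or>
      ?I LRound (\<rho>(RV := v, RC := ?c v (\<rho> RS), RS := ?c v (\<rho> RS), RW := w, RC := ?c w (\<rho> RT),
          RT := ?c w (\<rho> RT)))"
    by (simp add: exact_macros[OF ex] sem_macros eval_call_def holds_LEval) blast
  show ?case
  proof
    assume "holds LRound \<rho>'"
    then obtain w where w: "computes (recf_decode (\<rho> RQ)) [\<rho> RX, ?c w (\<rho> RT)] 1"
      and step': "computes (recf_decode (\<rho> RP)) [\<rho> RX, ?c v (\<rho> RS)] 0 \<or>
        holds LRound (\<rho>'(RV := w, RC := ?c v (\<rho> RS), RS := ?c w (\<rho> RT), RW := v, RT := ?c v (\<rho> RS)))"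
      by (subst (asm) holds_LRound) (use 1(2-) in auto)
    have "holds LRound (\<rho>'(RV := w, RC := ?c v (\<rho> RS), RS := ?c w (\<rho> RT), RW := v, RT := ?c v (\<rho> RS)))"
      using step' computes_deterministic[OF v] by fastforce
    then show False
      using step[of w] computes_deterministic[OF w] 1(2-) by fastforce
  qed
qed

lemma not_start0_and_start1:
  assumes "\<rho> RS = \<rho> RT"
  shows "\<not> (sem holds start0 \<rho> \<and> sem holds start1 \<rho>)"
  using LRound_asym[of "\<rho>(RP := fst (prod_decode (\<rho> RX)), RQ := snd (prod_decode (\<rho> RX)))"
      "\<rho>(RQ := fst (prod_decode (\<rho> RX)), RP := snd (prod_decode (\<rho> RX)))"] assms
  by (auto simp: start0_def start1_def exact_macros[OF exact_holds])

text \<open>Player 1 plays along \<open>\<psi>\<close>. If this did not give a derivation, Player 2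
  would always have an answer that is not rejected, and these answers would form a branch through
  \<open>B\<close>.\<close>

lemma LRound_wins:
  assumes A: "\<And>s. computes (recf_decode (\<rho> RP)) [\<rho> RX, s] (if A s then 1 else 0)"
    and B: "\<And>s. computes (recf_decode (\<rho> RQ)) [\<rho> RX, s] (if B s then 1 else 0)"
    and path: "\<And>k. A (list_encode (rev (prefix (Suc k) \<psi>)))"
    and no_path: "\<not> (\<exists>\<psi>. \<forall>k. B (list_encode (rev (prefix (Suc k) \<psi>))))"
    and zero: "\<rho> RS = 0" "\<rho> RT = 0"
  shows "holds LRound \<rho>"
proof (rule ccontr)
  assume neg: "\<not> holds LRound \<rho>"
  \<comment> \<open>\<open>P\<close> fixes \<open>RT\<close> only at the start; afterwards
    \<open>Q\<close> links it to its predecessor.\<close>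
  define P where "P k \<rho>' \<longleftrightarrow> \<rho>' RP = \<rho> RP \<and> \<rho>' RQ = \<rho> RQ \<and> \<rho>' RX = \<rho> RX \<and>
      \<rho>' RS = list_encode (rev (prefix k \<psi>)) \<and> (k = 0 \<longrightarrow> \<rho>' RT = 0) \<and> \<not> holds LRound \<rho>'"
    for k :: nat and \<rho>'
  define Q where "Q \<rho>1 \<rho>2 \<longleftrightarrow> B (\<rho>2 RT) \<and> (\<exists>w. \<rho>2 RT = Suc (prod_encode (w, \<rho>1 RT)))"
    for \<rho>1 \<rho>2 :: "reg \<Rightarrow> nat"
  have "\<exists>f. \<forall>k. P k (f k) \<and> Q (f k) (f (Suc k))"
  proof (rule dependent_nat_choice)
    show "\<exists>\<rho>'. P 0 \<rho>'" using neg zero by (intro exI[of _ \<rho>]) (simp add: P_def)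
  next
    fix \<rho>' k assume P: "P k \<rho>'"
    let ?c = "\<lambda>a b. Suc (prod_encode (a, b))"
    have "computes (recf_decode (\<rho>' RP)) [\<rho>' RX, ?c (\<psi> k) (\<rho>' RS)] 1"
      using A[of "?c (\<psi> k) (\<rho>' RS)"] path[of k] P by (simp add: P_def)
    then obtain w where w: "\<not> computes (recf_decode (\<rho>' RQ)) [\<rho>' RX, ?c w (\<rho>' RT)] 0"
      "\<not> holds LRound (\<rho>'(RV := \<psi> k, RC := ?c w (\<rho>' RT), RS := ?c (\<psi> k) (\<rho>' RS), RW := w,
          RT := ?c w (\<rho>' RT)))"
      using P holds_LRound[of \<rho>'] by (auto simp: P_def)
    have "B (?c w (\<rho>' RT))" using B[of "?c w (\<rho>' RT)"] w(1) P by (auto simp: P_def split: if_splits)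
    then show "\<exists>\<rho>''. P (Suc k) \<rho>'' \<and> Q \<rho>' \<rho>''"
      using w(2) P
      by (intro exI[of _ "\<rho>'(RV := \<psi> k, RC := ?c w (\<rho>' RT), RS := ?c (\<psi> k) (\<rho>' RS), RW := w,
          RT := ?c w (\<rho>' RT))"]) (simp add: P_def Q_def)
  qed
  then obtain f where f: "\<And>k. P k (f k)" "\<And>k. Q (f k) (f (Suc k))" by blast
  define \<psi>' where "\<psi>' k = code_hd (f (Suc k) RT)" for k
  have "f k RT = list_encode (rev (prefix k \<psi>'))" for k
  proof (induction k)
    case 0
    then show ?case using f(1)[of 0] by (simp add: P_def)
  next
    case (Suc k)
    then show ?case using f(2)[of k] by (auto simp: Q_def \<psi>'_def code_hd_def)
  qed
  then have "B (list_encode (rev (prefix (Suc k) \<psi>')))" for k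
    using f(2)[of k] by (metis Q_def)
  with no_path show False by blast
qed

lemma Sigma11_programE:
  assumes "Sigma11 S"
  obtains n A where "\<And>x s. computes (recf_decode n) [x, s] (if A x s then 1 else 0)"
    "\<And>x. x \<in> S \<longleftrightarrow> (\<exists>\<psi>. \<forall>k. A x (list_encode (rev (prefix (Suc k) \<psi>))))"
proof -
  obtain R where R: "recursive_rel 2 R"
    "S = {x. \<exists>\<psi>. \<forall>k. R [x, list_encode (rev (prefix (Suc k) \<psi>))]}"
    using Sigma11_normal_form[OF assms] .
  obtain p where p: "\<And>xs. length xs = 2 \<Longrightarrow> computes p xs (if R xs then 1 else 0)"
    using R(1) unfolding recursive_rel_def by blast
  obtain n where "recf_decode n = p" using surj_recf_decode by blast
  with p R(2) show thesis by (intro that[of n "\<lambda>x s. R [x, s]"]) auto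
qed

lemma hyperarithmetical_diagonal:
  assumes "hyperarithmetical S"
  shows "\<exists>x. (x \<in> S \<longrightarrow> sem holds start1 ((\<lambda>_. 0)(RX := x))) \<and>
    (x \<notin> S \<longrightarrow> sem holds start0 ((\<lambda>_. 0)(RX := x)))"
proof -
  obtain m A where A: "\<And>x s. computes (recf_decode m) [x, s] (if A x s then 1 else 0)"
    "\<And>x. x \<in> S \<longleftrightarrow> (\<exists>\<psi>. \<forall>k. A x (list_encode (rev (prefix (Suc k) \<psi>))))"
    using Sigma11_programE assms unfolding hyperarithmetical_def by metis
  obtain n B where B: "\<And>x s. computes (recf_decode n) [x, s] (if B x s then 1 else 0)"
    "\<And>x. x \<in> - S \<longleftrightarrow> (\<exists>\<psi>. \<forall>k. B x (list_encode (rev (prefix (Suc k) \<psi>))))"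
    using Sigma11_programE assms unfolding hyperarithmetical_def by metis
  define x where "x = prod_encode (m, n)"
  show ?thesis
  proof (intro exI[of _ x] conjI impI)
    assume "x \<in> S"
    then obtain \<psi> where "\<And>k. A x (list_encode (rev (prefix (Suc k) \<psi>)))" using A(2) by blast
    moreover have "\<not> (\<exists>\<psi>. \<forall>k. B x (list_encode (rev (prefix (Suc k) \<psi>))))"
      using B(2)[of x] \<open>x \<in> S\<close> by blast
    ultimately have "holds LRound ((\<lambda>_. 0)(RX := x, RP := m, RQ := n))"
      by (intro LRound_wins[of _ "A x" "B x" \<psi>]) (simp_all add: A(1) B(1) del: upt_Suc)
    then show "sem holds start1 ((\<lambda>_. 0)(RX := x))"
      by (simp add: start1_def exact_macros[OF exact_holds] x_def)
  next
    assume "x \<notin> S"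
    then obtain \<psi> where "\<And>k. B x (list_encode (rev (prefix (Suc k) \<psi>)))" using B(2)[of x] by blast
    moreover have "\<not> (\<exists>\<psi>. \<forall>k. A x (list_encode (rev (prefix (Suc k) \<psi>))))"
      using A(2)[of x] \<open>x \<notin> S\<close> by blast
    ultimately have "holds LRound ((\<lambda>_. 0)(RX := x, RQ := m, RP := n))"
      by (intro LRound_wins[of _ "B x" "A x" \<psi>]) (simp_all add: A(1) B(1) del: upt_Suc)
    then show "sem holds start0 ((\<lambda>_. 0)(RX := x))"
      by (simp add: start0_def exact_macros[OF exact_holds] x_def)
  qed
qed

section \<open>The game and its language\<close>

text \<open>\<open>a\<close> is the bit of Player 1 and \<open>b\<close> that of Player 2. In
  \<open>Ask\<close>, the bit 1 of Player 2 leads to \<open>Tru\<close> while Player 1 is still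
  counting. So every winning strategy has to give the same answers during the opening, and the word
  announcing \<open>x\<close> does not depend on the strategy.\<close>

primrec next_fm :: "fm \<Rightarrow> bool \<Rightarrow> bool \<Rightarrow> fm" where
  "next_fm Tru a b = Tru"
| "next_fm (Test r z) a b = Test r z"
| "next_fm (Either A B) a b = (if a then B else A)"
| "next_fm (Both A B) a b = (if b then B else A)"
| "next_fm (Inc r A) a b = A"
| "next_fm (Dec r A) a b = (if b then Test r False else A)"
| "next_fm (Guess r A) a b =
     (if a then Either (Inc r (Guess r A)) (Dec r (Guess r A)) else A)"
| "next_fm (Forall r A) a b = (if b then Forall r A else A)"
| "next_fm (Call l) a b = prog l"
| "next_fm (Ask r A B) a b =
     (if a then if b then B else A else if b then Tru else Ask r A B)"

primrec delta :: "fm \<Rightarrow> bool \<Rightarrow> bool \<Rightarrow> reg \<Rightarrow> int" where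
  "delta Tru a b = (\<lambda>s. 0)"
| "delta (Test r z) a b = (\<lambda>s. 0)"
| "delta (Either A B) a b = (\<lambda>s. 0)"
| "delta (Both A B) a b = (\<lambda>s. 0)"
| "delta (Inc r A) a b = (\<lambda>s. if s = r then 1 else 0)"
| "delta (Dec r A) a b = (\<lambda>s. if s = r \<and> \<not> b then -1 else 0)"
| "delta (Guess r A) a b = (\<lambda>s. 0)"
| "delta (Forall r A) a b = (\<lambda>s. if s = r \<and> b then 1 else 0)"
| "delta (Call l) a b = (\<lambda>s. 0)"
| "delta (Ask r A B) a b = (\<lambda>s. if s = r \<and> \<not> a \<and> \<not> b then 1 else 0)"

text \<open>A letter is a pair \<open>(u, v)\<close> of numbers below \<open>4\<close>. Player 1 plays the bit \<open>a = (u \<noteq> 0)\<close>.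
  Player 2 has to answer with \<open>u = v = a + 2 b\<close> for a bit \<open>b\<close>, so that each of the two tapes
  carries all bits of the play.\<close>

definition letters :: "nat set" where
  "letters = prod_encode ` ({..<4} \<times> {..<4})"

abbreviation fst_part :: "nat \<Rightarrow> nat" where
  "fst_part l \<equiv> fst (prod_decode l)"

abbreviation snd_part :: "nat \<Rightarrow> nat" where
  "snd_part l \<equiv> snd (prod_decode l)"

definition valid_reply :: "bool \<Rightarrow> nat \<Rightarrow> bool" where
  "valid_reply a l \<longleftrightarrow> fst_part l = snd_part l \<and> odd (fst_part l) = a"

definition reply :: "bool \<Rightarrow> bool \<Rightarrow> nat" where
  "reply a b = (let u = of_bool a + 2 * of_bool b in prod_encode (u, u))"

type_synonym ctl = "bool option \<times> fm"

text \<open>Copying is the duty of Player 2 alone: an invalid reply is punished with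
  \<open>Tru\<close>, whereas all that counts in a letter of Player 1 is whether its first part is
  0.\<close>

fun step_ctl :: "ctl \<Rightarrow> nat \<Rightarrow> ctl" where
  "step_ctl (None, A) l = (Some (fst_part l \<noteq> 0), A)"
| "step_ctl (Some a, A) l =
     (None, if valid_reply a l then next_fm A a (2 \<le> fst_part l) else Tru)"

fun step_delta :: "ctl \<Rightarrow> nat \<Rightarrow> reg \<Rightarrow> int" where
  "step_delta (None, A) l s = 0"
| "step_delta (Some a, A) l s = (if valid_reply a l then delta A a (2 \<le> fst_part l) s else 0)"

text \<open>The registers are integers, as a decrement of an empty register makes it negative when
  Player 2 does not object.\<close>

type_synonym cfg = "ctl \<times> (reg \<Rightarrow> int)"

definition step_cfg :: "cfg \<Rightarrow> nat \<Rightarrow> cfg" where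
  "step_cfg c l = (step_ctl (fst c) l, \<lambda>s. snd c s + step_delta (fst c) l s)"

definition init_ctl :: ctl where
  "init_ctl = (None, Ask RX start0 start1)"

definition conf :: "nat list \<Rightarrow> cfg" where
  "conf w = foldl step_cfg (init_ctl, \<lambda>s. 0) w"

definition run :: "nat word \<Rightarrow> nat \<Rightarrow> cfg" where
  "run \<sigma> j = conf (prefix j \<sigma>)"

text \<open>In \<open>Forall\<close> it is Player 2 who delays, so staying there is good. The other
  unfinished positions, in particular \<open>Ask\<close> and \<open>Guess\<close>, count against
  Player 1 if they recur forever.\<close>

fun good :: "cfg \<Rightarrow> bool" where
  "good ((p, Tru), \<rho>) = True"
| "good ((p, Test r z), \<rho>) = ((\<rho> r = 0) = z)"
| "good ((p, Forall r A), \<rho>) = True"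
| "good ((p, _), \<rho>) = False"

definition game_lang :: "nat word set" where
  "game_lang = {\<sigma> \<in> omega_words letters. \<exists>m. \<forall>j\<ge>m. good (run \<sigma> j)}"

lemma conf_Nil: "conf [] = (init_ctl, \<lambda>s. 0)"
  by (simp add: conf_def)

lemma conf_snoc: "conf (w @ [l]) = step_cfg (conf w) l"
  by (simp add: conf_def)

lemma run_0: "run \<sigma> 0 = (init_ctl, \<lambda>s. 0)"
  by (simp add: run_def conf_Nil)

lemma run_Suc: "run \<sigma> (Suc j) = step_cfg (run \<sigma> j) (\<sigma> j)"
  by (simp add: run_def conf_snoc)

lemma finite_letters: "finite letters"
  by (simp add: letters_def)

lemma letters_iff: "l \<in> letters \<longleftrightarrow> fst_part l < 4 \<and> snd_part l < 4"
  unfolding letters_def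
  by (auto simp: image_iff) (metis lessThan_iff mem_Times_iff prod.collapse prod_decode_inverse)

lemma reply_in_letters: "reply a b \<in> letters"
  by (auto simp: letters_iff reply_def Let_def)

lemma valid_reply_reply: "valid_reply a (reply a b)" "2 \<le> fst_part (reply a b) \<longleftrightarrow> b"
  by (auto simp: valid_reply_def reply_def Let_def)

lemma valid_replyD:
  assumes "valid_reply a l" "l \<in> letters"
  shows "l = reply a (2 \<le> fst_part l)"
proof -
  have l: "l = prod_encode (fst_part l, fst_part l)"
    using assms(1) by (metis prod.collapse prod_decode_inverse valid_reply_def)
  have "fst_part l < 4" using assms(2) by (simp add: letters_iff)
  then have "fst_part l = 0 \<or> fst_part l = 1 \<or> fst_part l = 2 \<or> fst_part l = 3" by linarith
  with assms(1) l show ?thesis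
    by (auto simp: reply_def valid_reply_def Let_def)
qed

section \<open>Player 2 wins\<close>

text \<open>The bit by which Player 2 passes from an underivable position to an underivable one. It
  consults \<open>holds\<close>, hence is not effective.\<close>

primrec pick :: "fm \<Rightarrow> (reg \<Rightarrow> nat) \<Rightarrow> bool \<Rightarrow> bool" where
  "pick Tru \<rho> a = False"
| "pick (Test r z) \<rho> a = False"
| "pick (Either A B) \<rho> a = False"
| "pick (Both A B) \<rho> a = sem holds A \<rho>"
| "pick (Inc r A) \<rho> a = False"
| "pick (Dec r A) \<rho> a = (\<rho> r = 0)"
| "pick (Guess r A) \<rho> a = False"
| "pick (Forall r A) \<rho> a = sem holds A \<rho>"
| "pick (Call l) \<rho> a = False"
| "pick (Ask r A B) \<rho> a = (a \<and> sem holds A \<rho>)"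

text \<open>Registers stay natural numbers along the strategy, because Player 2 objects to a
  decrement exactly when the register is 0. At \<open>Forall\<close>, leaving is right as soon as
  the body is underivable for the current value.\<close>

lemma pick_step:
  assumes "\<not> sem holds A \<rho>" "b = pick A \<rho> a"
  obtains \<rho>' where "(\<lambda>s. int (\<rho> s) + delta A a b s) = (\<lambda>s. int (\<rho>' s))"
    "\<not> sem holds (next_fm A a b) \<rho>'"
proof -
  have "\<exists>\<rho>'. (\<lambda>s. int (\<rho> s) + delta A a b s) = (\<lambda>s. int (\<rho>' s)) \<and> \<not> sem holds (next_fm A a b) \<rho>'"
  proof (cases A)
    case (Inc r B)
    then show ?thesis using assms by (intro exI[of _ "\<rho>(r := Suc (\<rho> r))"]) auto
  next
    case (Dec r B)
    show ?thesis
    proof (cases "\<rho> r = 0")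
      case True
      then show ?thesis using assms Dec by (intro exI[of _ \<rho>]) auto
    next
      case False
      then show ?thesis using assms Dec
        by (intro exI[of _ "\<rho>(r := \<rho> r - 1)"]) (auto simp: of_nat_diff)
    qed
  next
    case (Guess r B)
    then have "\<not> sem holds B \<rho>" "\<not> sem holds (Guess r B) (\<rho>(r := v))" for v
      using assms(1) by (auto simp: fun_upd_idem[of \<rho> r] elim: allE[of _ "\<rho> r"])
    then show ?thesis using assms Guess by (intro exI[of _ \<rho>]) auto
  next
    case (Forall r B)
    show ?thesis
    proof (cases "sem holds B \<rho>")
      case True
      obtain v where v: "\<rho> r \<le> v" "\<not> sem holds B (\<rho>(r := v))" using assms(1) Forall by auto
      with True have "Suc (\<rho> r) \<le> v" by (metis fun_upd_triv le_antisym not_less_eq_eq)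
      then show ?thesis using True assms Forall v
        by (intro exI[of _ "\<rho>(r := Suc (\<rho> r))"]) auto
    next
      case False
      then show ?thesis using assms Forall by (intro exI[of _ \<rho>]) auto
    qed
  next
    case (Call l)
    then show ?thesis using assms holds_iff by (intro exI[of _ \<rho>]) auto
  next
    case (Ask r B C)
    then have *: "\<not> (sem holds B \<rho> \<and> sem holds C \<rho>)"
      using assms(1) by (auto dest!: spec[of _ "\<rho> r"])
    show ?thesis
    proof (cases a)
      case True
      then show ?thesis using assms Ask * by (intro exI[of _ \<rho>]) auto
    next
      case False
      then show ?thesis using assms Ask
        by (intro exI[of _ "\<rho>(r := Suc (\<rho> r))"]) auto
    qed
  qed (use assms in \<open>auto intro!: exI[of _ \<rho>]\<close>)
  with that show thesis by blast
qed

definition strategy :: "nat list \<Rightarrow> nat" where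
  "strategy w = (case conf w of ((Some a, A), \<rho>) \<Rightarrow> reply a (pick A (\<lambda>s. nat (\<rho> s)) a) | _ \<Rightarrow> 0)"

lemma strategy_in_letters: "strategy w \<in> letters"
proof -
  have "0 \<in> letters" using reply_in_letters[of False False] by (simp add: reply_def prod_encode_0)
  then show ?thesis
    by (auto simp: strategy_def reply_in_letters split: prod.split option.split)
qed

text \<open>The register increases until Player 2 can leave to a smaller state.\<close>

lemma not_forever_Forall:
  fixes A :: "nat \<Rightarrow> fm" and \<rho> :: "nat \<Rightarrow> reg \<Rightarrow> nat"
  assumes neg: "\<And>k. \<not> sem holds (A k) (\<rho> k)"
    and A: "\<And>k. A (Suc k) = next_fm (A k) (a k) (pick (A k) (\<rho> k) (a k))"
    and \<rho>: "\<And>k. (\<lambda>s. int (\<rho> k s) + delta (A k) (a k) (pick (A k) (\<rho> k) (a k)) s) =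
        (\<lambda>s. int (\<rho> (Suc k) s))"
    and all: "\<And>k. k0 \<le> k \<Longrightarrow> \<exists>r B. A k = Forall r B"
  shows False
proof -
  have False if "k0 \<le> k" "size (A k) = n" for k n
    using that
  proof (induction n arbitrary: k rule: less_induct)
    case (less n)
    note outer = less.IH
    obtain r B where AB: "A k = Forall r B" using all less.prems by blast
    then obtain v where v: "\<rho> k r \<le> v" "\<not> sem holds B ((\<rho> k)(r := v))" using neg[of k] by auto
    note k = less.prems
    have False if "k \<le> k'" "A k' = Forall r B" "\<rho> k' r \<le> v" "\<not> sem holds B ((\<rho> k')(r := v))" for k'
      using that
    proof (induction "v - \<rho> k' r" arbitrary: k' rule: less_induct)
      case (less k')
      note inner_hyps = less(1) and inner_prems = less(2-)
      show ?case
      proof (cases "sem holds B (\<rho> k')")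
        case True
        then have A': "A (Suc k') = Forall r B" using A[of k'] inner_prems by simp
        have "(\<lambda>s. int (\<rho> (Suc k') s)) = (\<lambda>s. int (((\<rho> k')(r := Suc (\<rho> k' r))) s))"
          unfolding \<rho>[of k', symmetric] using True inner_prems by auto
        then have \<rho>': "\<rho> (Suc k') = (\<rho> k')(r := Suc (\<rho> k' r))"
          by (metis (no_types, lifting) ext of_nat_eq_iff)
        have "\<rho> k' r \<noteq> v" using True inner_prems by (metis fun_upd_triv)
        then have "Suc (\<rho> k' r) \<le> v" "v - Suc (\<rho> k' r) < v - \<rho> k' r"
          using inner_prems by simp_all
        then show ?thesis
          using inner_hyps[of "Suc k'"] inner_prems A' \<rho>' by simp
      next
        case False
        then have "A (Suc k') = B" using A[of k'] inner_prems by simp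
        then show ?thesis
          using outer[of "size B" "Suc k'"]
            inner_prems k AB by simp
      qed
    qed
    then show ?case using AB v by blast
  qed
  then show False by blast
qed

lemma strategy_winning:
  assumes "\<not> sem holds (Ask RX start0 start1) (\<lambda>s. 0)"
  shows "winning2 letters game_lang strategy"
  unfolding winning2_def
proof (intro conjI ballI impI notI)
  show "strategy2 letters strategy"
    by (simp add: strategy2_def strategy_in_letters)
next
  fix \<sigma> assume \<sigma>: "\<sigma> \<in> omega_words letters" and fol: "follows2 strategy \<sigma>" and win: "\<sigma> \<in> game_lang"
  define P where "P k c \<longleftrightarrow> run \<sigma> (2 * k) = ((None, fst c), \<lambda>s. int (snd c s)) \<and> \<not> sem holds (fst c) (snd c)"
    for k and c :: "fm \<times> (reg \<Rightarrow> nat)"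
  define a where "a k \<longleftrightarrow> fst_part (\<sigma> (2 * k)) \<noteq> 0" for k
  define Q where "Q k c d \<longleftrightarrow> (let b = pick (fst c) (snd c) (a k) in
      fst d = next_fm (fst c) (a k) b \<and>
      (\<lambda>s. int (snd c s) + delta (fst c) (a k) b s) = (\<lambda>s. int (snd d s)))"
    for k and c d :: "fm \<times> (reg \<Rightarrow> nat)"
  have "\<exists>f. \<forall>k. P k (f k) \<and> Q k (f k) (f (Suc k))"
  proof (rule dependent_nat_choice)
    show "\<exists>c. P 0 c"
      using assms by (intro exI[of _ "(Ask RX start0 start1, \<lambda>s. 0)"])
        (simp add: P_def run_0 init_ctl_def)
  next
    fix c k assume P: "P k c"
    define b where "b = pick (fst c) (snd c) (a k)"
    obtain \<rho>' where \<rho>': "(\<lambda>s. int (snd c s) + delta (fst c) (a k) b s) = (\<lambda>s. int (\<rho>' s))"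
      "\<not> sem holds (next_fm (fst c) (a k) b) \<rho>'"
      using pick_step P b_def unfolding P_def by metis
    have run1: "run \<sigma> (Suc (2 * k)) = ((Some (a k), fst c), \<lambda>s. int (snd c s))"
      using P by (simp add: run_Suc P_def step_cfg_def a_def)
    have "\<sigma> (Suc (2 * k)) = strategy (prefix (Suc (2 * k)) \<sigma>)"
      using fol unfolding follows2_def by simp
    also have "\<dots> = reply (a k) b"
      using run1 unfolding run_def by (simp add: strategy_def b_def del: upt_Suc)
    finally have "run \<sigma> (Suc (Suc (2 * k))) = ((None, next_fm (fst c) (a k) b), \<lambda>s. int (\<rho>' s))"
      using \<rho>'(1) by (simp add: run_Suc[of _ "Suc (2 * k)"] run1 step_cfg_def valid_reply_reply)
    then show "\<exists>d. P (Suc k) d \<and> Q k c d"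
      using \<rho>' by (intro exI[of _ "(next_fm (fst c) (a k) b, \<rho>')"]) (simp add: P_def Q_def b_def Let_def)
  qed
  then obtain f where f: "\<And>k. P k (f k)" "\<And>k. Q k (f k) (f (Suc k))" by blast
  obtain m where m: "\<And>j. m \<le> j \<Longrightarrow> good (run \<sigma> j)" using win unfolding game_lang_def by blast
  show False
  proof (rule not_forever_Forall[of "\<lambda>k. fst (f k)" "\<lambda>k. snd (f k)" a m])
    fix k
    show "\<not> sem holds (fst (f k)) (snd (f k))" using f(1) by (simp add: P_def)
    show "fst (f (Suc k)) = next_fm (fst (f k)) (a k) (pick (fst (f k)) (snd (f k)) (a k))"
      "(\<lambda>s. int (snd (f k) s) + delta (fst (f k)) (a k) (pick (fst (f k)) (snd (f k)) (a k)) s) =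
        (\<lambda>s. int (snd (f (Suc k)) s))"
      using f(2)[of k] by (simp_all add: Q_def Let_def)
    assume "m \<le> k"
    then have "good ((None, fst (f k)), \<lambda>s. int (snd (f k) s))"
      using m[of "2 * k"] f(1)[of k] by (simp add: P_def)
    moreover have "\<not> sem holds (fst (f k)) (snd (f k))" using f(1) by (simp add: P_def)
    \<comment> \<open>Among the good positions, only those of the form \<open>Forall\<close> can be
      underivable.\<close>
    ultimately show "\<exists>r B. fst (f k) = Forall r B" by (cases "fst (f k)") auto
  qed
qed

section \<open>Winning strategies of Player 2 avoid the derivable positions\<close>

definition consistent :: "(nat list \<Rightarrow> nat) \<Rightarrow> nat list \<Rightarrow> bool" where
  "consistent f w \<longleftrightarrow> (\<forall>i<length w. odd i \<longrightarrow> w ! i = f (take i w))"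

definition reach :: "(nat list \<Rightarrow> nat) \<Rightarrow> fm \<Rightarrow> (reg \<Rightarrow> int) \<Rightarrow> bool" where
  "reach f A \<rho> \<longleftrightarrow> (\<exists>w. even (length w) \<and> set w \<subseteq> letters \<and> consistent f w \<and>
     conf w = ((None, A), \<rho>))"

definition ext1 :: "(nat list \<Rightarrow> nat) \<Rightarrow> nat list \<Rightarrow> nat \<Rightarrow> nat list" where
  "ext1 f w l = w @ [l, f (w @ [l])]"

lemma consistent_ext1:
  assumes "consistent f w" "even (length w)"
  shows "consistent f (ext1 f w l)"
  using assms
  by (auto simp: consistent_def ext1_def nth_append less_Suc_eq nth_Cons split: nat.split)

lemma zero_in_letters: "0 \<in> letters"
  by (simp add: letters_iff prod_decode_0)

definition one_letter :: nat where
  "one_letter = prod_encode (1, 0)"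

lemma one_letter: "one_letter \<in> letters" "fst_part one_letter = 1"
  by (simp_all add: letters_iff one_letter_def)

locale winning =
  fixes f :: "nat list \<Rightarrow> nat"
  assumes winning: "winning2 letters game_lang f"
begin

lemma f_in_letters: "set w \<subseteq> letters \<Longrightarrow> odd (length w) \<Longrightarrow> f w \<in> letters"
  using winning by (auto simp: winning2_def strategy2_def positions2_def lists_eq_set)

lemma ext1_letters:
  "set w \<subseteq> letters \<Longrightarrow> even (length w) \<Longrightarrow> l \<in> letters \<Longrightarrow> set (ext1 f w l) \<subseteq> letters"
  using f_in_letters[of "w @ [l]"] by (simp add: ext1_def)

primrec idle :: "nat list \<Rightarrow> nat \<Rightarrow> nat list" where
  "idle w 0 = w"
| "idle w (Suc k) = ext1 f (idle w k) 0"

lemma length_idle: "length (idle w k) = length w + 2 * k"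
  by (induction k) (simp_all add: ext1_def)

lemma idle_letters:
  "set w \<subseteq> letters \<Longrightarrow> even (length w) \<Longrightarrow> set (idle w k) \<subseteq> letters"
  by (induction k) (simp_all add: ext1_letters length_idle zero_in_letters)

lemma idle_consistent:
  "consistent f w \<Longrightarrow> even (length w) \<Longrightarrow> consistent f (idle w k)"
  by (induction k) (simp_all add: consistent_ext1 length_idle)

lemma take_idle: "n \<le> length w + 2 * k \<Longrightarrow> take n (idle w (k + m)) = take n (idle w k)"
  by (induction m) (simp_all add: ext1_def length_idle)

text \<open>The plays in which Player 1 writes 0 from \<open>w\<close> on grow to one infinite play
  following \<open>f\<close>. If waiting kept it good, Player 1 would win it.\<close>

lemma idle_not_good:
  assumes w: "even (length w)" "set w \<subseteq> letters" "consistent f w"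
    and good: "\<And>k. good (conf (idle w k)) \<and> good (conf (idle w k @ [0]))"
  shows False
proof -
  \<comment> \<open>\<open>idle w (Suc j)\<close> is longer than \<open>j\<close>, and all longer
    plays agree with it at \<open>j\<close>.\<close>
  define \<sigma> where "\<sigma> j = idle w (Suc j) ! j" for j
  have prefix: "prefix n \<sigma> = take n (idle w k)" if "n \<le> length w + 2 * k" for n k
  proof (rule nth_equalityI)
    fix i assume "i < length (prefix n \<sigma>)"
    then have i: "i < n" by simp
    have "\<sigma> i = take (Suc i) (idle w (Suc i)) ! i" by (simp add: \<sigma>_def)
    also have "\<dots> = take (Suc i) (idle w (Suc i + k)) ! i"
      by (subst take_idle) auto
    also have "\<dots> = take (Suc i) (idle w (k + Suc i)) ! i" by (simp add: add.commute)
    also have "\<dots> = take (Suc i) (idle w k) ! i"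
      using that i by (subst take_idle) auto
    finally show "prefix n \<sigma> ! i = take n (idle w k) ! i" using i by simp
  qed (use that in \<open>simp add: length_idle\<close>)
  have \<sigma>: "\<sigma> \<in> omega_words letters"
  proof -
    have "\<sigma> j \<in> set (idle w (Suc j))" for j
      unfolding \<sigma>_def by (rule nth_mem) (simp add: length_idle del: idle.simps)
    then show ?thesis using idle_letters[OF w(2,1)] unfolding omega_words_def by blast
  qed
  moreover have "follows2 f \<sigma>"
    unfolding follows2_def
  proof (intro allI impI)
    fix i :: nat assume "odd i"
    then have "idle w (Suc i) ! i = f (take i (idle w (Suc i)))"
      using idle_consistent[OF w(3,1)] by (simp add: consistent_def length_idle del: idle.simps)
    then show "\<sigma> i = f (prefix i \<sigma>)"
      using prefix[of i "Suc i"] by (simp add: \<sigma>_def del: idle.simps)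
  qed
  ultimately have "\<sigma> \<notin> game_lang" using winning by (auto simp: winning2_def)
  moreover have "good (run \<sigma> j)" if "length w \<le> j" for j
  proof -
    define k where "k = (j - length w) div 2"
    have "j = length w + 2 * k \<or> j = length w + 2 * k + 1" using that unfolding k_def by linarith
    then show ?thesis
    proof
      assume j: "j = length w + 2 * k"
      then have "prefix j \<sigma> = idle w k" by (subst prefix[of _ k]) (simp_all add: length_idle)
      then show ?thesis using good[of k] by (simp add: run_def)
    next
      assume j: "j = length w + 2 * k + 1"
      then have "prefix j \<sigma> = idle w k @ [0]"
        by (subst prefix[of _ "Suc k"]) (simp_all add: length_idle ext1_def)
      then show ?thesis using good[of k] by (simp add: run_def)
    qed
  qed
  ultimately show False using \<sigma> unfolding game_lang_def by blast
qed

lemma conf_Some: "conf w = ((None, A), \<rho>) \<Longrightarrow>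
    conf (w @ [l]) = ((Some (fst_part l \<noteq> 0), A), \<rho>)"
  by (simp add: conf_snoc step_cfg_def)

text \<open>Waiting wins here: \<open>Tru\<close> persists, and so does a test with the right
  outcome unless an invalid reply turns it into \<open>Tru\<close>.\<close>

lemma not_reach_good:
  assumes "A = Tru \<or> (A = Test r z \<and> (\<rho> r = 0) = z)"
  shows "\<not> reach f A \<rho>"
proof
  assume "reach f A \<rho>"
  then obtain w where w: "even (length w)" "set w \<subseteq> letters" "consistent f w"
    and c: "conf w = ((None, A), \<rho>)"
    unfolding reach_def by blast
  have good: "good ((p, Tru), \<rho>)" "A = Test r z \<Longrightarrow> good ((p, A), \<rho>)" for p
    using assms by auto
  have inv: "conf (idle w k) = ((None, A), \<rho>) \<or> (\<exists>\<rho>'. conf (idle w k) = ((None, Tru), \<rho>'))" for k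
  proof (induction k)
    case (Suc k)
    then show ?case
    proof
      assume k: "conf (idle w k) = ((None, A), \<rho>)"
      then show ?thesis
        using assms conf_snoc[of "idle w k @ [0]" "f (idle w k @ [0])"]
        by (auto simp: ext1_def conf_Some[OF k] step_cfg_def)
    next
      assume "\<exists>\<rho>'. conf (idle w k) = ((None, Tru), \<rho>')"
      then obtain \<rho>' where k: "conf (idle w k) = ((None, Tru), \<rho>')" by blast
      then show ?thesis
        using conf_snoc[of "idle w k @ [0]" "f (idle w k @ [0])"]
        by (auto simp: ext1_def conf_Some[OF k] step_cfg_def)
    qed
  qed (use c in simp)
  show False
  proof (rule idle_not_good[OF w])
    fix k
    show "good (conf (idle w k)) \<and> good (conf (idle w k @ [0]))"
      using inv[of k] assms by (auto simp: conf_Some)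
  qed
qed

text \<open>An invalid reply would reach \<open>Tru\<close>, so each answer of a winning strategy
  amounts to a bit \<open>b\<close>.\<close>

lemma reach_step_word:
  assumes w: "even (length w)" "set w \<subseteq> letters" "consistent f w" "conf w = ((None, A), \<rho>)"
    and l: "l \<in> letters"
  obtains b where "f (w @ [l]) = reply (fst_part l \<noteq> 0) b"
    "conf (ext1 f w l) = ((None, next_fm A (fst_part l \<noteq> 0) b),
       \<lambda>s. \<rho> s + delta A (fst_part l \<noteq> 0) b s)"
    "reach f (next_fm A (fst_part l \<noteq> 0) b) (\<lambda>s. \<rho> s + delta A (fst_part l \<noteq> 0) b s)"
proof -
  define a m where "a \<longleftrightarrow> fst_part l \<noteq> 0" and "m = f (w @ [l])"
  have m: "m \<in> letters" unfolding m_def using w l by (intro f_in_letters) auto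
  have conf: "conf (ext1 f w l) = step_cfg ((Some a, A), \<rho>) m"
    using conf_snoc[of "w @ [l]" m] conf_Some[OF w(4), of l] by (simp add: ext1_def m_def a_def)
  have reach: "reach f A' \<rho>'" if "conf (ext1 f w l) = ((None, A'), \<rho>')" for A' \<rho>'
    unfolding reach_def
    by (rule exI[of _ "ext1 f w l"])
      (use w l that in \<open>simp add: ext1_letters consistent_ext1, simp add: ext1_def\<close>)
  have valid: "valid_reply a m"
  proof (rule ccontr)
    assume "\<not> valid_reply a m"
    then have "reach f Tru \<rho>" using conf by (intro reach) (simp add: step_cfg_def)
    then show False using not_reach_good by blast
  qed
  define b where "b \<longleftrightarrow> 2 \<le> fst_part m"
  have mb: "m = reply a b" unfolding b_def using valid m by (rule valid_replyD)
  have c: "conf (ext1 f w l) = ((None, next_fm A a b), \<lambda>s. \<rho> s + delta A a b s)"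
    unfolding conf using valid by (simp add: step_cfg_def b_def)
  show thesis by (rule that[of b, folded a_def m_def, OF mb c reach[OF c]])
qed

lemma reach_step:
  assumes "reach f A \<rho>"
  obtains b where "reach f (next_fm A a b) (\<lambda>s. \<rho> s + delta A a b s)"
proof -
  obtain w where w: "even (length w)" "set w \<subseteq> letters" "consistent f w" "conf w = ((None, A), \<rho>)"
    using assms unfolding reach_def by blast
  define l where "l = (if a then one_letter else 0)"
  have l: "l \<in> letters" "(fst_part l \<noteq> 0) = a"
    by (auto simp: l_def one_letter zero_in_letters prod_decode_0)
  show thesis using reach_step_word[OF w l(1)] that unfolding l(2) by blast
qed

lemma reach_Dec:
  assumes "reach f (Dec r A) (\<lambda>s. int (\<rho> s))" "\<rho> r \<noteq> 0"
  shows "reach f A (\<lambda>s. int ((\<rho>(r := \<rho> r - 1)) s))"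
proof -
  obtain b where b: "reach f (next_fm (Dec r A) False b) (\<lambda>s. int (\<rho> s) + delta (Dec r A) False b s)"
    using reach_step[OF assms(1)] .
  have "\<not> b"
  proof
    assume b
    with b have "reach f (Test r False) (\<lambda>s. int (\<rho> s))" by simp
    with not_reach_good assms(2) show False by fastforce
  qed
  moreover have "(\<lambda>s. int (\<rho> s) + (if s = r then -1 else 0)) = (\<lambda>s. int ((\<rho>(r := \<rho> r - 1)) s))"
    using assms(2) by (auto simp: of_nat_diff)
  ultimately show ?thesis using b by simp
qed

lemma reach_Inc:
  assumes "reach f (Inc r A) (\<lambda>s. int (\<rho> s))"
  shows "reach f A (\<lambda>s. int ((\<rho>(r := Suc (\<rho> r))) s))"
proof -
  obtain b where b: "reach f (next_fm (Inc r A) False b) (\<lambda>s. int (\<rho> s) + delta (Inc r A) False b s)"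
    using reach_step[OF assms(1)] .
  moreover have "(\<lambda>s. int (\<rho> s) + (if s = r then 1 else 0)) = (\<lambda>s. int ((\<rho>(r := Suc (\<rho> r))) s))"
    by auto
  ultimately show ?thesis by simp
qed

lemma reach_Either:
  assumes "reach f (Either A B) \<rho>"
  shows "reach f A \<rho>" "reach f B \<rho>"
  using reach_step[OF assms, of False] reach_step[OF assms, of True] by auto

lemma reach_Guess:
  assumes "reach f (Guess r A) (\<lambda>s. int (\<rho> s))"
  shows "reach f A (\<lambda>s. int ((\<rho>(r := v)) s))"
  using assms
proof (induction "nat \<bar>int v - int (\<rho> r)\<bar>" arbitrary: \<rho>)
  case 0
  then have "\<rho>(r := v) = \<rho>" by auto
  then show ?case using reach_step[OF 0(2), of False] by auto
next
  case (Suc n)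
  have "reach f (Either (Inc r (Guess r A)) (Dec r (Guess r A))) (\<lambda>s. int (\<rho> s))"
    using reach_step[OF Suc(3), of True] by auto
  note either = reach_Either[OF this]
  show ?case
  proof (cases "\<rho> r < v")
    case True
    have "reach f A (\<lambda>s. int (((\<rho>(r := Suc (\<rho> r)))(r := v)) s))"
      by (rule Suc(1)[OF _ reach_Inc[OF either(1)]]) (use Suc(2) True in simp)
    then show ?thesis by simp
  next
    case False
    then have pos: "\<rho> r \<noteq> 0" using Suc(2) by auto
    have "reach f A (\<lambda>s. int (((\<rho>(r := \<rho> r - 1))(r := v)) s))"
      by (rule Suc(1)[OF _ reach_Dec[OF either(2) pos]])
        (use Suc(2) False pos in \<open>simp add: of_nat_diff\<close>)
    then show ?thesis by simp
  qed
qed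

lemma reach_Ask:
  assumes "reach f (Ask r A B) (\<lambda>s. int (\<rho> s))" "\<rho> r \<le> v"
  shows "reach f A (\<lambda>s. int ((\<rho>(r := v)) s)) \<or> reach f B (\<lambda>s. int ((\<rho>(r := v)) s))"
  using assms
proof (induction "v - \<rho> r" arbitrary: \<rho>)
  case 0
  then have \<rho>: "\<rho>(r := v) = \<rho>" by auto
  obtain b where "reach f (next_fm (Ask r A B) True b) (\<lambda>s. int (\<rho> s) + delta (Ask r A B) True b s)"
    using reach_step[OF 0(2)] .
  then show ?case unfolding \<rho> by (cases b) simp_all
next
  case (Suc n)
  obtain b where b: "reach f (next_fm (Ask r A B) False b) (\<lambda>s. int (\<rho> s) + delta (Ask r A B) False b s)"
    using reach_step[OF Suc(3)] .
  have "\<not> b" using b not_reach_good[of Tru] by (cases b) simp_all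
  moreover have "(\<lambda>s. int (\<rho> s) + (if s = r then 1 else 0)) = (\<lambda>s. int ((\<rho>(r := Suc (\<rho> r))) s))"
    by auto
  ultimately have "reach f (Ask r A B) (\<lambda>s. int ((\<rho>(r := Suc (\<rho> r))) s))" using b by simp
  from Suc(1)[OF _ this] Suc(2,4) show ?case unfolding fun_upd_upd by simp
qed

text \<open>If \<open>A\<close> were avoided at every value, waiting would make the strategy raise
  the register forever, in a play that stays in \<open>Forall\<close> and hence is good.\<close>

lemma reach_Forall:
  assumes "reach f (Forall r A) (\<lambda>s. int (\<rho> s))"
  obtains v where "\<rho> r \<le> v" "reach f A (\<lambda>s. int ((\<rho>(r := v)) s))"
proof (rule ccontr)
  assume "\<not> thesis"
  with that have no: "\<not> reach f A (\<lambda>s. int ((\<rho>(r := v)) s))" if "\<rho> r \<le> v" for v using that by blast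
  obtain w where w: "even (length w)" "set w \<subseteq> letters" "consistent f w"
    and c: "conf w = ((None, Forall r A), \<lambda>s. int (\<rho> s))"
    using assms unfolding reach_def by blast
  have inv: "conf (idle w k) = ((None, Forall r A), \<lambda>s. int ((\<rho>(r := \<rho> r + k)) s))" for k
  proof (induction k)
    case (Suc k)
    have "even (length (idle w k))" "set (idle w k) \<subseteq> letters" "consistent f (idle w k)"
      using w by (simp_all add: length_idle idle_letters idle_consistent)
    from reach_step_word[OF this Suc zero_in_letters] obtain b where
      b: "conf (idle w (Suc k)) = ((None, next_fm (Forall r A) False b),
          \<lambda>s. int ((\<rho>(r := \<rho> r + k)) s) + delta (Forall r A) False b s)"
        "reach f (next_fm (Forall r A) False b)
          (\<lambda>s. int ((\<rho>(r := \<rho> r + k)) s) + delta (Forall r A) False b s)"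
      by (auto simp: prod_decode_0)
    have b using b(2) no[of "\<rho> r + k"] by (cases b) auto
    then show ?case unfolding b(1) by auto
  qed (use c in simp)
  show False
    by (rule idle_not_good[OF w]) (simp add: inv conf_Some)
qed

text \<open>At every connective Player 1 can move on to a part that is true in \<open>I\<close>,
  whatever the answer is. The parameter \<open>I\<close> is first the induction hypothesis for
  \<open>holds\<close> and finally \<open>holds\<close> itself.\<close>

lemma sem_not_reach:
  assumes "\<And>l \<rho>. I l \<rho> \<Longrightarrow> \<not> reach f (Call l) (\<lambda>s. int (\<rho> s))"
  shows "sem I A \<rho> \<Longrightarrow> \<not> reach f A (\<lambda>s. int (\<rho> s))"
proof (induction A arbitrary: \<rho>)
  case Tru
  then show ?case using not_reach_good by blast
next
  case (Test r z)
  then show ?case using not_reach_good[of "Test r z" r z "\<lambda>s. int (\<rho> s)"] by simp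
next
  case (Either A B)
  then show ?case using reach_Either[of A B "\<lambda>s. int (\<rho> s)"] by auto
next
  case (Both A B)
  show ?case
  proof
    assume "reach f (Both A B) (\<lambda>s. int (\<rho> s))"
    then obtain b where "reach f (next_fm (Both A B) False b)
        (\<lambda>s. int (\<rho> s) + delta (Both A B) False b s)"
      using reach_step by blast
    then show False using Both by (cases b) simp_all
  qed
next
  case (Inc r A)
  then have "sem I A (\<rho>(r := Suc (\<rho> r)))" by simp
  with Inc.IH reach_Inc[of r A \<rho>] show ?case by blast
next
  case (Dec r A)
  then have "\<rho> r \<noteq> 0" "sem I A (\<rho>(r := \<rho> r - 1))" by simp_all
  with Dec.IH reach_Dec[of r A \<rho>] show ?case by blast
next
  case (Guess r A)
  then obtain v where "sem I A (\<rho>(r := v))" by auto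
  with Guess.IH reach_Guess[of r A \<rho> v] show ?case by blast
next
  case (Forall r A)
  then have "sem I A (\<rho>(r := v))" if "\<rho> r \<le> v" for v using that by simp
  with Forall.IH reach_Forall[of r A \<rho>] show ?case by blast
next
  case (Call l)
  then show ?case using assms by simp
next
  case (Ask r A B)
  then obtain v where "\<rho> r \<le> v" "sem I A (\<rho>(r := v))" "sem I B (\<rho>(r := v))" by auto
  with Ask.IH reach_Ask[of r A B \<rho> v] show ?case by blast
qed

lemma holds_not_reach: "holds l \<rho> \<Longrightarrow> \<not> reach f (Call l) (\<lambda>s. int (\<rho> s))"
proof (induction rule: holds.induct)
  case (1 l \<rho>)
  have *: "\<not> reach f (prog l) (\<lambda>s. int (\<rho> s))"
    by (rule sem_not_reach[OF _ 1]) blast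
  show ?case
  proof
    assume "reach f (Call l) (\<lambda>s. int (\<rho> s))"
    then obtain b where "reach f (next_fm (Call l) False b)
        (\<lambda>s. int (\<rho> s) + delta (Call l) False b s)"
      using reach_step by blast
    then show False using * by simp
  qed
qed

text \<open>While Player 1 counts in \<open>Ask\<close>, the answer is forced to be the letter 0,
  since the bit 1 would reach \<open>Tru\<close>. This makes the opening for \<open>x\<close> a
  fixed word, computable from \<open>x\<close>.\<close>

lemma conf_replicate:
  "consistent f (replicate (2 * x) 0) \<and>
   conf (replicate (2 * x) 0) = ((None, Ask RX start0 start1), \<lambda>s. int (((\<lambda>_. 0)(RX := x)) s))"
proof (induction x)
  case 0
  then show ?case by (simp add: consistent_def conf_Nil init_ctl_def)
next
  case (Suc x)
  let ?w = "replicate (2 * x) 0 :: nat list"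
  have w: "even (length ?w)" "set ?w \<subseteq> letters" "consistent f ?w"
    "conf ?w = ((None, Ask RX start0 start1), \<lambda>s. int (((\<lambda>_. 0)(RX := x)) s))"
    using Suc zero_in_letters by auto
  obtain b where b: "f (?w @ [0]) = reply False b"
    "conf (ext1 f ?w 0) = ((None, next_fm (Ask RX start0 start1) False b),
       \<lambda>s. int (((\<lambda>_. 0)(RX := x)) s) + delta (Ask RX start0 start1) False b s)"
    "reach f (next_fm (Ask RX start0 start1) False b)
       (\<lambda>s. int (((\<lambda>_. 0)(RX := x)) s) + delta (Ask RX start0 start1) False b s)"
    by (rule reach_step_word[OF w zero_in_letters]) (auto simp: prod_decode_0)
  have nb: "\<not> b" using b(3) not_reach_good[of Tru] by (cases b) simp_all
  then have "f (?w @ [0]) = 0" using b(1) by (simp add: reply_def prod_encode_0)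
  then have ext: "replicate (2 * Suc x) 0 = ext1 f ?w 0"
    by (simp add: ext1_def replicate_append_same[symmetric])
  show ?case
    unfolding ext b(2) using consistent_ext1[OF w(3,1)] nb by auto
qed

lemma answer:
  defines "w \<equiv> \<lambda>x. replicate (2 * x) 0 @ [one_letter]"
  shows "f (w x) = reply True True \<Longrightarrow> \<not> sem holds start1 ((\<lambda>_. 0)(RX := x))"
    and "f (w x) \<noteq> reply True True \<Longrightarrow> \<not> sem holds start0 ((\<lambda>_. 0)(RX := x))"
proof -
  let ?w = "replicate (2 * x) 0 :: nat list" and ?\<rho> = "(\<lambda>_. 0)(RX := x)"
  have "set ?w \<subseteq> letters" using zero_in_letters by auto
  then obtain b where b: "f (w x) = reply True b"
    "reach f (next_fm (Ask RX start0 start1) True b)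
       (\<lambda>s. int (?\<rho> s) + delta (Ask RX start0 start1) True b s)"
    using reach_step_word[of ?w "Ask RX start0 start1" "\<lambda>s. int (?\<rho> s)" one_letter]
      conf_replicate[of x] one_letter unfolding w_def by auto
  then have "reach f (if b then start1 else start0) (\<lambda>s. int (?\<rho> s))" by simp
  then have "\<not> sem holds (if b then start1 else start0) ?\<rho>"
    using sem_not_reach[OF holds_not_reach] by blast
  moreover have "reply True b = reply True True \<longleftrightarrow> b"
    using valid_reply_reply(2)[of True] by metis
  ultimately show "f (w x) = reply True True \<Longrightarrow> \<not> sem holds start1 ((\<lambda>_. 0)(RX := x))"
    "f (w x) \<noteq> reply True True \<Longrightarrow> \<not> sem holds start0 ((\<lambda>_. 0)(RX := x))"
    using b(1) by (auto split: if_splits)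
qed

end

lemma computable_opening:
  "computable (Suc 0) (\<lambda>xs. list_encode (replicate (2 * xs ! 0) 0 @ [one_letter]))"
proof -
  have "computable (Suc 0) (\<lambda>xs. rec_nat (list_encode [one_letter])
      (\<lambda>i y. Suc (prod_encode (0, Suc (prod_encode (0, y))))) (xs ! 0))"
    by (rule computable_rec_nat[where s = "\<lambda>i y xs. Suc (prod_encode (0, Suc (prod_encode (0, y))))"])
      (auto intro!: computable_proj computable_const computable_Suc computable_prod_encode)
  moreover have "rec_nat (list_encode [one_letter])
      (\<lambda>i y. Suc (prod_encode (0, Suc (prod_encode (0, y))))) n =
      list_encode (replicate (2 * n) 0 @ [one_letter])" for n
    by (induction n) simp_all
  ultimately show ?thesis by simp
qed

theorem no_hyperarithmetical_winning_strategy: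
  assumes "winning2 letters game_lang f"
  shows "\<not> hyperarithmetical (strategy_code id letters f)"
proof
  interpret winning f by standard (rule assms)
  let ?S = "strategy_code id letters f"
  assume hyp: "hyperarithmetical ?S"
  define w where "w x = replicate (2 * x) 0 @ [one_letter]" for x
  \<comment> \<open>The number \<open>g x\<close> is in the strategy code iff the answer to
    \<open>x\<close> is the bit 1; its preimage is the set to which the diagonal argument is
    applied.\<close>
  define g where "g x = prod_encode (list_encode (w x), reply True True)" for x
  have w: "w x \<in> positions2 letters" for x
    by (auto simp: w_def positions2_def zero_in_letters one_letter)
  have g: "g x \<in> ?S \<longleftrightarrow> f (w x) = reply True True" for x
    using w by (auto simp: g_def strategy_code_def image_iff list_encode_eq)
  have comp: "computable (Suc 0) (\<lambda>xs. g (xs ! 0))"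
    unfolding g_def w_def by (intro computable_prod_encode computable_opening computable_const)
  have "Sigma11 {x. g x \<in> ?S}" "Sigma11 {x. g x \<in> - ?S}"
    using hyp Sigma11_vimage[OF _ comp] unfolding hyperarithmetical_def by blast+
  then have hyp': "hyperarithmetical {x. g x \<in> ?S}"
    by (simp add: hyperarithmetical_def Collect_neg_eq[symmetric])
  obtain x where x: "g x \<in> ?S \<longrightarrow> sem holds start1 ((\<lambda>_. 0)(RX := x))"
    "g x \<notin> ?S \<longrightarrow> sem holds start0 ((\<lambda>_. 0)(RX := x))"
    using hyperarithmetical_diagonal[OF hyp'] by auto
  show False
  proof (cases "g x \<in> ?S")
    case True
    then show False using x(1) answer(1)[of x] g[of x] by (simp add: w_def)
  next
    case False
    then show False using x(2) answer(2)[of x] g[of x] by (simp add: w_def)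
  qed
qed

lemma not_sem_init: "\<not> sem holds (Ask RX start0 start1) (\<lambda>s. 0)"
  using not_start0_and_start1[of "(\<lambda>_. 0)(RX := _)"] by auto

section \<open>Finiteness of the control\<close>

instance reg :: finite
proof
  have "(UNIV :: reg set) = {RX, RP, RQ, RS, RT, RV, RW, RC, EP, EA, EZ, EU, EB, EF, EG, EH, EN, EY}"
    by (auto intro: reg.exhaust)
  then show "finite (UNIV :: reg set)" by (metis finite.emptyI finite_insert)
qed

instance lab :: finite
proof
  have "l \<in> case_prod LEq ` UNIV \<union> (\<lambda>(a, b, c). LPair a b c) ` UNIV \<union>
      {LEval, LNth, LEvals, LBelow, LRound}" for l
    by (cases l) (auto simp: image_iff)
  then have "(UNIV :: lab set) \<subseteq> case_prod LEq ` UNIV \<union> (\<lambda>(a, b, c). LPair a b c) ` UNIV \<union>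
      {LEval, LNth, LEvals, LBelow, LRound}"
    by blast
  then show "finite (UNIV :: lab set)" by (rule finite_subset) simp
qed

instance reg :: countable by countable_datatype
instance lab :: countable by countable_datatype
instance fm :: countable by countable_datatype

text \<open>Besides subformulas, this collects the positions that \<open>next_fm\<close> creates,
  such as the objection to a \<open>Dec\<close> and the choice within a \<open>Guess\<close>; so
  only calls lead out of the set.\<close>

primrec subfms :: "fm \<Rightarrow> fm set" where
  "subfms Tru = {Tru}"
| "subfms (Test r z) = {Test r z}"
| "subfms (Either A B) = insert (Either A B) (subfms A \<union> subfms B)"
| "subfms (Both A B) = insert (Both A B) (subfms A \<union> subfms B)"
| "subfms (Inc r A) = insert (Inc r A) (subfms A)"
| "subfms (Dec r A) = {Dec r A, Test r False} \<union> subfms A"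
| "subfms (Guess r A) = {Guess r A, Either (Inc r (Guess r A)) (Dec r (Guess r A)),
     Inc r (Guess r A), Dec r (Guess r A), Test r False} \<union> subfms A"
| "subfms (Forall r A) = insert (Forall r A) (subfms A)"
| "subfms (Call l) = {Call l}"
| "subfms (Ask r A B) = {Ask r A B, Tru} \<union> subfms A \<union> subfms B"

lemma finite_subfms: "finite (subfms A)"
  by (induction A) simp_all

lemma subfms_refl: "A \<in> subfms A"
  by (cases A) simp_all

lemma next_fm_subfms: "A \<in> subfms B \<Longrightarrow> next_fm A a b \<in> subfms B \<union> (\<Union>l. subfms (prog l))"
proof (induction B)
  case (Call l)
  then have "next_fm A a b \<in> subfms (prog l)" by (simp add: subfms_refl)
  then show ?case by blast
qed (auto simp: subfms_refl)

definition ctls :: "ctl set" where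
  "ctls = UNIV \<times> ({Tru} \<union> subfms (Ask RX start0 start1) \<union> (\<Union>l. subfms (prog l)))"

lemma finite_ctls: "finite ctls"
  by (simp add: ctls_def finite_subfms)

lemma init_ctl_in: "init_ctl \<in> ctls"
  by (simp add: ctls_def init_ctl_def)

lemma next_fm_ctls: "(p, A) \<in> ctls \<Longrightarrow> (p', next_fm A a b) \<in> ctls"
  using next_fm_subfms unfolding ctls_def by fastforce

lemma Tru_ctls: "(p, Tru) \<in> ctls"
  by (simp add: ctls_def)

lemma step_ctl_in: "c \<in> ctls \<Longrightarrow> step_ctl c l \<in> ctls"
  by (cases "(c, l)" rule: step_ctl.cases) (auto simp: next_fm_ctls Tru_ctls, auto simp: ctls_def)

lemma run_in_ctls: "fst (run \<sigma> j) \<in> ctls"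
  by (induction j) (simp_all add: run_0 run_Suc init_ctl_in step_ctl_in step_cfg_def)

section \<open>The language is \<open>\<Delta>\<^sup>0\<^sub>3\<close>\<close>

definition code_nth :: "nat \<Rightarrow> nat \<Rightarrow> nat" where
  "code_nth s j = code_hd ((code_tl ^^ j) s)"

definition dom_table :: "nat set" where
  "dom_table = (\<lambda>(c, l). prod_encode (to_nat c, l)) ` (ctls \<times> letters)"

text \<open>The value 0 outside the finite domain makes this computable for every
  \<open>t\<close>.\<close>

definition table :: "(ctl \<Rightarrow> nat \<Rightarrow> nat) \<Rightarrow> nat \<Rightarrow> nat" where
  "table t m = (if m \<in> dom_table
     then t (from_nat (fst (prod_decode m))) (snd (prod_decode m)) else 0)"

definition ctl_code :: "nat \<Rightarrow> nat \<Rightarrow> nat" where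
  "ctl_code s n = rec_nat (to_nat init_ctl)
     (\<lambda>j y. table (\<lambda>c l. to_nat (step_ctl c l)) (prod_encode (y, code_nth s j))) n"

text \<open>Increments (\<open>d = 1\<close>) and decrements (\<open>d = -1\<close>) are counted
  separately, which avoids integers; a register is 0 iff its two counts agree.\<close>

definition count_code :: "int \<Rightarrow> reg \<Rightarrow> nat \<Rightarrow> nat \<Rightarrow> nat" where
  "count_code d r s n = rec_nat 0
     (\<lambda>j y. y + table (\<lambda>c l. of_bool (step_delta c l r = d)) (prod_encode (ctl_code s j, code_nth s j))) n"

lemma table_eq: "c \<in> ctls \<Longrightarrow> l \<in> letters \<Longrightarrow> table t (prod_encode (to_nat c, l)) = t c l"
  by (auto simp: table_def dom_table_def)

lemma computable_table': "computable k f \<Longrightarrow> computable k (\<lambda>xs. table t (f xs))"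
  unfolding table_def
  by (rule computable_table) (simp_all add: dom_table_def finite_ctls finite_letters)

lemma computable_code_nth:
  "computable k s \<Longrightarrow> computable k j \<Longrightarrow> computable k (\<lambda>xs. code_nth (s xs) (j xs))"
  unfolding code_nth_def by (intro computable_code_hd computable_code_tl_pow)

lemma computable_ctl_code:
  assumes "computable k s" "computable k n"
  shows "computable k (\<lambda>xs. ctl_code (s xs) (n xs))"
  unfolding ctl_code_def
  by (rule computable_rec_nat[where s = "\<lambda>j y xs. table (\<lambda>c l. to_nat (step_ctl c l))
        (prod_encode (y, code_nth (s xs) j))"])
    (auto intro!: assms computable_const computable_table' computable_prod_encode computable_proj
      computable_code_nth computable_drop2)

lemma computable_count_code:
  assumes "computable k s" "computable k n"
  shows "computable k (\<lambda>xs. count_code d r (s xs) (n xs))"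
  unfolding count_code_def
  by (rule computable_rec_nat[where s = "\<lambda>j y xs. y + table (\<lambda>c l. of_bool (step_delta c l r = d))
        (prod_encode (ctl_code (s xs) j, code_nth (s xs) j))"])
    (auto intro!: assms computable_const computable_table' computable_prod_encode computable_proj
      computable_code_nth computable_drop2 computable_add computable_ctl_code)

lemma step_delta_cases: "step_delta c l r \<in> {-1, 0, 1}"
proof (cases "(c, l, r)" rule: step_delta.cases)
  case (2 a A l s)
  then show ?thesis by (cases A) auto
qed auto

context
  fixes \<sigma> :: "nat word" and n :: nat
  assumes \<sigma>: "\<sigma> \<in> omega_words letters"
begin

lemma word_letters: "\<sigma> j \<in> letters"
  using \<sigma> by (auto simp: omega_words_def)

lemma code_nth_prefix: "j < n \<Longrightarrow> code_nth (list_encode (prefix n \<sigma>)) j = \<sigma> j"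
  by (simp add: code_nth_def code_nth_encode)

lemma ctl_code_run:
  "j \<le> n \<Longrightarrow> ctl_code (list_encode (prefix n \<sigma>)) j = to_nat (fst (run \<sigma> j))"
proof (induction j)
  case 0
  then show ?case by (simp add: ctl_code_def run_0)
next
  case (Suc j)
  then have "ctl_code (list_encode (prefix n \<sigma>)) (Suc j) =
      table (\<lambda>c l. to_nat (step_ctl c l)) (prod_encode (to_nat (fst (run \<sigma> j)), \<sigma> j))"
    by (simp add: ctl_code_def code_nth_prefix)
  then show ?case by (simp add: table_eq run_in_ctls word_letters run_Suc step_cfg_def)
qed

lemma count_code_run:
  "j \<le> n \<Longrightarrow> int (count_code 1 r (list_encode (prefix n \<sigma>)) j) -
     int (count_code (-1) r (list_encode (prefix n \<sigma>)) j) = snd (run \<sigma> j) r"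
proof (induction j)
  case 0
  then show ?case by (simp add: count_code_def run_0)
next
  case (Suc j)
  have "count_code d r (list_encode (prefix n \<sigma>)) (Suc j) =
      count_code d r (list_encode (prefix n \<sigma>)) j + of_bool (step_delta (fst (run \<sigma> j)) (\<sigma> j) r = d)"
    for d
    using Suc.prems
    by (simp add: count_code_def ctl_code_run code_nth_prefix table_eq run_in_ctls word_letters)
  then show ?case
    using Suc step_delta_cases[of "fst (run \<sigma> j)" "\<sigma> j" r] by (auto simp: run_Suc step_cfg_def)
qed

end

definition good_code :: "nat \<Rightarrow> bool" where
  "good_code s \<longleftrightarrow> (\<exists>c\<in>ctls. ctl_code s (code_length s) = to_nat c \<and>
     good (c, \<lambda>r. int (count_code 1 r s (code_length s)) - int (count_code (-1) r s (code_length s))))"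

lemma good_code_run:
  assumes "\<sigma> \<in> omega_words letters"
  shows "good_code (list_encode (prefix n \<sigma>)) \<longleftrightarrow> good (run \<sigma> n)"
proof -
  have len: "code_length (list_encode (prefix n \<sigma>)) = n" by (simp add: code_length_encode)
  have "(\<lambda>r. int (count_code 1 r (list_encode (prefix n \<sigma>)) n) -
      int (count_code (-1) r (list_encode (prefix n \<sigma>)) n)) = snd (run \<sigma> n)"
    using count_code_run[OF assms order_refl] by auto
  then show ?thesis
    unfolding good_code_def len using ctl_code_run[OF assms order_refl, of n] run_in_ctls[of \<sigma> n]
    by auto
qed

lemma recursive_good_code:
  assumes s: "computable k s"
  shows "recursive_rel k (\<lambda>xs. good_code (s xs))"
  unfolding good_code_def
proof (intro recursive_rel_Bex finite_ctls recursive_rel_conj recursive_rel_eq computable_ctl_code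
    computable_code_length computable_const s)
  fix c :: ctl
  obtain p A where c: "c = (p, A)" by (cases c)
  have eq: "recursive_rel k (\<lambda>xs. (count_code 1 r (s xs) (code_length (s xs)) =
      count_code (-1) r (s xs) (code_length (s xs))) = z)" for r z
  proof (cases z)
    case True
    then show ?thesis
      by (auto intro!: recursive_rel_eq computable_count_code computable_code_length s)
  next
    case False
    then show ?thesis
      by (auto intro!: recursive_rel_not recursive_rel_eq computable_count_code computable_code_length s)
  qed
  show "recursive_rel k (\<lambda>xs. good (c, \<lambda>r. int (count_code 1 r (s xs) (code_length (s xs))) -
      int (count_code (-1) r (s xs) (code_length (s xs)))))"
    unfolding c by (cases A) (simp_all add: recursive_rel_const eq)
qed

lemma alt_quant_3: "alt_quant True 3 P \<longleftrightarrow> (\<exists>a. \<forall>b. \<exists>c. P [a, b, c])"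
  by (simp add: numeral_3_eq_3)

text \<open>The language has the form "there is \<open>a\<close> such that for all
  \<open>b\<close>", and its complement "for all \<open>b\<close> there is \<open>c\<close>"; both
  are padded to three quantifiers. In \<open>R\<close> the third number is forced to be
  \<open>a + b\<close>; for \<open>R'\<close> the padding is the outermost quantifier. Initial
  segments of length \<open>c + 1\<close> skip time 0, which does not affect what happens
  eventually.\<close>

theorem Delta0_game_lang: "Delta0 id letters 3 game_lang"
proof -
  define R where "R xs \<longleftrightarrow> code_length (xs ! 2) = Suc (xs ! 0 + xs ! 1) \<and> good_code (xs ! 2)" for xs
  define R' where "R' xs \<longleftrightarrow> Suc (xs ! 1) \<le> code_length (xs ! 2) \<and> \<not> good_code (xs ! 2)" for xs
  have rec: "recursive_rel 3 R" "recursive_rel 3 R'"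
    unfolding R_def R'_def
    by (intro recursive_rel_conj recursive_rel_not recursive_rel_eq recursive_rel_le
        recursive_good_code computable_code_length computable_proj computable_Suc computable_add;
        simp)+
  have "(\<exists>m. \<forall>j\<ge>m. good (run \<sigma> j)) \<longleftrightarrow> alt_quant True 3 (matrix R [] \<sigma>)"
    if "\<sigma> \<in> omega_words letters" for \<sigma>
  proof -
    have "matrix R [] \<sigma> [a, b, c] \<longleftrightarrow> c = a + b \<and> good (run \<sigma> (Suc c))" for a b c
      unfolding matrix_def R_def using good_code_run[OF that, of "Suc c"]
      by (simp add: code_length_encode del: upt_Suc)
    then have "alt_quant True 3 (matrix R [] \<sigma>) \<longleftrightarrow> (\<exists>a. \<forall>b. good (run \<sigma> (Suc (a + b))))"
      by (simp add: alt_quant_3)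
    also have "\<dots> \<longleftrightarrow> (\<exists>m. \<forall>j\<ge>m. good (run \<sigma> j))"
      by (metis Suc_le_D add_Suc le_Suc_ex le_add1 le_SucI)
    finally show ?thesis by simp
  qed
  then have S: "game_lang = {\<sigma> \<in> omega_words letters. alt_quant True 3 (matrix R [] (id \<circ> \<sigma>))}"
    unfolding game_lang_def by auto
  have "(\<forall>m. \<exists>j\<ge>m. \<not> good (run \<sigma> j)) \<longleftrightarrow> alt_quant True 3 (matrix R' [] \<sigma>)"
    if "\<sigma> \<in> omega_words letters" for \<sigma>
  proof -
    have "matrix R' [] \<sigma> [a, b, c] \<longleftrightarrow> b \<le> c \<and> \<not> good (run \<sigma> (Suc c))" for a b c
      unfolding matrix_def R'_def using good_code_run[OF that, of "Suc c"]
      by (simp add: code_length_encode del: upt_Suc)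
    then have "alt_quant True 3 (matrix R' [] \<sigma>) \<longleftrightarrow> (\<forall>b. \<exists>c\<ge>b. \<not> good (run \<sigma> (Suc c)))"
      by (simp add: alt_quant_3)
    also have "\<dots> \<longleftrightarrow> (\<forall>m. \<exists>j\<ge>m. \<not> good (run \<sigma> j))"
    proof (intro iffI allI)
      fix m assume "\<forall>b. \<exists>c\<ge>b. \<not> good (run \<sigma> (Suc c))"
      then obtain c where "m \<le> c" "\<not> good (run \<sigma> (Suc c))" by blast
      then show "\<exists>j\<ge>m. \<not> good (run \<sigma> j)" by (intro exI[of _ "Suc c"]) simp
    next
      fix b assume "\<forall>m. \<exists>j\<ge>m. \<not> good (run \<sigma> j)"
      then obtain j where "Suc b \<le> j" "\<not> good (run \<sigma> j)" by blast
      then show "\<exists>c\<ge>b. \<not> good (run \<sigma> (Suc c))" by (intro exI[of _ "j - 1"]) simp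
    qed
    finally show ?thesis by simp
  qed
  then have P: "omega_words letters - game_lang =
      {\<sigma> \<in> omega_words letters. alt_quant True 3 (matrix R' [] (id \<circ> \<sigma>))}"
    unfolding game_lang_def by auto
  show ?thesis
    unfolding Delta0_def Pi0_def Sigma0_def
    using rec S P by (intro conjI exI[of _ R] exI[of _ R']) (auto simp: game_lang_def)
qed

lemma Sigma0_vimage:
  assumes "Sigma0 id (c ` X) n L"
  shows "Sigma0 c X n {\<sigma> \<in> omega_words X. c \<circ> \<sigma> \<in> L}"
proof -
  have "c \<circ> \<sigma> \<in> omega_words (c ` X)" if "\<sigma> \<in> omega_words X" for \<sigma>
    using that by (auto simp: omega_words_def)
  then show ?thesis using assms unfolding Sigma0_def by auto
qed

lemma Delta0_vimage:
  assumes "Delta0 id (c ` X) n L"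
  shows "Delta0 c X n {\<sigma> \<in> omega_words X. c \<circ> \<sigma> \<in> L}"
proof -
  have "c \<circ> \<sigma> \<in> omega_words (c ` X)" if "\<sigma> \<in> omega_words X" for \<sigma>
    using that by (auto simp: omega_words_def)
  then have "omega_words X - {\<sigma> \<in> omega_words X. c \<circ> \<sigma> \<in> L} =
      {\<sigma> \<in> omega_words X. c \<circ> \<sigma> \<in> omega_words (c ` X) - L}"
    by auto
  then show ?thesis
    using assms Sigma0_vimage unfolding Delta0_def Pi0_def by fastforce
qed

section \<open>The counter automaton\<close>

text \<open>The part of \<open>good\<close> that the finite control recognises without the
  registers.\<close>

definition calm :: "ctl \<Rightarrow> bool" where
  "calm c \<longleftrightarrow> snd c = Tru \<or> (\<exists>r A. snd c = Forall r A)"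

lemma good_iff:
  "good (c, \<rho>) \<longleftrightarrow> calm c \<or> (\<exists>r z. snd c = Test r z \<and> (\<rho> r = 0) = z)"
  by (cases "(c, \<rho>)" rule: good.cases) (auto simp: calm_def)

lemma calm_good: "calm (fst c) \<Longrightarrow> good c"
  by (cases c) (simp add: good_iff)

lemma step_ctl_Tru: "snd c = Tru \<Longrightarrow> snd (step_ctl c l) = Tru"
  by (cases "(c, l)" rule: step_ctl.cases) auto

lemma step_ctl_Test: "snd c = Test r z \<Longrightarrow>
    snd (step_ctl c l) = Tru \<or> snd (step_ctl c l) = Test r z \<and> step_delta c l = (\<lambda>s. 0)"
  by (cases "(c, l)" rule: step_ctl.cases) (auto simp: fun_eq_iff)

text \<open>Only an invalid reply leads out of a test, and then to \<open>Tru\<close>; the registers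
  do not change meanwhile. Hence a play meets at most one test, and its outcome is final.\<close>

lemma Test_stays:
  assumes "j \<le> k" "snd (fst (run \<sigma> j)) = Test r z"
  shows "snd (fst (run \<sigma> k)) = Tru \<or>
    snd (fst (run \<sigma> k)) = Test r z \<and> snd (run \<sigma> k) = snd (run \<sigma> j)"
  using assms(1)
proof (induction k rule: dec_induct)
  case (step k)
  then show ?case
    using step_ctl_Tru[of "fst (run \<sigma> k)" "\<sigma> k"] step_ctl_Test[of "fst (run \<sigma> k)" r z "\<sigma> k"]
    by (auto simp: run_Suc step_cfg_def)
qed (use assms(2) in simp)

lemma good_Test_stays:
  assumes "snd (fst (run \<sigma> j)) = Test r z" "good (run \<sigma> j)" "j \<le> k"
  shows "good (run \<sigma> k)"
  using Test_stays[OF assms(3,1)] assms(1,2)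
  by (cases "run \<sigma> j"; cases "run \<sigma> k") (auto simp: good_iff calm_def)

text \<open>The counter holds the absolute value of one register, whose sign is kept in the state.\<close>

datatype ca_state = CInit | CTrack reg bool ctl | CFin ctl

instance ca_state :: countable by countable_datatype

text \<open>At counter value 0 the stored sign is free. A change then stores the sign of
  \<open>d\<close> and increments, so an empty counter is never decremented.\<close>

definition track_upd :: "bool \<Rightarrow> bool \<Rightarrow> int \<Rightarrow> bool \<times> int" where
  "track_upd s z d = (if d = 0 then (s, 0) else if z then (d < 0, 1)
     else if s = (d < 0) then (s, 1) else (s, -1))"

text \<open>The first transition guesses the register and already performs a step, as a real-time
  automaton reads a letter each time. \<open>commit\<close> guesses that the control is calm from
  now on; \<open>verdict\<close> makes the only use of the counter that matters for acceptance and
  enters the calm control \<open>(None, Tru)\<close>.\<close>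

inductive ca_step :: "ca_state \<Rightarrow> nat \<Rightarrow> bool \<Rightarrow> ca_state \<Rightarrow> int \<Rightarrow> bool" where
  track: "c \<in> ctls \<Longrightarrow> l \<in> letters \<Longrightarrow> track_upd s z (step_delta c l r) = (s', d) \<Longrightarrow>
    ca_step (CTrack r s c) l z (CTrack r s' (step_ctl c l)) d"
| commit: "c \<in> ctls \<Longrightarrow> l \<in> letters \<Longrightarrow> calm (step_ctl c l) \<Longrightarrow>
    ca_step (CTrack r s c) l z (CFin (step_ctl c l)) 0"
| verdict: "c \<in> ctls \<Longrightarrow> l \<in> letters \<Longrightarrow> snd c = Test r z \<Longrightarrow>
    ca_step (CTrack r s c) l z (CFin (None, Tru)) 0"
| fin: "c \<in> ctls \<Longrightarrow> l \<in> letters \<Longrightarrow> calm (step_ctl c l) \<Longrightarrow>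
    ca_step (CFin c) l z (CFin (step_ctl c l)) 0"
| init: "ca_step (CTrack r False init_ctl) l z q d \<Longrightarrow> ca_step CInit l z q d"

definition ca_state_set :: "ca_state set" where
  "ca_state_set = {CInit} \<union> (\<lambda>(r, s, c). CTrack r s c) ` (UNIV \<times> UNIV \<times> ctls) \<union> CFin ` ctls"

definition game_ca :: "(nat, nat) counter_aut" where
  "game_ca = \<lparr>ca_states = to_nat ` ca_state_set, ca_alphabet = letters,
     ca_trans = {(to_nat p, l, z, to_nat q, d) | p l z q d. ca_step p l z q d},
     ca_init = to_nat CInit, ca_final = to_nat ` CFin ` ctls\<rparr>"

lemma track_upd_range: "track_upd s z d = (s', d') \<Longrightarrow> d' \<in> {-1, 0, 1} \<and> (z \<longrightarrow> d' \<noteq> -1)"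
  by (auto simp: track_upd_def split: if_splits)

lemma ca_step_range:
  "ca_step p l z q d \<Longrightarrow> p \<in> ca_state_set \<and> l \<in> letters \<and> q \<in> ca_state_set \<and>
     d \<in> {-1, 0, 1} \<and> (z \<longrightarrow> d \<noteq> -1)"
  by (induction rule: ca_step.induct)
    (auto simp: ca_state_set_def step_ctl_in Tru_ctls image_iff dest: track_upd_range)

lemma rt_counter_buchi_game_ca: "rt_counter_buchi game_ca"
proof -
  have "finite ca_state_set" "CInit \<in> ca_state_set" "CFin ` ctls \<subseteq> ca_state_set"
    by (auto simp: ca_state_set_def finite_ctls)
  then show ?thesis
    unfolding rt_counter_buchi_def game_ca_def
    by (auto simp: finite_letters dest: ca_step_range)
qed

section \<open>Runs of the counter automaton\<close>

definition signed :: "bool \<Rightarrow> nat \<Rightarrow> int" where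
  "signed s n = (if s then - int n else int n)"

lemma track_upd_signed:
  assumes "track_upd s (n = 0) d = (s', d')" "d \<in> {-1, 0, 1}"
  shows "0 \<le> int n + d'" "int n' - int n = d' \<Longrightarrow> signed s' n' = signed s n + d"
  using assms by (auto simp: track_upd_def signed_def split: if_splits)

primrec tracked :: "reg \<Rightarrow> nat word \<Rightarrow> nat \<Rightarrow> bool \<times> nat" where
  "tracked r \<sigma> 0 = (False, 0)"
| "tracked r \<sigma> (Suc i) = (let (s, n) = tracked r \<sigma> i;
     (s', d) = track_upd s (n = 0) (step_delta (fst (run \<sigma> i)) (\<sigma> i) r) in (s', nat (int n + d)))"

lemma tracked_step:
  "track_upd (fst (tracked r \<sigma> i)) (snd (tracked r \<sigma> i) = 0) (step_delta (fst (run \<sigma> i)) (\<sigma> i) r) =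
     (fst (tracked r \<sigma> (Suc i)), int (snd (tracked r \<sigma> (Suc i))) - int (snd (tracked r \<sigma> i)))"
proof -
  obtain s n where sn: "tracked r \<sigma> i = (s, n)" by (cases "tracked r \<sigma> i")
  obtain s' d where sd: "track_upd s (n = 0) (step_delta (fst (run \<sigma> i)) (\<sigma> i) r) = (s', d)"
    by (metis surj_pair)
  have "0 \<le> int n + d" using track_upd_signed(1)[OF sd step_delta_cases] .
  then show ?thesis by (simp add: sn sd)
qed

lemma tracked_signed:
  "signed (fst (tracked r \<sigma> i)) (snd (tracked r \<sigma> i)) = snd (run \<sigma> i) r"
proof (induction i)
  case 0
  then show ?case by (simp add: signed_def run_0)
next
  case (Suc i)
  from track_upd_signed(2)[OF tracked_step step_delta_cases refl] Suc show ?case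
    by (simp add: run_Suc step_cfg_def del: tracked.simps)
qed

lemma ca_lang_game_ca_subset: "ca_lang game_ca \<subseteq> game_lang"
proof
  fix \<sigma> assume "\<sigma> \<in> ca_lang game_ca"
  then obtain q' n where \<sigma>: "\<sigma> \<in> omega_words letters" and run: "ca_run game_ca \<sigma> q' n"
    and inf: "\<exists>\<^sub>\<infinity>i. q' i \<in> ca_final game_ca"
    unfolding ca_lang_def by (auto simp: game_ca_def)
  define q where "q i = (from_nat (q' i) :: ca_state)" for i
  have step: "ca_step (q i) (\<sigma> i) (n i = 0) (q (Suc i)) (int (n (Suc i)) - int (n i))" for i
    using run unfolding ca_run_def by (auto simp: game_ca_def q_def dest!: spec[of _ i])
  have q0: "q 0 = CInit" "n 0 = 0" using run by (simp_all add: ca_run_def q_def game_ca_def)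
  \<comment> \<open>A final state either carries the true control, which is calm, or goes back to a
    verdict on a passed test; in the second case its control may differ from that of the
    play.\<close>
  have inv: "q i = CInit \<and> i = 0 \<or>
      (\<exists>r s. q i = CTrack r s (fst (run \<sigma> i)) \<and> signed s (n i) = snd (run \<sigma> i) r) \<or>
      (\<exists>c. q i = CFin c \<and> (c = fst (run \<sigma> i) \<and> calm c \<or>
        (\<exists>j\<le>i. good (run \<sigma> j) \<and> (\<exists>r z. snd (fst (run \<sigma> j)) = Test r z))))" for i
  proof (induction i)
    case 0
    then show ?case by (simp add: q0)
  next
    case (Suc i)
    have tr: ?case if "ca_step (CTrack r s (fst (run \<sigma> i))) (\<sigma> i) (n i = 0) (q (Suc i))
        (int (n (Suc i)) - int (n i))" "signed s (n i) = snd (run \<sigma> i) r" for r s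
      using that(1)
    proof cases
      case (track s')
      then show ?thesis
        using track_upd_signed(2)[OF track(4) step_delta_cases refl] that(2)
        by (simp add: run_Suc step_cfg_def)
    next
      case commit
      then show ?thesis by (simp add: run_Suc step_cfg_def)
    next
      case verdict
      then have "good (run \<sigma> i)"
        using that(2) by (cases "run \<sigma> i") (auto simp: good_iff signed_def split: if_splits)
      then show ?thesis using verdict by auto
    qed
    from Suc.IH consider "q i = CInit" "i = 0"
      | r s where "q i = CTrack r s (fst (run \<sigma> i))" "signed s (n i) = snd (run \<sigma> i) r"
      | c where "q i = CFin c" "c = fst (run \<sigma> i) \<and> calm c \<or>
        (\<exists>j\<le>i. good (run \<sigma> j) \<and> (\<exists>r z. snd (fst (run \<sigma> j)) = Test r z))"
      by blast
    then show ?case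
    proof cases
      case 1
      have "ca_step CInit (\<sigma> i) (n i = 0) (q (Suc i)) (int (n (Suc i)) - int (n i))"
        using step[of i] 1 by simp
      then obtain r where "ca_step (CTrack r False init_ctl) (\<sigma> i) (n i = 0) (q (Suc i))
          (int (n (Suc i)) - int (n i))"
        by cases
      then show ?thesis using tr[of r False] 1 q0 by (simp add: run_0 signed_def)
    next
      case 2
      then show ?thesis using tr[of r s] step[of i] by simp
    next
      case 3
      have "ca_step (CFin c) (\<sigma> i) (n i = 0) (q (Suc i)) (int (n (Suc i)) - int (n i))"
        using step[of i] 3 by simp
      then show ?thesis
      proof cases
        case fin
        then show ?thesis using 3(2) by (auto simp: run_Suc step_cfg_def intro: le_SucI)
      qed
    qed
  qed
  obtain i where "q' i \<in> ca_final game_ca" using inf by (auto simp: INFM_nat)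
  then have "\<exists>c. q i = CFin c" by (auto simp: q_def game_ca_def)
  have fin: "\<exists>c. q j = CFin c" if "i \<le> j" for j
    using that
  proof (induction j rule: dec_induct)
    case (step j)
    then obtain c where "q j = CFin c" by blast
    with \<open>\<And>i. ca_step (q i) (\<sigma> i) (n i = 0) (q (Suc i)) (int (n (Suc i)) - int (n i))\<close>[of j]
    show ?case by (auto elim: ca_step.cases)
  qed fact
  have "good (run \<sigma> j)" if "i \<le> j" for j
    using inv[of j] fin[OF that] good_Test_stays[of \<sigma>] calm_good[of "run \<sigma> j"] by auto
  then show "\<sigma> \<in> game_lang" using \<sigma> unfolding game_lang_def by blast
qed

text \<open>Both kinds of acceptance share this run: follow register \<open>r\<close> up to time
  \<open>k\<close>, enter \<open>CFin e\<close> and stay calm. After a commitment \<open>e\<close>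
  is the true control, after a verdict it is \<open>(None, Tru)\<close>.\<close>

lemma ca_lang_game_caI:
  assumes \<sigma>: "\<sigma> \<in> omega_words letters" and e: "calm e" "e \<in> ctls"
    and step: "ca_step (CTrack r (fst (tracked r \<sigma> k)) (fst (run \<sigma> k))) (\<sigma> k)
        (snd (tracked r \<sigma> k) = 0) (CFin e) 0"
    and calm: "\<And>j. calm (foldl step_ctl e (prefix j (suffix (Suc k) \<sigma>)))"
  shows "\<sigma> \<in> ca_lang game_ca"
proof -
  define E where "E j = foldl step_ctl e (prefix j (suffix (Suc k) \<sigma>))" for j
  have E: "E 0 = e" "E (Suc j) = step_ctl (E j) (\<sigma> (Suc k + j))" for j
    by (simp_all add: E_def suffix_def)
  have E_in: "E j \<in> ctls" for j by (induction j) (simp_all add: E e step_ctl_in)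
  have \<sigma>_in: "\<sigma> j \<in> letters" for j using \<sigma> by (auto simp: omega_words_def)
  define q where "q i = (if i = 0 then CInit
      else if i \<le> k then CTrack r (fst (tracked r \<sigma> i)) (fst (run \<sigma> i)) else CFin (E (i - Suc k)))" for i
  \<comment> \<open>The transitions from time \<open>k\<close> on add 0, so the counter is frozen at
    its value there.\<close>
  define n where "n i = snd (tracked r \<sigma> (min i k))" for i
  have q_step: "ca_step (if i \<le> k then CTrack r (fst (tracked r \<sigma> i)) (fst (run \<sigma> i))
      else CFin (E (i - Suc k))) (\<sigma> i) (n i = 0) (q (Suc i)) (int (n (Suc i)) - int (n i))" for i
  proof -
    consider "i < k" | "i = k" | "k < i" by linarith
    then show ?thesis
    proof cases
      case 1
      have "fst (run \<sigma> (Suc i)) = step_ctl (fst (run \<sigma> i)) (\<sigma> i)"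
        by (simp add: run_Suc step_cfg_def)
      with ca_step.track[OF run_in_ctls[of \<sigma> i] \<sigma>_in[of i] tracked_step[of r \<sigma> i]] 1 show ?thesis
        by (simp add: q_def n_def del: tracked.simps)
    next
      case 2
      then show ?thesis using step by (simp add: q_def n_def E)
    next
      case 3
      then obtain j where j: "i = Suc k + j" using less_iff_Suc_add by auto
      have "calm (step_ctl (E j) (\<sigma> i))" using calm[folded E_def, of "Suc j"] E(2)[of j] j by simp
      then have "ca_step (CFin (E j)) (\<sigma> i) (n i = 0) (CFin (step_ctl (E j) (\<sigma> i))) 0"
        by (intro ca_step.fin E_in \<sigma>_in)
      then show ?thesis using j by (simp add: q_def n_def E)
    qed
  qed
  have "ca_step (q i) (\<sigma> i) (n i = 0) (q (Suc i)) (int (n (Suc i)) - int (n i))" for i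
  proof (cases "i = 0")
    case True
    then show ?thesis using q_step[of 0] by (auto simp: q_def run_0 intro: ca_step.init)
  next
    case False
    then show ?thesis using q_step[of i] by (simp add: q_def)
  qed
  then have "ca_run game_ca \<sigma> (\<lambda>i. to_nat (q i)) n"
    by (auto simp: ca_run_def game_ca_def q_def n_def)
  moreover have "\<exists>\<^sub>\<infinity>i. to_nat (q i) \<in> ca_final game_ca"
    unfolding INFM_nat_le
  proof
    fix m
    show "\<exists>i\<ge>m. to_nat (q i) \<in> ca_final game_ca"
      by (rule exI[of _ "m + Suc k"]) (simp add: q_def game_ca_def E_in)
  qed
  ultimately show ?thesis using \<sigma> unfolding ca_lang_def by (auto simp: game_ca_def)
qed

lemma foldl_step_ctl_run:
  "foldl step_ctl (fst (run \<sigma> m)) (prefix j (suffix m \<sigma>)) = fst (run \<sigma> (m + j))"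
  by (induction j) (simp_all add: run_Suc step_cfg_def suffix_def)

lemma foldl_step_ctl_Tru: "snd c = Tru \<Longrightarrow> snd (foldl step_ctl c w) = Tru"
  by (induction w arbitrary: c) (simp_all add: step_ctl_Tru)

text \<open>A position that is good but not calm is a passed test. So either the registers cease to
  matter or a single test decides.\<close>

lemma game_lang_cases:
  assumes "\<sigma> \<in> game_lang"
  obtains (calm) k where "\<And>j. k \<le> j \<Longrightarrow> calm (fst (run \<sigma> j))"
  | (test) k r z where "snd (fst (run \<sigma> k)) = Test r z" "(snd (run \<sigma> k) r = 0) = z"
proof -
  obtain m where m: "\<And>j. m \<le> j \<Longrightarrow> good (run \<sigma> j)" using assms unfolding game_lang_def by blast
  show thesis
  proof (cases "\<forall>j\<ge>m. calm (fst (run \<sigma> j))")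
    case True
    then show thesis using calm by blast
  next
    case False
    then obtain j where "m \<le> j" "\<not> calm (fst (run \<sigma> j))" by blast
    then obtain r z where "snd (fst (run \<sigma> j)) = Test r z" "(snd (run \<sigma> j) r = 0) = z"
      using m[of j] by (cases "run \<sigma> j") (auto simp: good_iff)
    then show thesis by (rule test)
  qed
qed

theorem ca_lang_game_ca: "ca_lang game_ca = game_lang"
proof
  show "game_lang \<subseteq> ca_lang game_ca"
  proof
    fix \<sigma> assume L: "\<sigma> \<in> game_lang"
    then have \<sigma>: "\<sigma> \<in> omega_words letters" by (simp add: game_lang_def)
    then have \<sigma>_in: "\<sigma> j \<in> letters" for j by (auto simp: omega_words_def)
    from L show "\<sigma> \<in> ca_lang game_ca"
    proof (cases rule: game_lang_cases)
      case (calm k)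
      have eq: "fst (run \<sigma> (Suc k)) = step_ctl (fst (run \<sigma> k)) (\<sigma> k)"
        by (simp add: run_Suc step_cfg_def)
      show ?thesis
      proof (rule ca_lang_game_caI[OF \<sigma>])
        show "calm (fst (run \<sigma> (Suc k)))" using calm by simp
        show "ca_step (CTrack RX (fst (tracked RX \<sigma> k)) (fst (run \<sigma> k))) (\<sigma> k)
            (snd (tracked RX \<sigma> k) = 0) (CFin (fst (run \<sigma> (Suc k)))) 0"
          unfolding eq using calm[of "Suc k"] eq by (intro ca_step.commit run_in_ctls \<sigma>_in) simp
        show "calm (foldl step_ctl (fst (run \<sigma> (Suc k))) (prefix j (suffix (Suc k) \<sigma>)))" for j
          unfolding foldl_step_ctl_run using calm by simp
      qed (rule run_in_ctls)
    next
      case (test k r z)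
      have "z = (snd (tracked r \<sigma> k) = 0)"
        using test(2) tracked_signed[of r \<sigma> k] by (auto simp: signed_def split: if_splits)
      then show ?thesis
        using test(1) by (intro ca_lang_game_caI[OF \<sigma>, of "(None, Tru)" r k] ca_step.verdict
            run_in_ctls \<sigma>_in) (simp_all add: calm_def Tru_ctls foldl_step_ctl_Tru)
    qed
  qed
qed (rule ca_lang_game_ca_subset)

section \<open>The 2-tape automaton\<close>

text \<open>If Player 2 copies correctly, the parts of his letters on either tape determine the play.
  To test register \<open>r\<close>, the first head counts its increments and the second head its decrements,
  independently of each other, until both reach the state \<open>Test r z\<close>.\<close>

type_synonym head = "bool \<times> fm"

fun head_step :: "head \<Rightarrow> nat \<Rightarrow> head" where
  "head_step (False, A) u = (True, A)"
| "head_step (True, A) u = (False, next_fm A (odd u) (2 \<le> u))"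

fun head_delta :: "head \<Rightarrow> nat \<Rightarrow> reg \<Rightarrow> int" where
  "head_delta (False, A) u s = 0"
| "head_delta (True, A) u s = delta A (odd u) (2 \<le> u) s"

definition stopped :: "fm \<Rightarrow> bool" where
  "stopped A \<longleftrightarrow> (\<exists>r z. A = Test r z)"

definition heads :: "head set" where
  "heads = {(b, A). (None, A) \<in> ctls}"

text \<open>\<open>both\<close> pairs an increment read on the first tape with a decrement read on
  the second. Unpaired ones may occur on one side only, recorded as \<open>More\<close> or
  \<open>Fewer\<close>. Thus \<open>Equal\<close> certifies equal counts and the other two values
  certify different ones.\<close>

datatype balance = Equal | More | Fewer

datatype ta_state = TInit | TSync ctl | TFin ctl | THeads reg balance head head

instance balance :: countable by countable_datatype
instance ta_state :: countable by countable_datatype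

text \<open>\<open>TSync\<close> reads both tapes in step and serves the plays that become calm,
  including those with an invalid reply. \<open>THeads\<close> serves the plays decided by a test:
  both heads stop at the first test, hence at the same position, where \<open>TFin\<close> resumes
  reading in step.\<close>

inductive ta_step :: "ta_state \<Rightarrow> nat list \<Rightarrow> nat list \<Rightarrow> ta_state \<Rightarrow> bool" where
  init_sync: "ta_step TInit [] [] (TSync init_ctl)"
| init_heads: "ta_step TInit [] [] (THeads r Equal (False, snd init_ctl) (False, snd init_ctl))"
| sync: "c \<in> ctls \<Longrightarrow> u < 4 \<Longrightarrow> v < 4 \<Longrightarrow>
    ta_step (TSync c) [u] [v] (TSync (step_ctl c (prod_encode (u, v))))"
| commit: "c \<in> ctls \<Longrightarrow> calm c \<Longrightarrow> ta_step (TSync c) [] [] (TFin c)"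
| fin: "c \<in> ctls \<Longrightarrow> u < 4 \<Longrightarrow> v < 4 \<Longrightarrow> calm (step_ctl c (prod_encode (u, v))) \<Longrightarrow>
    ta_step (TFin c) [u] [v] (TFin (step_ctl c (prod_encode (u, v))))"
| left: "h1 \<in> heads \<Longrightarrow> h2 \<in> heads \<Longrightarrow> u < 4 \<Longrightarrow> \<not> stopped (snd h1) \<Longrightarrow>
    head_delta h1 u r \<noteq> 1 \<and> m' = m \<or> head_delta h1 u r = 1 \<and> m \<noteq> Fewer \<and> m' = More \<Longrightarrow>
    ta_step (THeads r m h1 h2) [u] [] (THeads r m' (head_step h1 u) h2)"
| right: "h1 \<in> heads \<Longrightarrow> h2 \<in> heads \<Longrightarrow> v < 4 \<Longrightarrow> \<not> stopped (snd h2) \<Longrightarrow>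
    head_delta h2 v r \<noteq> -1 \<and> m' = m \<or> head_delta h2 v r = -1 \<and> m \<noteq> More \<and> m' = Fewer \<Longrightarrow>
    ta_step (THeads r m h1 h2) [] [v] (THeads r m' h1 (head_step h2 v))"
| both: "h1 \<in> heads \<Longrightarrow> h2 \<in> heads \<Longrightarrow> u < 4 \<Longrightarrow> v < 4 \<Longrightarrow>
    \<not> stopped (snd h1) \<Longrightarrow> \<not> stopped (snd h2) \<Longrightarrow>
    head_delta h1 u r = 1 \<Longrightarrow> head_delta h2 v r = -1 \<Longrightarrow>
    ta_step (THeads r m h1 h2) [u] [v] (THeads r m (head_step h1 u) (head_step h2 v))"
| verdict: "h1 \<in> heads \<Longrightarrow> h2 \<in> heads \<Longrightarrow> snd h1 = Test r z \<Longrightarrow> snd h2 = Test r z \<Longrightarrow>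
    (m = Equal) = z \<Longrightarrow> ta_step (THeads r m h1 h2) [] [] (TFin (None, Tru))"

definition ta_state_set :: "ta_state set" where
  "ta_state_set = {TInit} \<union> TSync ` ctls \<union> TFin ` ctls \<union>
     (\<lambda>(r, m, h1, h2). THeads r m h1 h2) ` (UNIV \<times> {Equal, More, Fewer} \<times> heads \<times> heads)"

definition game_ta :: "(nat, nat, nat) tape2_aut" where
  "game_ta = \<lparr>ta_states = to_nat ` ta_state_set, ta_in = {..<4}, ta_out = {..<4},
     ta_trans = {(to_nat p, x, y, to_nat q) | p x y q. ta_step p x y q},
     ta_init = to_nat TInit, ta_final = to_nat ` TFin ` ctls\<rparr>"

lemma finite_heads: "finite heads"
proof -
  have "heads \<subseteq> UNIV \<times> snd ` ctls" by (auto simp: heads_def image_iff) force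
  then show ?thesis by (rule finite_subset) (simp add: finite_ctls)
qed

lemma head_step_in: "h \<in> heads \<Longrightarrow> head_step h u \<in> heads"
  by (cases "(h, u)" rule: head_step.cases) (auto simp: heads_def next_fm_ctls)

lemma init_head_in: "(False, snd init_ctl) \<in> heads"
  using init_ctl_in by (simp add: heads_def init_ctl_def)

lemma mem_ta_state_set:
  "TInit \<in> ta_state_set" "TSync c \<in> ta_state_set \<longleftrightarrow> c \<in> ctls" "TFin c \<in> ta_state_set \<longleftrightarrow> c \<in> ctls"
  "THeads r m h1 h2 \<in> ta_state_set \<longleftrightarrow> h1 \<in> heads \<and> h2 \<in> heads"
  by (cases m; auto simp: ta_state_set_def image_iff)+

lemma ta_step_range:
  "ta_step p x y q \<Longrightarrow> p \<in> ta_state_set \<and> q \<in> ta_state_set \<and>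
     x \<in> insert [] ((\<lambda>u. [u]) ` {..<4}) \<and> y \<in> insert [] ((\<lambda>u. [u]) ` {..<4})"
  by (induction rule: ta_step.induct)
    (auto simp: mem_ta_state_set step_ctl_in init_ctl_in init_head_in head_step_in Tru_ctls)

lemma tape2_buchi_game_ta: "tape2_buchi game_ta"
proof -
  have "finite ta_state_set"
    by (simp add: ta_state_set_def finite_ctls finite_heads)
  moreover have "ta_trans game_ta \<subseteq> to_nat ` ta_state_set \<times> insert [] ((\<lambda>u. [u]) ` {..<4}) \<times>
      insert [] ((\<lambda>u. [u]) ` {..<4}) \<times> to_nat ` ta_state_set" (is "_ \<subseteq> ?T")
    using ta_step_range by (force simp: game_ta_def)
  moreover have "?T \<subseteq> to_nat ` ta_state_set \<times> lists {..<4} \<times> lists {..<4} \<times> to_nat ` ta_state_set"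
    by auto
  ultimately have "finite (ta_trans game_ta)" "finite (to_nat ` ta_state_set)"
    "ta_trans game_ta \<subseteq> to_nat ` ta_state_set \<times> lists {..<4} \<times> lists {..<4} \<times> to_nat ` ta_state_set"
    by (auto intro: finite_subset)
  moreover have "TInit \<in> ta_state_set" "TFin ` ctls \<subseteq> ta_state_set"
    by (auto simp: ta_state_set_def)
  ultimately show ?thesis
    by (auto simp: tape2_buchi_def game_ta_def)
qed

text \<open>The bit of Player 1 can be forgotten, since the reply repeats it on both tapes; the
  letter of Player 1 itself may differ on them.\<close>

definition head_of :: "ctl \<Rightarrow> head" where
  "head_of c = (fst c \<noteq> None, snd c)"

lemma head_of_in: "c \<in> ctls \<Longrightarrow> head_of c \<in> heads"
  by (auto simp: head_of_def heads_def ctls_def)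

definition count :: "int \<Rightarrow> reg \<Rightarrow> nat word \<Rightarrow> nat \<Rightarrow> nat" where
  "count d r \<tau> n = (\<Sum>j<n. of_bool (step_delta (fst (run \<tau> j)) (\<tau> j) r = d))"

lemma count_simps:
  "count d r \<tau> 0 = 0"
  "count d r \<tau> (Suc n) = count d r \<tau> n + of_bool (step_delta (fst (run \<tau> n)) (\<tau> n) r = d)"
  by (simp_all add: count_def)

lemma run_count: "snd (run \<tau> n) r = int (count 1 r \<tau> n) - int (count (-1) r \<tau> n)"
proof (induction n)
  case 0
  then show ?case by (simp add: count_simps run_0)
next
  case (Suc n)
  then show ?case using step_delta_cases[of "fst (run \<tau> n)" "\<tau> n" r]
    by (auto simp: count_simps run_Suc step_cfg_def)
qed

section \<open>Plays in which Player 2 copies correctly\<close>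

definition copies :: "nat word \<Rightarrow> bool" where
  "copies \<tau> \<longleftrightarrow> (\<forall>j a. fst (fst (run \<tau> j)) = Some a \<longrightarrow> valid_reply a (\<tau> j))"

lemma not_copies_calm:
  assumes "\<not> copies \<tau>"
  shows "\<exists>k. \<forall>j\<ge>k. calm (fst (run \<tau> j))"
proof -
  obtain j a where j: "fst (fst (run \<tau> j)) = Some a" "\<not> valid_reply a (\<tau> j)"
    using assms by (auto simp: copies_def)
  have "snd (fst (run \<tau> k)) = Tru" if "Suc j \<le> k" for k
    using that
  proof (induction k rule: dec_induct)
    case base
    then show ?case using j by (cases "fst (run \<tau> j)") (simp add: run_Suc step_cfg_def)
  next
    case (step k)
    then show ?case by (simp add: run_Suc step_cfg_def step_ctl_Tru)
  qed
  then show ?thesis by (intro exI[of _ "Suc j"]) (simp add: calm_def)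
qed

text \<open>Both parts of a valid reply contain both bits, and from a letter of Player 1 a head only
  learns that the turn has passed. So each tape alone drives the control.\<close>

lemma head_of_run:
  assumes "copies \<tau>"
  shows "head_of (fst (run \<tau> (Suc j))) = head_step (head_of (fst (run \<tau> j))) (fst_part (\<tau> j))"
    "head_of (fst (run \<tau> (Suc j))) = head_step (head_of (fst (run \<tau> j))) (snd_part (\<tau> j))"
    "head_delta (head_of (fst (run \<tau> j))) (fst_part (\<tau> j)) = step_delta (fst (run \<tau> j)) (\<tau> j)"
    "head_delta (head_of (fst (run \<tau> j))) (snd_part (\<tau> j)) = step_delta (fst (run \<tau> j)) (\<tau> j)"
proof -
  obtain p A where c: "fst (run \<tau> j) = (p, A)" by (metis surj_pair)
  have "valid_reply a (\<tau> j)" if "p = Some a" for a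
    using assms c that by (simp add: copies_def)
  then show "head_of (fst (run \<tau> (Suc j))) = head_step (head_of (fst (run \<tau> j))) (fst_part (\<tau> j))"
    "head_of (fst (run \<tau> (Suc j))) = head_step (head_of (fst (run \<tau> j))) (snd_part (\<tau> j))"
    "head_delta (head_of (fst (run \<tau> j))) (fst_part (\<tau> j)) = step_delta (fst (run \<tau> j)) (\<tau> j)"
    "head_delta (head_of (fst (run \<tau> j))) (snd_part (\<tau> j)) = step_delta (fst (run \<tau> j)) (\<tau> j)"
    using c by (cases p; auto simp: run_Suc step_cfg_def head_of_def valid_reply_def fun_eq_iff)+
qed

lemma concat_is_singleton:
  assumes "concat_is ws w" "ws i = [l]"
  shows "l = w (length (concat (prefix i ws)))"
proof -
  let ?n = "length (concat (prefix i ws))"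
  have c: "concat (prefix k ws) = prefix (length (concat (prefix k ws))) w" for k
    using assms(1) by (simp add: concat_is_def)
  have "concat (prefix (Suc i) ws) = concat (prefix i ws) @ [l]" using assms(2) by simp
  moreover have "concat (prefix (Suc i) ws) = prefix (Suc ?n) w"
    using c[of "Suc i"] calculation by simp
  ultimately have "concat (prefix i ws) @ [l] = prefix ?n w @ [w ?n]" by simp
  then show ?thesis using c[of i] by simp
qed

lemma ta_lang_sound:
  assumes "\<sigma> \<in> ta_lang game_ta"
  shows "prod_encode \<circ> \<sigma> \<in> game_lang"
proof -
  define u v \<tau> where "u = fst \<circ> \<sigma>" and "v = snd \<circ> \<sigma>" and "\<tau> = prod_encode \<circ> \<sigma>"
  have parts: "fst_part (\<tau> j) = u j" "snd_part (\<tau> j) = v j" for j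
    by (simp_all add: \<tau>_def u_def v_def)
  have \<tau>_uv: "\<tau> j = prod_encode (u j, v j)" for j by (simp add: \<tau>_def u_def v_def)
  have \<tau>: "\<tau> \<in> omega_words letters"
    using assms by (auto simp: ta_lang_def omega_words_def game_ta_def letters_def \<tau>_def)
  have "ta_accepts game_ta u v" using assms by (simp add: ta_lang_def u_def v_def)
  then obtain q' x y where q': "q' 0 = ta_init game_ta"
      "\<And>i. (q' i, x i, y i, q' (Suc i)) \<in> ta_trans game_ta"
    and inf: "\<exists>\<^sub>\<infinity>i. q' i \<in> ta_final game_ta" and x: "concat_is x u" and y: "concat_is y v"
    unfolding ta_accepts_def by blast
  define q where "q i = (from_nat (q' i) :: ta_state)" for i
  have step: "ta_step (q i) (x i) (y i) (q (Suc i))" for i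
    using q'(2)[of i] by (auto simp: game_ta_def q_def)
  have q0: "q 0 = TInit" using q'(1) by (simp add: q_def game_ta_def)
  define a b where "a i = length (concat (prefix i x))" and "b i = length (concat (prefix i y))" for i
  have ab0: "a 0 = 0" "b 0 = 0" by (simp_all add: a_def b_def)
  have aS: "a (Suc i) = a i + length (x i)" "b (Suc i) = b i + length (y i)" for i
    by (simp_all add: a_def b_def)
  have x1: "l = u (a i)" if "x i = [l]" for i l
    using concat_is_singleton[OF x that] by (simp add: a_def)
  have y1: "l = v (b i)" if "y i = [l]" for i l
    using concat_is_singleton[OF y that] by (simp add: b_def)
  show ?thesis
  proof (cases "copies \<tau>")
    \<comment> \<open>An invalid reply puts the word into the language, whatever the run
      was.\<close>
    case False
    then have "\<exists>m. \<forall>j\<ge>m. good (run \<tau> j)" using not_copies_calm calm_good by blast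
    then show ?thesis using \<tau> unfolding game_lang_def \<tau>_def[symmetric] by blast
  next
    case True
    note hd = head_of_run[OF True, unfolded parts]
    define c where "c j = fst (run \<tau> j)" for j
    have c_Suc: "c (Suc j) = step_ctl (c j) (\<tau> j)" for j by (simp add: c_def run_Suc step_cfg_def)
    define verd where "verd \<longleftrightarrow> (\<exists>j r z. snd (c j) = Test r z \<and> good (run \<tau> j))"
    define bal where "bal m r i j \<longleftrightarrow> (case m of Equal \<Rightarrow> count 1 r \<tau> i = count (-1) r \<tau> j
        | More \<Rightarrow> count (-1) r \<tau> j < count 1 r \<tau> i | Fewer \<Rightarrow> count 1 r \<tau> i < count (-1) r \<tau> j)"
      for m r i j
    \<comment> \<open>\<open>a i\<close> and \<open>b i\<close> are the positions of the two heads.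
      As long as they move independently, neither has passed a test, which forces them to the same
      position when both have stopped.\<close>
    have inv: "q i = TInit \<and> a i = 0 \<and> b i = 0 \<or> (q i = TSync (c (a i)) \<and> a i = b i) \<or>
        (\<exists>r m. q i = THeads r m (head_of (c (a i))) (head_of (c (b i))) \<and> bal m r (a i) (b i) \<and>
          (\<forall>j<a i. \<not> stopped (snd (c j))) \<and> (\<forall>j<b i. \<not> stopped (snd (c j)))) \<or>
        (\<exists>e. q i = TFin e \<and> (e = c (a i) \<and> a i = b i \<and> calm e \<or> verd))" for i
    proof (induction i)
      case 0
      then show ?case by (simp add: q0 ab0)
    next
      case (Suc i)
      from Suc.IH consider "q i = TInit" "a i = 0" "b i = 0"
        | "q i = TSync (c (a i))" "a i = b i"
        | r m where "q i = THeads r m (head_of (c (a i))) (head_of (c (b i)))" "bal m r (a i) (b i)"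
          "\<forall>j<a i. \<not> stopped (snd (c j))" "\<forall>j<b i. \<not> stopped (snd (c j))"
        | e where "q i = TFin e" "e = c (a i) \<and> a i = b i \<and> calm e \<or> verd"
        by (elim disjE exE conjE) blast+
      then show ?case
      proof cases
        case 1
        have "ta_step TInit (x i) (y i) (q (Suc i))" using step[of i] 1 by simp
        then show ?thesis
          by cases (use 1 in \<open>auto simp: aS c_def run_0 head_of_def init_ctl_def bal_def count_simps\<close>)
      next
        case 2
        have "ta_step (TSync (c (a i))) (x i) (y i) (q (Suc i))" using step[of i] 2 by simp
        then show ?thesis
        proof cases
          case (sync l k)
          then show ?thesis using 2 x1[OF sync(1)] y1[OF sync(2)] by (simp add: aS c_Suc \<tau>_uv)
        next
          case commit
          then show ?thesis using 2 by (simp add: aS)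
        qed
      next
        case (3 r m)
        have "ta_step (THeads r m (head_of (c (a i))) (head_of (c (b i)))) (x i) (y i) (q (Suc i))"
          using step[of i] 3 by simp
        then show ?thesis
        proof cases
          case (left l m')
          then have ns: "\<not> stopped (snd (c (a i)))" by (simp add: head_of_def)
          have d: "head_delta (head_of (c (a i))) l r = step_delta (c (a i)) (\<tau> (a i)) r"
            using hd(3)[of "a i"] x1[OF left(1)] by (simp add: c_def)
          have "bal m' r (Suc (a i)) (b i)"
            using left(8) 3(2) unfolding d
            by (cases m; cases m') (auto simp: bal_def count_simps c_def)
          then show ?thesis
            using left(1-3) 3 ns hd(1)[of "a i"] x1[OF left(1)] by (auto simp: aS less_Suc_eq c_def)
        next
          case (right l m')
          then have ns: "\<not> stopped (snd (c (b i)))" by (simp add: head_of_def)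
          have d: "head_delta (head_of (c (b i))) l r = step_delta (c (b i)) (\<tau> (b i)) r"
            using hd(4)[of "b i"] y1[OF right(2)] by (simp add: c_def)
          have "bal m' r (a i) (Suc (b i))"
            using right(8) 3(2) unfolding d
            by (cases m; cases m') (auto simp: bal_def count_simps c_def)
          then show ?thesis
            using right(1-3) 3 ns hd(2)[of "b i"] y1[OF right(2)] by (auto simp: aS less_Suc_eq c_def)
        next
          case (both l k)
          then have ns: "\<not> stopped (snd (c (a i)))" "\<not> stopped (snd (c (b i)))"
            by (simp_all add: head_of_def)
          have d: "head_delta (head_of (c (a i))) l r = step_delta (c (a i)) (\<tau> (a i)) r"
            "head_delta (head_of (c (b i))) k r = step_delta (c (b i)) (\<tau> (b i)) r"
            using hd(3)[of "a i"] hd(4)[of "b i"] x1[OF both(1)] y1[OF both(2)] by (simp_all add: c_def)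
          have "bal m r (Suc (a i)) (Suc (b i))"
            using both(10,11) 3(2) unfolding d
            by (cases m) (auto simp: bal_def count_simps c_def)
          then show ?thesis
            using both(1-3) 3 ns hd(1)[of "a i"] hd(2)[of "b i"] x1[OF both(1)] y1[OF both(2)]
            by (auto simp: aS less_Suc_eq c_def)
        next
          case (verdict z)
          then have st: "snd (c (a i)) = Test r z" "snd (c (b i)) = Test r z"
            by (simp_all add: head_of_def)
          have "a i = b i"
            using st 3(3,4) unfolding stopped_def by (metis linorder_neqE_nat)
          then have "(snd (run \<tau> (a i)) r = 0) = z"
            using verdict(8) 3(2) by (cases m) (auto simp: bal_def run_count)
          then have verd
            unfolding verd_def using st(1) by (cases "run \<tau> (a i)") (auto simp: good_iff c_def intro!: exI[of _ "a i"])
          then show ?thesis using verdict by simp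
        qed
      next
        case (4 e)
        have "ta_step (TFin e) (x i) (y i) (q (Suc i))" using step[of i] 4 by simp
        then show ?thesis
        proof cases
          case (fin l k)
          then show ?thesis using 4 x1[OF fin(1)] y1[OF fin(2)] by (auto simp: aS c_Suc \<tau>_uv)
        qed
      qed
    qed
    obtain i where "q' i \<in> ta_final game_ta" using inf by (auto simp: INFM_nat)
    then have qi: "\<exists>e. q i = TFin e" by (auto simp: q_def game_ta_def)
    \<comment> \<open>Final states read one letter from each tape, so from \<open>a i\<close> on no
      position of the play is skipped.\<close>
    have fin: "(\<exists>e. q k = TFin e) \<and> a k = a i + (k - i)" if "i \<le> k" for k
      using that
    proof (induction k rule: dec_induct)
      case base
      then show ?case using qi by simp
    next
      case (step k)
      then obtain e where "q k = TFin e" by blast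
      with \<open>\<And>i. ta_step (q i) (x i) (y i) (q (Suc i))\<close>[of k]
      have "ta_step (TFin e) (x k) (y k) (q (Suc k))" by simp
      then show ?case by cases (use step in \<open>simp add: aS\<close>)
    qed
    have "\<exists>m. \<forall>j\<ge>m. good (run \<tau> j)"
    proof (cases verd)
      case True
      then show ?thesis using good_Test_stays unfolding verd_def c_def by blast
    next
      case False
      have "good (run \<tau> j)" if "a i \<le> j" for j
      proof -
        define k where "k = i + (j - a i)"
        have k: "i \<le> k" "a k = j" using that fin[of k] by (simp_all add: k_def)
        then show ?thesis using fin[of k] inv[of k] False calm_good[of "run \<tau> j"] by (auto simp: c_def)
      qed
      then show ?thesis by blast
    qed
    then show ?thesis using \<tau> unfolding game_lang_def \<tau>_def[symmetric] by blast
  qed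
qed

section \<open>Construction of accepting runs\<close>

definition ta_path :: "nat word \<Rightarrow> nat word \<Rightarrow> nat \<Rightarrow> nat \<Rightarrow> ta_state \<Rightarrow> bool" where
  "ta_path u v a b p \<longleftrightarrow> (\<exists>n q x y. q 0 = TInit \<and> q n = p \<and>
     (\<forall>i<n. ta_step (q i) (x i) (y i) (q (Suc i))) \<and>
     concat (prefix n x) = prefix a u \<and> concat (prefix n y) = prefix b v)"

lemma ta_path_0: "ta_path u v 0 0 TInit"
  unfolding ta_path_def by (rule exI[of _ 0], rule exI[of _ "\<lambda>_. TInit"]) auto

lemma ta_path_step:
  assumes "ta_path u v a b p" "ta_step p s t p'"
    and "prefix a' u = prefix a u @ s" "prefix b' v = prefix b v @ t"
  shows "ta_path u v a' b' p'"
proof -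
  obtain n q x y where q: "q 0 = TInit" "q n = p"
     "\<forall>i<n. ta_step (q i) (x i) (y i) (q (Suc i))"
     "concat (prefix n x) = prefix a u" "concat (prefix n y) = prefix b v"
    using assms(1) unfolding ta_path_def by blast
  have upd: "prefix n (f(n := z)) = prefix n f" for f :: "nat list word" and z
    by (simp add: subsequence_def)
  have 1: "concat (prefix (Suc n) (x(n := s))) = prefix a' u"
    "concat (prefix (Suc n) (y(n := t))) = prefix b' v"
    by (simp_all add: upd q(4,5) assms(3,4))
  have 2: "\<forall>i<Suc n. ta_step ((q(Suc n := p')) i) ((x(n := s)) i) ((y(n := t)) i) ((q(Suc n := p')) (Suc i))"
  proof (intro allI impI)
    fix i assume "i < Suc n"
    then show "ta_step ((q(Suc n := p')) i) ((x(n := s)) i) ((y(n := t)) i) ((q(Suc n := p')) (Suc i))"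
      using q(2,3) assms(2) by (cases "i = n") simp_all
  qed
  have 3: "(q(Suc n := p')) 0 = TInit" "(q(Suc n := p')) (Suc n) = p'" using q(1) by simp_all
  show ?thesis
    unfolding ta_path_def
    by (rule exI[of _ "Suc n"], rule exI[of _ "q(Suc n := p')"], rule exI[of _ "x(n := s)"],
        rule exI[of _ "y(n := t)"]) (intro conjI 1 2 3)
qed

lemma concat_isI:
  assumes ws: "\<And>k. concat (prefix (N + k) ws) = prefix (a + k) w"
  shows "concat_is ws w"
  unfolding concat_is_def
proof (intro conjI allI)
  fix n
  show "concat (prefix n ws) = prefix (length (concat (prefix n ws))) w"
  proof (cases "n \<le> N")
    case True
    define p where "p = concat (prefix n ws)"
    have "[0..<N] = [0..<n] @ [n..<N]"
      using True upt_add_eq_append[of 0 n "N - n"] by simp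
    then have eq: "prefix a w = p @ concat (map ws [n..<N])"
      using ws[of 0] by (simp add: subsequence_def p_def)
    then have "length (prefix a w) = length p + length (concat (map ws [n..<N]))"
      by (simp del: subsequence_length)
    then have "length p \<le> a" by simp
    then have "take (length p) (prefix a w) = prefix (length p) w"
      by (simp add: subsequence_def take_map)
    then have "p = prefix (length p) w" unfolding eq by simp
    then show ?thesis unfolding p_def .
  next
    case False
    then obtain k where "n = N + k" using le_Suc_ex[of N n] by auto
    then show ?thesis using ws[of k] by simp
  qed
next
  fix m
  show "\<exists>n. m \<le> length (concat (prefix n ws))"
    by (rule exI[of _ "N + m"]) (simp add: ws)
qed

lemma ta_path_accepts:
  assumes path: "ta_path u v a b (TFin e)" and e: "e \<in> ctls"
    and u: "\<And>j. u j < 4" and v: "\<And>j. v j < 4"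
    and calm: "\<And>j. calm (foldl step_ctl e (map (\<lambda>i. prod_encode (u (a + i), v (b + i))) [0..<j]))"
  shows "ta_accepts game_ta u v"
proof -
  obtain n q x y where q: "q 0 = TInit" "q n = TFin e"
     "\<forall>i<n. ta_step (q i) (x i) (y i) (q (Suc i))"
     "concat (prefix n x) = prefix a u" "concat (prefix n y) = prefix b v"
    using path unfolding ta_path_def by blast
  define E where "E j = foldl step_ctl e (map (\<lambda>i. prod_encode (u (a + i), v (b + i))) [0..<j])" for j
  have E: "E 0 = e" "E (Suc j) = step_ctl (E j) (prod_encode (u (a + j), v (b + j)))" for j
    by (simp_all add: E_def)
  have E_in: "E j \<in> ctls" for j by (induction j) (simp_all add: E e step_ctl_in)
  define q' where "q' i = (if i \<le> n then q i else TFin (E (i - n)))" for i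
  define x' where "x' i = (if i < n then x i else [u (a + (i - n))])" for i
  define y' where "y' i = (if i < n then y i else [v (b + (i - n))])" for i
  have step: "ta_step (q' i) (x' i) (y' i) (q' (Suc i))" for i
  proof (cases "i < n")
    case True
    then show ?thesis using q(3) by (simp add: q'_def x'_def y'_def)
  next
    case False
    then obtain j where j: "i = n + j" using le_Suc_ex[of n i] by auto
    have qj: "q' (n + j) = TFin (E j)" for j using q(2) by (simp add: q'_def E)
    have "ta_step (TFin (E j)) [u (a + j)] [v (b + j)] (TFin (E (Suc j)))"
      unfolding E(2) using calm[folded E_def, of "Suc j"] by (intro ta_step.fin E_in u v) (simp add: E)
    then show ?thesis using qj[of j] qj[of "Suc j"] j by (simp add: x'_def y'_def)
  qed
  have eq: "prefix n x' = prefix n x" "prefix n y' = prefix n y"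
    by (simp_all add: x'_def y'_def subsequence_def)
  have xy': "x' (n + k) = [u (a + k)]" "y' (n + k) = [v (b + k)]" for k
    by (simp_all add: x'_def y'_def)
  have "concat (prefix (n + k) x') = prefix (a + k) u" for k
    by (induction k) (simp_all add: q(4) eq xy')
  then have "concat_is x' u" by (rule concat_isI)
  moreover have "concat (prefix (n + k) y') = prefix (b + k) v" for k
    by (induction k) (simp_all add: q(5) eq xy')
  then have "concat_is y' v" by (rule concat_isI)
  moreover have "\<exists>\<^sub>\<infinity>i. to_nat (q' i) \<in> ta_final game_ta"
    unfolding INFM_nat_le
  proof
    fix m
    show "\<exists>i\<ge>m. to_nat (q' i) \<in> ta_final game_ta"
      by (rule exI[of _ "m + Suc n"]) (simp add: q'_def game_ta_def E_in)
  qed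
  moreover have "to_nat (q' 0) = ta_init game_ta" using q(1) by (simp add: q'_def game_ta_def)
  moreover have "(to_nat (q' i), x' i, y' i, to_nat (q' (Suc i))) \<in> ta_trans game_ta" for i
    using step[of i] by (auto simp: game_ta_def)
  ultimately show ?thesis
    unfolding ta_accepts_def
    by - (rule exI[of _ "\<lambda>i. to_nat (q' i)"], rule exI[of _ x'], rule exI[of _ y'], simp)
qed

lemma ta_lang_complete:
  assumes \<sigma>: "\<sigma> \<in> omega_words ({..<4} \<times> {..<4})" and L: "prod_encode \<circ> \<sigma> \<in> game_lang"
  shows "\<sigma> \<in> ta_lang game_ta"
proof -
  define u v \<tau> where "u = fst \<circ> \<sigma>" and "v = snd \<circ> \<sigma>" and "\<tau> = prod_encode \<circ> \<sigma>"
  have parts: "fst_part (\<tau> j) = u j" "snd_part (\<tau> j) = v j" for j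
    by (simp_all add: \<tau>_def u_def v_def)
  have \<tau>_uv: "\<tau> j = prod_encode (u j, v j)" for j by (simp add: \<tau>_def u_def v_def)
  have "\<sigma> j \<in> {..<4} \<times> {..<4}" for j using \<sigma> by (auto simp: omega_words_def)
  then have uv: "u j < 4" "v j < 4" for j
    by (auto simp: u_def v_def mem_Times_iff)
  define c where "c j = fst (run \<tau> j)" for j
  have c_Suc: "c (Suc j) = step_ctl (c j) (prod_encode (u j, v j))" for j
    by (simp add: c_def run_Suc step_cfg_def \<tau>_uv)
  have c_0: "c 0 = init_ctl" by (simp add: c_def run_0)
  have c_in: "c j \<in> ctls" for j by (simp add: c_def run_in_ctls)
  have calm_case: "ta_accepts game_ta u v" if calm: "\<And>j. k \<le> j \<Longrightarrow> calm (c j)" for k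
  proof (rule ta_path_accepts)
    have sync: "ta_path u v k k (TSync (c k))" for k
    proof (induction k)
      case 0
      show ?case
        unfolding c_0 by (rule ta_path_step[OF ta_path_0 ta_step.init_sync]) simp_all
    next
      case (Suc k)
      show ?case
        unfolding c_Suc by (rule ta_path_step[OF Suc ta_step.sync[OF c_in uv(1,2)]]) simp_all
    qed
    show "ta_path u v k k (TFin (c k))"
      by (rule ta_path_step[OF sync ta_step.commit[OF c_in calm]]) simp_all
    have "foldl step_ctl (c k) (map (\<lambda>i. prod_encode (u (k + i), v (k + i))) [0..<j]) = c (k + j)" for j
      by (induction j) (simp_all add: c_Suc)
    then show "calm (foldl step_ctl (c k) (map (\<lambda>i. prod_encode (u (k + i), v (k + i))) [0..<j]))" for j
      using calm by simp
  qed (rule c_in uv)+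
  have "ta_accepts game_ta u v"
  proof (cases "copies \<tau>")
    case False
    then show ?thesis using not_copies_calm calm_case unfolding c_def by blast
  next
    case True
    note hd = head_of_run[OF True, unfolded parts, folded c_def]
    from L[folded \<tau>_def] show ?thesis
    proof (cases rule: game_lang_cases)
      case (calm k)
      then show ?thesis using calm_case unfolding c_def by blast
    next
      case (test k r z)
      \<comment> \<open>The test may have been entered before time \<open>k\<close>. The heads stop
        at its first occurrence \<open>T\<close>, and \<open>Test_stays\<close> shows that the
        outcome known at \<open>k\<close> is that at \<open>T\<close>.\<close>
      define T where "T = (LEAST j. stopped (snd (c j)))"
      have "stopped (snd (c k))" using test(1) by (simp add: stopped_def c_def)
      then have T: "stopped (snd (c T))" "T \<le> k"
        unfolding T_def by (rule LeastI, rule Least_le)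
      have before: "\<not> stopped (snd (c j))" if "j < T" for j
        using that unfolding T_def by (rule not_less_Least)
      obtain r' z' where T': "snd (fst (run \<tau> T)) = Test r' z'"
        using T(1) by (auto simp: stopped_def c_def)
      from Test_stays[OF T(2) T'] test have rz: "r' = r" "z' = z" "(snd (run \<tau> T) r = 0) = z"
        by auto
      define h where "h j = head_of (c j)" for j
      have h_in: "h j \<in> heads" for j by (simp add: h_def head_of_in c_in)
      have ns: "\<not> stopped (snd (h j))" if "j < T" for j
        using before[OF that] by (simp add: h_def head_of_def)
      have h_Suc: "h (Suc j) = head_step (h j) (u j)" "h (Suc j) = head_step (h j) (v j)"
        "head_delta (h j) (u j) r = step_delta (c j) (\<tau> j) r"
        "head_delta (h j) (v j) r = step_delta (c j) (\<tau> j) r" for j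
        using hd[of j] by (simp_all add: h_def)
      let ?P = "count 1 r \<tau>" and ?N = "count (-1) r \<tau>"
      have cnt: "?P (Suc j) = ?P j + of_bool (step_delta (c j) (\<tau> j) r = 1)"
        "?N (Suc j) = ?N j + of_bool (step_delta (c j) (\<tau> j) r = -1)" for j
        by (simp_all add: count_simps c_def)
      have left: "ta_path u v (Suc i) j (THeads r m' (h (Suc i)) (h j))"
        if "ta_path u v i j (THeads r m (h i) (h j))" "i < T"
          "step_delta (c i) (\<tau> i) r \<noteq> 1 \<and> m' = m \<or> step_delta (c i) (\<tau> i) r = 1 \<and> m \<noteq> Fewer \<and> m' = More"
        for i j m m'
        unfolding h_Suc(1)
        by (rule ta_path_step[OF that(1) ta_step.left[OF h_in h_in uv(1) ns[OF that(2)]]])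
          (use that(3) in \<open>simp_all add: h_Suc(3)\<close>)
      have right: "ta_path u v i (Suc j) (THeads r m' (h i) (h (Suc j)))"
        if "ta_path u v i j (THeads r m (h i) (h j))" "j < T"
          "step_delta (c j) (\<tau> j) r \<noteq> -1 \<and> m' = m \<or> step_delta (c j) (\<tau> j) r = -1 \<and> m \<noteq> More \<and> m' = Fewer"
        for i j m m'
        unfolding h_Suc(2)
        by (rule ta_path_step[OF that(1) ta_step.right[OF h_in h_in uv(2) ns[OF that(2)]]])
          (use that(3) in \<open>simp_all add: h_Suc(4)\<close>)
      \<comment> \<open>The path is found backwards: a last letter that is no increment,
        respectively no decrement, is removed from its tape alone; otherwise an increment and a
        decrement are removed together. The surplus of one side is read afterwards, in
        \<open>more\<close> and \<open>fewer\<close>.\<close>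
      have equal: "ta_path u v i j (THeads r Equal (h i) (h j))"
        if "i \<le> T" "j \<le> T" "?P i = ?N j" for i j
        using that
      proof (induction "i + j" arbitrary: i j rule: less_induct)
        case less
        show ?case
        proof (cases i)
          case i: 0
          show ?thesis
          proof (cases j)
            case 0
            have "h 0 = (False, snd init_ctl)"
              by (simp add: h_def c_0 head_of_def init_ctl_def)
            moreover have "ta_path u v 0 0
                (THeads r Equal (False, snd init_ctl) (False, snd init_ctl))"
              by (rule ta_path_step[OF ta_path_0 ta_step.init_heads]) simp_all
            ultimately show ?thesis using i 0 by simp
          next
            case (Suc j')
            then have "step_delta (c j') (\<tau> j') r \<noteq> -1" "?P i = ?N j'"
              using less.prems(3) i by (auto simp: cnt count_simps(1))
            then show ?thesis using less.hyps[of i j'] less.prems Suc by (auto intro!: right)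
          qed
        next
          case i: (Suc i')
          show ?thesis
          proof (cases "step_delta (c i') (\<tau> i') r = 1")
            case False
            then show ?thesis using less.hyps[of i' j] less.prems i cnt(1)[of i'] by (auto intro!: left)
          next
            case inc: True
            then obtain j' where j: "j = Suc j'"
              using less.prems(3) i cnt(1)[of i'] by (cases j) (auto simp: count_simps(1))
            show ?thesis
            proof (cases "step_delta (c j') (\<tau> j') r = -1")
              case False
              then show ?thesis
                using less.hyps[of i j'] less.prems j cnt(2)[of j'] by (auto intro!: right)
            next
              case dec: True
              have "ta_path u v i' j' (THeads r Equal (h i') (h j'))"
                using less.hyps[of i' j'] less.prems i j inc dec cnt(1)[of i'] cnt(2)[of j'] by auto
              moreover have "ta_step (THeads r Equal (h i') (h j')) [u i'] [v j']
                  (THeads r Equal (head_step (h i') (u i')) (head_step (h j') (v j')))"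
                using less.prems i j inc dec by (intro ta_step.both h_in uv ns) (simp_all add: h_Suc)
              ultimately show ?thesis
                unfolding i j h_Suc(1)[of i'] h_Suc(2)[of j'] by (rule ta_path_step) simp_all
            qed
          qed
        qed
      qed
      have more: "ta_path u v i j (THeads r More (h i) (h j))"
        if "i \<le> T" "j \<le> T" "?N j < ?P i" for i j
        using that
      proof (induction i)
        case (Suc i)
        show ?case
        proof (cases "step_delta (c i) (\<tau> i) r = 1 \<and> ?P i = ?N j")
          case True
          then show ?thesis using equal[of i j] Suc.prems by (auto intro!: left[of i j Equal])
        next
          case False
          then have "?N j < ?P i" using Suc.prems(3) cnt(1)[of i]
            by (cases "step_delta (c i) (\<tau> i) r = 1") auto
          then show ?thesis using Suc by (auto intro!: left[of i j More])
        qed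
      qed (simp add: count_simps)
      have fewer: "ta_path u v i j (THeads r Fewer (h i) (h j))"
        if "i \<le> T" "j \<le> T" "?P i < ?N j" for i j
        using that
      proof (induction j)
        case (Suc j)
        show ?case
        proof (cases "step_delta (c j) (\<tau> j) r = -1 \<and> ?P i = ?N j")
          case True
          then show ?thesis using equal[of i j] Suc.prems by (auto intro!: right[of i j Equal])
        next
          case False
          then have "?P i < ?N j" using Suc.prems(3) cnt(2)[of j]
            by (cases "step_delta (c j) (\<tau> j) r = -1") auto
          then show ?thesis using Suc by (auto intro!: right[of i j Fewer])
        qed
      qed (simp add: count_simps)
      have "\<exists>m. ta_path u v T T (THeads r m (h T) (h T)) \<and> (m = Equal) = z"
        using equal[of T T] more[of T T] fewer[of T T] rz(3) unfolding run_count
        by (cases "?P T" "?N T" rule: linorder_cases) auto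
      then obtain m where m: "ta_path u v T T (THeads r m (h T) (h T))" "(m = Equal) = z" by blast
      have hT: "snd (h T) = Test r z" using T' rz by (simp add: h_def head_of_def c_def)
      show ?thesis
      proof (rule ta_path_accepts)
        show "ta_path u v T T (TFin (None, Tru))"
          by (rule ta_path_step[OF m(1) ta_step.verdict[OF h_in h_in hT hT m(2)]]) simp_all
      qed (simp_all add: Tru_ctls uv calm_def foldl_step_ctl_Tru)
    qed
  qed
  then show ?thesis using \<sigma> by (simp add: ta_lang_def game_ta_def u_def v_def)
qed

theorem ta_lang_game_ta:
  "ta_lang game_ta = {\<sigma> \<in> omega_words ({..<4} \<times> {..<4}). prod_encode \<circ> \<sigma> \<in> game_lang}"
  using ta_lang_sound ta_lang_complete by (auto simp: ta_lang_def game_ta_def)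

section \<open>Renaming the letters of a game\<close>

context
  fixes c :: "'a \<Rightarrow> nat" and d :: "nat \<Rightarrow> 'a" and X :: "'a set" and L :: "nat word set"
  assumes dc: "\<And>x. d (c x) = x"
begin

lemma map_positions2: "positions2 (c ` X) = map c ` positions2 X"
proof (intro equalityI subsetI)
  fix w assume w: "w \<in> positions2 (c ` X)"
  then have "w = map c (map d w)"
    using dc by (auto simp: positions2_def intro!: nth_equalityI) (metis imageE in_listsD nth_mem)
  moreover have "map d w \<in> positions2 X"
    using w dc by (auto simp: positions2_def) (metis imageE)
  ultimately show "w \<in> map c ` positions2 X" by blast
qed (auto simp: positions2_def)

lemma winning2_preimage:
  assumes "winning2 (c ` X) L g"
  shows "winning2 X {\<sigma> \<in> omega_words X. c \<circ> \<sigma> \<in> L} (\<lambda>w. d (g (map c w)))"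
proof -
  have g: "g (map c w) \<in> c ` X" if "w \<in> positions2 X" for w
    using assms that map_positions2 by (auto simp: winning2_def strategy2_def)
  have "follows2 g (c \<circ> \<sigma>)" if "\<sigma> \<in> omega_words X" "follows2 (\<lambda>w. d (g (map c w))) \<sigma>" for \<sigma>
    unfolding follows2_def
  proof (intro allI impI)
    fix i :: nat assume i: "odd i"
    have "prefix i \<sigma> \<in> positions2 X"
      using that(1) i by (auto simp: positions2_def omega_words_def subsequence_def image_subset_iff)
    from g[OF this] have "c (d (g (map c (prefix i \<sigma>)))) = g (map c (prefix i \<sigma>))"
      using dc by auto
    then show "(c \<circ> \<sigma>) i = g (prefix i (c \<circ> \<sigma>))"
      using that(2) i by (simp add: follows2_def subsequence_def)
  qed
  moreover have "c \<circ> \<sigma> \<in> omega_words (c ` X)" if "\<sigma> \<in> omega_words X" for \<sigma>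
    using that by (auto simp: omega_words_def)
  ultimately show ?thesis
    using assms g dc by (fastforce simp: winning2_def strategy2_def)
qed

lemma winning2_image:
  assumes "winning2 X {\<sigma> \<in> omega_words X. c \<circ> \<sigma> \<in> L} f"
  shows "winning2 (c ` X) L (\<lambda>w. c (f (map d w)))"
  unfolding winning2_def
proof (intro conjI ballI impI)
  show "strategy2 (c ` X) (\<lambda>w. c (f (map d w)))"
    using assms dc by (auto simp: winning2_def strategy2_def map_positions2 comp_def)
next
  fix \<sigma> assume \<sigma>: "\<sigma> \<in> omega_words (c ` X)" and fol: "follows2 (\<lambda>w. c (f (map d w))) \<sigma>"
  have cd: "c \<circ> (d \<circ> \<sigma>) = \<sigma>"
  proof
    fix i
    have "\<sigma> i \<in> c ` X" using \<sigma> by (auto simp: omega_words_def)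
    then show "(c \<circ> (d \<circ> \<sigma>)) i = \<sigma> i" using dc by auto
  qed
  have "d \<circ> \<sigma> \<in> omega_words X"
    using \<sigma> dc by (fastforce simp: omega_words_def)
  moreover have "follows2 f (d \<circ> \<sigma>)"
    using fol dc by (simp add: follows2_def subsequence_def)
  ultimately show "\<sigma> \<notin> L" using assms cd by (auto simp: winning2_def)
qed

text \<open>A letter enters the code of a strategy only through its number, so renaming by
  \<open>c\<close> leaves the coded set, and with it its complexity, unchanged.\<close>

lemma strategy_code_image:
  "strategy_code id (c ` X) (\<lambda>w. c (f (map d w))) = strategy_code c X f"
  using dc by (simp add: strategy_code_def map_positions2 image_image comp_def)

end

theorem theorem3p19:
  "\<exists>(A :: (nat, nat) counter_aut) (B :: (nat, nat, nat) tape2_aut).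
     rt_counter_buchi A \<and> tape2_buchi B \<and>
     Delta0 id (ca_alphabet A) 3 (ca_lang A) \<and>
     Delta0 prod_encode (ta_in B \<times> ta_out B) 3 (ta_lang B) \<and>
     (\<exists>f. winning2 (ca_alphabet A) (ca_lang A) f) \<and>
     (\<exists>f. winning2 (ta_in B \<times> ta_out B) (ta_lang B) f) \<and>
     \<not> (\<exists>f. winning2 (ca_alphabet A) (ca_lang A) f \<and>
            hyperarithmetical (strategy_code id (ca_alphabet A) f)) \<and>
     \<not> (\<exists>f. winning2 (ta_in B \<times> ta_out B) (ta_lang B) f \<and>
            hyperarithmetical (strategy_code prod_encode (ta_in B \<times> ta_out B) f))"
proof -
  let ?X = "{..<4} \<times> {..<4} :: (nat \<times> nat) set"
  have alph: "ca_alphabet game_ca = letters" "ta_in game_ta \<times> ta_out game_ta = ?X"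
    by (simp_all add: game_ca_def game_ta_def)
  have win: "winning2 letters game_lang strategy"
    by (rule strategy_winning[OF not_sem_init])
  have no_win: "\<not> hyperarithmetical (strategy_code prod_encode ?X f)"
    if "winning2 ?X (ta_lang game_ta) f" for f
    using no_hyperarithmetical_winning_strategy[of "\<lambda>w. prod_encode (f (map prod_decode w))"]
      winning2_image[of prod_decode prod_encode ?X game_lang f] that
      strategy_code_image[of prod_decode prod_encode ?X f]
    by (simp add: ta_lang_game_ta letters_def)
  show ?thesis
  proof (rule exI[of _ game_ca], rule exI[of _ game_ta], unfold alph, intro conjI)
    show "rt_counter_buchi game_ca" "tape2_buchi game_ta"
      by (rule rt_counter_buchi_game_ca tape2_buchi_game_ta)+
    show "Delta0 id letters 3 (ca_lang game_ca)"
      unfolding ca_lang_game_ca by (rule Delta0_game_lang)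
    show "Delta0 prod_encode ?X 3 (ta_lang game_ta)"
      unfolding ta_lang_game_ta
      by (rule Delta0_vimage[OF Delta0_game_lang[unfolded letters_def]])
    show "\<exists>f. winning2 letters (ca_lang game_ca) f"
      unfolding ca_lang_game_ca using win by blast
    show "\<exists>f. winning2 ?X (ta_lang game_ta) f"
      unfolding ta_lang_game_ta
      using winning2_preimage[OF prod_encode_inverse win[unfolded letters_def]] by blast
    show "\<not> (\<exists>f. winning2 letters (ca_lang game_ca) f \<and> hyperarithmetical (strategy_code id letters f))"
      unfolding ca_lang_game_ca using no_hyperarithmetical_winning_strategy by blast
    show "\<not> (\<exists>f. winning2 ?X (ta_lang game_ta) f \<and>
        hyperarithmetical (strategy_code prod_encode ?X f))"
      using no_win by blast
  qed
qed

end
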